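(* Let $n\ge 1$. There are no (nontrivial) linear relations among the images of $\{\underline{x}^{\underline{r}}\,\partial^B_w\}_{w\in B_n,\ \underline{r}\in\mathbb{N}^n}$ in $\mathrm{End}(\mathrm{Pol}_n^-)$, nor among the images of $\{\partial^B_w\,\underline{x}^{\underline{r}}\}_{w\in B_n,\ \underline{r}\in\mathbb{N}^n}$ in $\mathrm{End}(\mathrm{Pol}_n^-)$. Thus each of these two sets forms a $\mathbb{Z}$-basis of the spin type B nilHecke algebra ${}^{B}\mathrm{NH}_n^-$.
   Context: $\mathrm{Pol}_n^-$ is the unital $\mathbb{Z}$-algebra generated by $x_1,\dots,x_n$ subject to $x_ix_j+x_jx_i=0$ for all $i\ne j$; $\mathrm{End}(\mathrm{Pol}_n^-)$ is its ring of $\mathbb{Z}$-module endomorphisms. The spin type B nilHecke algebra ${}^{B}\mathrm{NH}_n^-$ is the unital $\mathbb{Z}$-algebra generated by $x_1,\dots,x_n$, $\partial_1^-,\dots,\partial_{n-1}^-$, $\partial_n^B$ subject to $x_ix_j+x_jx_i=0$ ($i\neq j$) and, for $1\le i\le n-1$ (whenever the indices make sense): $(\partial_i^-)^2=0$; $\partial_i^-\partial_{i+1}^-\partial_i^-=\partial_{i+1}^-\partial_i^-\partial_{i+1}^-$; $\partial_i^-\partial_j^-+\partial_j^-\partial_i^-=0$ for $|i-j|>1$; $x_i\partial_i^-+\partial_i^-x_{i+1}=1$; $\partial_i^-x_i+x_{i+1}\partial_i^-=1$; $\partial_i^-x_j+x_j\partial_i^-=0$ for $j\ne i,i+1$; and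 $(\partial_n^B)^2=0$; $\partial_n^B\partial_{n-1}^-\partial_n^B\partial_{n-1}^-=-\partial_{n-1}^-\partial_n^B\partial_{n-1}^-\partial_n^B$; $\partial_n^B\partial_i^-+\partial_i^-\partial_n^B=0$ for $1\le i\le n-2$; $\partial_n^Bx_n+x_n\partial_n^B=1$; $\partial_n^Bx_i+x_i\partial_n^B=0$ for $1\le i\le n-1$. It acts on $\mathrm{Pol}_n^-$ as follows. The $x_i$ act by left multiplication. For $1\le i\le n-1$ let $s_i$ be the algebra endomorphism of $\mathrm{Pol}_n^-$ with $s_i(x_i)=-x_{i+1}$, $s_i(x_{i+1})=-x_i$, $s_i(x_j)=-x_j$ for $j\ne i,i+1$, and let $s_n^B$ be the algebra endomorphism with $s_n^B(x_j)=-x_j$ for all $j$. Then $\partial_i^-$ and $\partial_n^B$ act as the $\mathbb{Z}$-linear (odd Demazure) operators that kill $1$ and satisfy: $\partial_i^-(x_j)=1$ if $j\in\{i,i+1\}$ and $0$ otherwise; $\partial_n^B(x_j)=1$ if $j=n$ and $0$ otherwise; $\partial_i^-(fg)=\partial_i^-(f)g+s_i(f)\partial_i^-(g)$, $\partial_n^B(fg)=\partial_n^B(f)g+s_n^B(f)\partial_n^B(g)$. $B_n=\langle s_1,\dots,s_n\rangle$ is the Weyl group of type $B_n$ with simple reflections $s_1,\dots,s_{n-1}$ (generating $S_n$) and $s_n$, where $(s_{n-1}s_n)^4=1$ and $s_n$ commutes with $s_i$ for $i\le n-2$. Write $\partial_{i}:=\partial_i^-$ for $i<n$, $\partial_n:=\partial_n^B$.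 For each $w\in B_n$ a reduced expression $w=s_{i_1}\cdots s_{i_\ell}$ is chosen and $\partial_w^B:=\partial_{i_1}\cdots\partial_{i_\ell}$ (well defined up to sign). For $\underline{r}=(r_1,\dots,r_n)\in\mathbb{N}^n$ (with $0\in\mathbb{N}$), $\underline{x}^{\underline{r}}=x_1^{r_1}\cdots x_n^{r_n}$. *)

theory Defs
  imports "HOL-Library.Poly_Mapping" "HOL-Algebra.Algebra"
begin

section \<open>Algebras given by generators and relations\<close>

text \<open>Words under concatenation, written additively so that \<^typ>\<open>'m \<Rightarrow>\<^sub>0 int\<close> over them
  is the monoid algebra, i.e. the free unital associative algebra over the integers.\<close>

datatype 'g free_monoid = FM (letters: "'g list")

instantiation free_monoid :: (type) monoid_add
begin
definition zero_free_monoid :: "'a free_monoid" where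
  "0 = FM []"
definition plus_free_monoid :: "'a free_monoid \<Rightarrow> 'a free_monoid \<Rightarrow> 'a free_monoid" where
  "u + v = FM (letters u @ letters v)"
instance
  by standard (simp_all add: zero_free_monoid_def plus_free_monoid_def)
end

type_synonym 'g free_elt = "'g free_monoid \<Rightarrow>\<^sub>0 int"

definition free_gen :: "'g \<Rightarrow> 'g free_elt" where
  "free_gen g = Poly_Mapping.single (FM [g]) 1"

definition free_alg :: "'g set \<Rightarrow> 'g free_elt ring" where
  "free_alg G =
    \<lparr>carrier = {f. \<forall>w \<in> Poly_Mapping.keys f. set (letters w) \<subseteq> G},
     monoid.mult = (*), one = 1, ring.zero = 0, ring.add = (+)\<rparr>"

text \<open>A relation \<open>a = b\<close> is encoded by the element \<open>a - b\<close>; \<^const>\<open>genideal\<close> is the two-sided ideal.\<close>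

definition presented_alg :: "'g set \<Rightarrow> 'g free_elt set \<Rightarrow> 'g free_elt set ring" where
  "presented_alg G R = free_alg G Quot genideal (free_alg G) R"

definition presented_class :: "'g set \<Rightarrow> 'g free_elt set \<Rightarrow> 'g free_elt \<Rightarrow> 'g free_elt set" where
  "presented_class G R f = genideal (free_alg G) R +>\<^bsub>free_alg G\<^esub> f"


section \<open>The skew polynomial algebra and the spin type B nilHecke algebra\<close>

text \<open>\<open>GenD i\<close> stands for \<open>\<partial>\<^sub>i\<^sup>-\<close> when \<open>i < n\<close>, and \<open>GenD n\<close> stands for \<open>\<partial>\<^sub>n\<^sup>B\<close>.\<close>

datatype generator = GenX nat | GenD nat

abbreviation xvar :: "nat \<Rightarrow> generator free_elt" where "xvar i \<equiv> free_gen (GenX i)"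
abbreviation del :: "nat \<Rightarrow> generator free_elt" where "del i \<equiv> free_gen (GenD i)"

definition pol_gens :: "nat \<Rightarrow> generator set" where
  "pol_gens n = GenX ` {1..n}"

definition pol_rels :: "nat \<Rightarrow> generator free_elt set" where
  "pol_rels n = {xvar i * xvar j + xvar j * xvar i | i j. i \<in> {1..n} \<and> j \<in> {1..n} \<and> i \<noteq> j}"

definition Pol :: "nat \<Rightarrow> generator free_elt set ring" where
  "Pol n = presented_alg (pol_gens n) (pol_rels n)"

definition pol_x :: "nat \<Rightarrow> nat \<Rightarrow> generator free_elt set" where
  "pol_x n i = presented_class (pol_gens n) (pol_rels n) (xvar i)"

definition nh_gens :: "nat \<Rightarrow> generator set" where
  "nh_gens n = GenX ` {1..n} \<union> GenD ` {1..n}"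

definition nh_rels :: "nat \<Rightarrow> generator free_elt set" where
  "nh_rels n =
     pol_rels n
   \<union> {del i * del i | i. i \<in> {1..<n}}
   \<union> {del i * del (i+1) * del i - del (i+1) * del i * del (i+1) | i. 1 \<le> i \<and> i + 1 < n}
   \<union> {del i * del j + del j * del i | i j.
        i \<in> {1..<n} \<and> j \<in> {1..<n} \<and> \<bar>int i - int j\<bar> > 1}
   \<union> {xvar i * del i + del i * xvar (i+1) - 1 | i. i \<in> {1..<n}}
   \<union> {del i * xvar i + xvar (i+1) * del i - 1 | i. i \<in> {1..<n}}
   \<union> {del i * xvar j + xvar j * del i | i j.
        i \<in> {1..<n} \<and> j \<in> {1..n} \<and> j \<noteq> i \<and> j \<noteq> i + 1}
   \<union> {del n * del n}
   \<union> (if 2 \<le> n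
      then {del n * del (n-1) * del n * del (n-1) + del (n-1) * del n * del (n-1) * del n} else {})
   \<union> {del n * del i + del i * del n | i. 1 \<le> i \<and> i + 2 \<le> n}
   \<union> {del n * xvar n + xvar n * del n - 1}
   \<union> {del n * xvar i + xvar i * del n | i. i \<in> {1..<n}}"

definition NH :: "nat \<Rightarrow> generator free_elt set ring" where
  "NH n = presented_alg (nh_gens n) (nh_rels n)"

definition nh_class :: "nat \<Rightarrow> generator free_elt \<Rightarrow> generator free_elt set" where
  "nh_class n f = presented_class (nh_gens n) (nh_rels n) f"


section \<open>The action by odd Demazure operators\<close>

text \<open>Maps on a carrier are normalised to be \<^const>\<open>extensional\<close>, so that the definite
  descriptions below have exactly one solution.\<close>

definition End_ring :: "('a, 'm) ring_scheme \<Rightarrow> ('a \<Rightarrow> 'a) ring" where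
  "End_ring A =
    \<lparr>carrier = hom (add_monoid A) (add_monoid A) \<inter> extensional (carrier A),
     monoid.mult = compose (carrier A),
     one = (\<lambda>a \<in> carrier A. a),
     ring.zero = (\<lambda>a \<in> carrier A. \<zero>\<^bsub>A\<^esub>),
     ring.add = (\<lambda>f g. \<lambda>a \<in> carrier A. f a \<oplus>\<^bsub>A\<^esub> g a)\<rparr>"

text \<open>For \<open>i < n\<close> this is \<open>s\<^sub>i\<close>, for \<open>i = n\<close> it is \<open>s\<^sub>n\<^sup>B\<close>.\<close>

definition odd_refl :: "nat \<Rightarrow> nat \<Rightarrow> generator free_elt set \<Rightarrow> generator free_elt set" where
  "odd_refl n i = (THE s. s \<in> ring_hom (Pol n) (Pol n) \<inter> extensional (carrier (Pol n)) \<and>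
     (\<forall>j \<in> {1..n}. s (pol_x n j) =
        (if i < n \<and> j = i then \<ominus>\<^bsub>Pol n\<^esub> pol_x n (i + 1)
         else if i < n \<and> j = i + 1 then \<ominus>\<^bsub>Pol n\<^esub> pol_x n i
         else \<ominus>\<^bsub>Pol n\<^esub> pol_x n j)))"

text \<open>For \<open>i = n\<close> the index \<open>i + 1\<close> is out of range, so only \<open>x\<^sub>n\<close> is sent to 1.\<close>

definition odd_demazure :: "nat \<Rightarrow> nat \<Rightarrow> generator free_elt set \<Rightarrow> generator free_elt set" where
  "odd_demazure n i = (THE d. d \<in> carrier (End_ring (Pol n)) \<and>
     d \<one>\<^bsub>Pol n\<^esub> = \<zero>\<^bsub>Pol n\<^esub> \<and>
     (\<forall>j \<in> {1..n}. d (pol_x n j) = (if j \<in> {i, i + 1} then \<one>\<^bsub>Pol n\<^esub> else \<zero>\<^bsub>Pol n\<^esub>)) \<and>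
     (\<forall>f \<in> carrier (Pol n). \<forall>g \<in> carrier (Pol n).
        d (f \<otimes>\<^bsub>Pol n\<^esub> g) = d f \<otimes>\<^bsub>Pol n\<^esub> g \<oplus>\<^bsub>Pol n\<^esub> odd_refl n i f \<otimes>\<^bsub>Pol n\<^esub> d g))"

definition nh_action ::
  "nat \<Rightarrow> generator free_elt set \<Rightarrow> generator free_elt set \<Rightarrow> generator free_elt set" where
  "nh_action n = (THE \<rho>. \<rho> \<in> ring_hom (NH n) (End_ring (Pol n)) \<inter> extensional (carrier (NH n)) \<and>
     (\<forall>i \<in> {1..n}. \<rho> (nh_class n (xvar i)) = (\<lambda>f \<in> carrier (Pol n). pol_x n i \<otimes>\<^bsub>Pol n\<^esub> f)) \<and>
     (\<forall>i \<in> {1..n}. \<rho> (nh_class n (del i)) = odd_demazure n i))"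


section \<open>The Weyl group of type B\<close>

text \<open>Signed permutations: \<open>-j\<close> stands for the negative of the \<open>j\<close>-th standard basis vector,
  so that the last simple reflection is the sign change of the \<open>n\<close>-th coordinate.\<close>

definition simple_refl :: "nat \<Rightarrow> nat \<Rightarrow> int \<Rightarrow> int" where
  "simple_refl n i =
    (if i < n
     then Transposition.transpose (int i) (int i + 1) \<circ> Transposition.transpose (- int i) (- int i - 1)
     else Transposition.transpose (int n) (- int n))"

definition weyl_B :: "nat \<Rightarrow> (int \<Rightarrow> int) set" where
  "weyl_B n = generate (BijGroup UNIV) (simple_refl n ` {1..n})"

definition word_prod :: "nat \<Rightarrow> nat list \<Rightarrow> int \<Rightarrow> int" where
  "word_prod n ks = foldr (\<circ>) (map (simple_refl n) ks) id"

definition reduced_expression :: "nat \<Rightarrow> (int \<Rightarrow> int) \<Rightarrow> nat list \<Rightarrow> bool" where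
  "reduced_expression n w ks \<longleftrightarrow>
     set ks \<subseteq> {1..n} \<and> word_prod n ks = w \<and>
     (\<forall>ls. set ls \<subseteq> {1..n} \<and> word_prod n ls = w \<longrightarrow> length ks \<le> length ls)"


section \<open>Monomials, integral linear independence and bases\<close>

definition x_monomial :: "nat \<Rightarrow> (nat \<Rightarrow> nat) \<Rightarrow> generator free_elt" where
  "x_monomial n r = prod_list (map (\<lambda>i. xvar i ^ r i) [1..<Suc n])"

definition del_word :: "nat list \<Rightarrow> generator free_elt" where
  "del_word ks = prod_list (map del ks)"

definition exponents :: "nat \<Rightarrow> (nat \<Rightarrow> nat) set" where
  "exponents n = {1..n} \<rightarrow>\<^sub>E UNIV"

text \<open>Both notions are about families: in an independent family distinct indices give distinct elements.\<close>

definition int_independent :: "('a, 'm) ring_scheme \<Rightarrow> ('i \<Rightarrow> 'a) \<Rightarrow> 'i set \<Rightarrow> bool" where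
  "int_independent A v I \<longleftrightarrow> v \<in> I \<rightarrow> carrier A \<and>
     (\<forall>F c. finite F \<and> F \<subseteq> I \<and> (\<Oplus>\<^bsub>A\<^esub>i\<in>F. add_pow A (c i :: int) (v i)) = \<zero>\<^bsub>A\<^esub> \<longrightarrow> (\<forall>i\<in>F. c i = 0))"

definition int_basis :: "('a, 'm) ring_scheme \<Rightarrow> ('i \<Rightarrow> 'a) \<Rightarrow> 'i set \<Rightarrow> bool" where
  "int_basis A v I \<longleftrightarrow> int_independent A v I \<and>
     (\<forall>a \<in> carrier A. \<exists>F c. finite F \<and> F \<subseteq> I \<and> a = (\<Oplus>\<^bsub>A\<^esub>i\<in>F. add_pow A (c i :: int) (v i)))"

end

theory Submission
  imports Defs
begin

text \<open>
  Write \<open>x\<^sup>r\<close> for a monomial and \<open>\<partial>\<^sub>w\<close> for the product of Demazure operators along a reduced expression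
  of \<open>w\<close>.  The argument has three parts.

  The Demazure operators already exist on the free algebra on the variables, by the
  recursion \<open>\<partial>(x\<^sub>j f) = \<partial>(x\<^sub>j) f + s(x\<^sub>j) \<partial>(f)\<close>, and there all relations of the nilHecke algebra except
  anticommutation of the variables hold on the nose: the operator \<open>T\<close> that should vanish satisfies
  \<open>T x\<^sub>j = \<plusminus> x\<^sub>k T\<close> and \<open>T 1 = 0\<close>.  The operators preserve the ideal generated by the anticommutators, so
  they descend to skew polynomials and the abstract nilHecke algebra acts.  The definite descriptions
  in the definitions of the action pick out these maps.

  A Demazure operator moves past a polynomial by the Leibniz rule, so every element is a
  combination of terms \<open>x\<^sup>r \<partial>\<^bsub>ks\<^esub>\<close> for words \<open>ks\<close> in the Demazure generators.  By Matsumoto's theorem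
  for signed permutations (\<open>matsumoto\<close>), reduced words of the same element differ by braid moves, hence
  give the same operator up to sign; a word that is not reduced can be brought by braid moves to
  one with a repeated letter (\<open>not_reduced_square\<close>), hence gives zero.

  Let \<open>w\<^sub>0 = -1\<close> be the longest element.  In a relation \<open>\<Sum> c\<^bsub>w,r\<^esub> x\<^sup>r \<partial>\<^sub>w = 0\<close> choose \<open>w\<close> of
  minimal length with a nonzero coefficient and compose on the right with \<open>\<partial>\<^sub>u\<close>, where \<open>w u = w\<^sub>0\<close>.
  As lengths cannot exceed that of \<open>w\<^sub>0\<close>, all terms die except those of \<open>w\<close> itself, which become
  \<open>\<plusminus> \<Sum> c\<^bsub>w,r\<^esub> x\<^sup>r \<partial>\<^bsub>w\<^sub>0\<^esub>\<close>.  Now \<open>\<partial>\<^bsub>w\<^sub>0\<^esub>\<close> sends \<open>x\<^sub>1 x\<^sub>2\<^sup>3 x\<^sub>3\<^sup>5 \<dots>\<close> to \<open>\<plusminus>1\<close> (\<open>act_long_word\<close>), and the monomials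
  are independent in the skew polynomials (\<open>x_monomials_independent\<close>), so the coefficients vanish
  (\<open>action_independent\<close>).

  With spanning, independence of the operators makes the action faithful.  The second family is the
  image of the first under the anti-automorphism of the nilHecke algebra that reverses words, so it
  is a basis as well, and by faithfulness it stays independent in the endomorphism ring.
\<close>

section \<open>Free algebras and their quotients\<close>

lemma carrier_free_alg:
  "f \<in> carrier (free_alg G) \<longleftrightarrow> (\<forall>w \<in> Poly_Mapping.keys f. set (letters w) \<subseteq> G)"
  by (simp add: free_alg_def)

lemma free_alg_ops [simp]:
  "a \<otimes>\<^bsub>free_alg G\<^esub> b = a * b" "a \<oplus>\<^bsub>free_alg G\<^esub> b = a + b"
  "\<one>\<^bsub>free_alg G\<^esub> = 1" "\<zero>\<^bsub>free_alg G\<^esub> = 0"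
  by (simp_all add: free_alg_def)

lemma free_alg_UNIV [simp]: "f \<in> carrier (free_alg UNIV)"
  by (simp add: carrier_free_alg)

lemma frag_of_word_mult: "frag_of (FM u) * frag_of (FM v) = frag_of (FM (u @ v))"
  by (simp add: mult_single plus_free_monoid_def)

lemma free_gen_mult_word: "free_gen g * frag_of (FM w) = frag_of (FM (g # w))"
  by (simp add: free_gen_def frag_of_word_mult)

lemma one_eq_empty_word: "(1 :: 'g free_elt) = frag_of (FM [])"
  by (simp flip: single_one add: zero_free_monoid_def)

lemma carrier_frag_of [simp]: "frag_of w \<in> carrier (free_alg G) \<longleftrightarrow> set (letters w) \<subseteq> G"
  by (simp add: carrier_free_alg)

lemma carrier_one [simp]: "1 \<in> carrier (free_alg G)"
  by (simp add: one_eq_empty_word)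

lemma carrier_zero [simp]: "0 \<in> carrier (free_alg G)"
  by (simp add: carrier_free_alg)

lemma carrier_gen [simp]: "free_gen g \<in> carrier (free_alg G) \<longleftrightarrow> g \<in> G"
  by (simp add: free_gen_def)

lemma carrier_diff [simp]:
  "a \<in> carrier (free_alg G) \<Longrightarrow> b \<in> carrier (free_alg G) \<Longrightarrow> a - b \<in> carrier (free_alg G)"
  using keys_diff[of a b] by (force simp: carrier_free_alg)

lemma carrier_uminus [simp]: "- a \<in> carrier (free_alg G) \<longleftrightarrow> a \<in> carrier (free_alg G)"
  by (simp add: carrier_free_alg)

lemma carrier_add [simp]:
  "a \<in> carrier (free_alg G) \<Longrightarrow> b \<in> carrier (free_alg G) \<Longrightarrow> a + b \<in> carrier (free_alg G)"
  using carrier_diff[of a G "- b"] by simp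

lemma carrier_mult [simp]:
  assumes "a \<in> carrier (free_alg G)" "b \<in> carrier (free_alg G)"
  shows "a * b \<in> carrier (free_alg G)"
  unfolding carrier_free_alg
proof
  fix w assume "w \<in> Poly_Mapping.keys (a * b)"
  then obtain u v where "w = u + v" "u \<in> Poly_Mapping.keys a" "v \<in> Poly_Mapping.keys b"
    using keys_mult[of a b] by blast
  then show "set (letters w) \<subseteq> G"
    using assms by (auto simp: carrier_free_alg plus_free_monoid_def)
qed

lemma carrier_cmul [simp]: "a \<in> carrier (free_alg G) \<Longrightarrow> frag_cmul c a \<in> carrier (free_alg G)"
  by (simp add: carrier_free_alg)

lemma carrier_sum:
  "(\<And>i. i \<in> F \<Longrightarrow> a i \<in> carrier (free_alg G)) \<Longrightarrow> (\<Sum>i\<in>F. a i) \<in> carrier (free_alg G)"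
  by (induction F rule: infinite_finite_induct) auto

lemma carrier_mono: "G \<subseteq> H \<Longrightarrow> f \<in> carrier (free_alg G) \<Longrightarrow> f \<in> carrier (free_alg H)"
  by (force simp: carrier_free_alg)

lemma ring_free_alg: "ring (free_alg G)"
proof (rule ringI)
  show "abelian_group (free_alg G)"
  proof (rule abelian_groupI)
    fix x assume "x \<in> carrier (free_alg G)"
    then show "\<exists>y\<in>carrier (free_alg G). y \<oplus>\<^bsub>free_alg G\<^esub> x = \<zero>\<^bsub>free_alg G\<^esub>"
      by (intro bexI[of _ "- x"]) auto
  qed (auto simp: algebra_simps)
  show "Group.monoid (free_alg G)"
    by (rule monoidI) (auto simp: algebra_simps)
qed (auto simp: algebra_simps)

lemma free_alg_minus [simp]:
  assumes "a \<in> carrier (free_alg G)"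
  shows "\<ominus>\<^bsub>free_alg G\<^esub> a = - a"
proof -
  interpret ring "free_alg G" by (rule ring_free_alg)
  show ?thesis using minus_equality[of "- a" a] assms by auto
qed

text \<open>Every element is an integral combination of words, and words grow on the left; hence a
  property that survives differences and left multiplication by a letter holds throughout.\<close>

lemma free_alg_induct [consumes 1, case_names one gen diff]:
  assumes "f \<in> carrier (free_alg G)"
    and one: "P 1"
    and gen: "\<And>g f. g \<in> G \<Longrightarrow> f \<in> carrier (free_alg G) \<Longrightarrow> P f \<Longrightarrow> P (free_gen g * f)"
    and diff: "\<And>a b. a \<in> carrier (free_alg G) \<Longrightarrow> b \<in> carrier (free_alg G) \<Longrightarrow> P a \<Longrightarrow> P b \<Longrightarrow> P (a - b)"
  shows "P f"
proof -
  have word: "set w \<subseteq> G \<Longrightarrow> P (frag_of (FM w))" for w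
  proof (induction w)
    case (Cons g w)
    then show ?case using gen[of g "frag_of (FM w)"] by (simp add: free_gen_mult_word)
  qed (simp add: one flip: one_eq_empty_word)
  have "P 0" using diff[of 1 1] one by simp
  have "f \<in> carrier (free_alg G) \<and> P f"
  proof (rule frag_induction[where S = "{w. set (letters w) \<subseteq> G}"])
    show "Poly_Mapping.keys f \<subseteq> {w. set (letters w) \<subseteq> G}"
      using assms(1) by (auto simp: carrier_free_alg)
    fix x assume "x \<in> {w. set (letters w) \<subseteq> G}"
    then show "frag_of x \<in> carrier (free_alg G) \<and> P (frag_of x)"
      using word[of "letters x"] by auto
  qed (auto simp: \<open>P 0\<close> diff)
  then show ?thesis by simp
qed

text \<open>From here on the algebra \<open>\<langle>G | R\<rangle>\<close> is handled through representatives: computations take place in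
  the type of free elements, and equality of classes becomes membership of a difference in the
  ideal of relations.\<close>

locale presentation =
  fixes G :: "'g set" and R :: "'g free_elt set"
  assumes rels_closed: "R \<subseteq> carrier (free_alg G)"
begin

abbreviation rel_ideal :: "'g free_elt set" where "rel_ideal \<equiv> genideal (free_alg G) R"
abbreviation alg :: "'g free_elt set ring" where "alg \<equiv> presented_alg G R"
abbreviation cls :: "'g free_elt \<Rightarrow> 'g free_elt set" where "cls \<equiv> presented_class G R"

lemma ideal_rel_ideal: "ideal rel_ideal (free_alg G)"
  by (rule ring.genideal_ideal[OF ring_free_alg rels_closed])

sublocale rel: ideal rel_ideal "free_alg G"
  by (rule ideal_rel_ideal)

lemma rel_ideal_carrier [dest]: "a \<in> rel_ideal \<Longrightarrow> a \<in> carrier (free_alg G)"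
  using rel.a_subset by blast

lemma rel_ideal_rel: "r \<in> R \<Longrightarrow> r \<in> rel_ideal"
  using ring.genideal_self[OF ring_free_alg rels_closed] by blast

lemma rel_ideal_0 [simp]: "0 \<in> rel_ideal"
  using additive_subgroup.zero_closed[OF rel.is_additive_subgroup] by simp

lemma rel_ideal_add: "a \<in> rel_ideal \<Longrightarrow> b \<in> rel_ideal \<Longrightarrow> a + b \<in> rel_ideal"
  using additive_subgroup.a_closed[OF rel.is_additive_subgroup, of a b] by simp

lemma rel_ideal_left: "a \<in> carrier (free_alg G) \<Longrightarrow> b \<in> rel_ideal \<Longrightarrow> a * b \<in> rel_ideal"
  using rel.I_l_closed[of b a] by simp

lemma rel_ideal_right: "a \<in> rel_ideal \<Longrightarrow> b \<in> carrier (free_alg G) \<Longrightarrow> a * b \<in> rel_ideal"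
  using rel.I_r_closed[of a b] by simp

lemma rel_ideal_uminus: "a \<in> rel_ideal \<Longrightarrow> - a \<in> rel_ideal"
  using rel_ideal_left[of "- 1" a] by simp

lemma rel_ideal_uminus_iff [simp]: "- a \<in> rel_ideal \<longleftrightarrow> a \<in> rel_ideal"
  using rel_ideal_uminus[of a] rel_ideal_uminus[of "- a"] by auto

lemma rel_ideal_diff: "a \<in> rel_ideal \<Longrightarrow> b \<in> rel_ideal \<Longrightarrow> a - b \<in> rel_ideal"
  using rel_ideal_add[of a "- b"] rel_ideal_uminus by simp

lemma rel_ideal_cmul: "a \<in> rel_ideal \<Longrightarrow> frag_cmul c a \<in> rel_ideal"
  by (rule frag_closure_minus_cmul) (auto intro: rel_ideal_diff)

lemma rel_ideal_sum: "(\<And>i. i \<in> F \<Longrightarrow> a i \<in> rel_ideal) \<Longrightarrow> (\<Sum>i\<in>F. a i) \<in> rel_ideal"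
  by (induction F rule: infinite_finite_induct) (auto intro: rel_ideal_add)

lemma rel_ideal_induct [consumes 1, case_names rel diff left right]:
  assumes "f \<in> rel_ideal"
    and rel: "\<And>r. r \<in> R \<Longrightarrow> P r"
    and diff: "\<And>a b. a \<in> carrier (free_alg G) \<Longrightarrow> b \<in> carrier (free_alg G) \<Longrightarrow> P a \<Longrightarrow> P b \<Longrightarrow> P (a - b)"
    and left: "\<And>a b. a \<in> carrier (free_alg G) \<Longrightarrow> b \<in> carrier (free_alg G) \<Longrightarrow> P b \<Longrightarrow> P (a * b)"
    and right: "\<And>a b. a \<in> carrier (free_alg G) \<Longrightarrow> b \<in> carrier (free_alg G) \<Longrightarrow> P a \<Longrightarrow> P (a * b)"
    and zero: "P 0"
  shows "P f"
proof -
  let ?J = "{f \<in> carrier (free_alg G). P f}"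
  have uminus: "f \<in> ?J \<Longrightarrow> - f \<in> ?J" for f
    using diff[of 0 f] zero by simp
  have add: "f \<in> ?J \<Longrightarrow> g \<in> ?J \<Longrightarrow> f + g \<in> ?J" for f g
    using diff[of f "- g"] uminus[of g] by simp
  interpret ring "free_alg G" by (rule ring_free_alg)
  have "ideal ?J (free_alg G)"
  proof (rule idealI[OF ring_free_alg])
    show "subgroup ?J (add_monoid (free_alg G))"
    proof
      fix x assume "x \<in> ?J"
      then show "inv\<^bsub>add_monoid (free_alg G)\<^esub> x \<in> ?J"
        using uminus[of x] free_alg_minus[of x G] by (simp add: a_inv_def)
    qed (use zero add in auto)
  qed (auto intro: left right)
  moreover have "R \<subseteq> ?J" using rels_closed rel by blast
  ultimately have "rel_ideal \<subseteq> ?J"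
    by (rule ring.genideal_minimal[OF ring_free_alg])
  with assms(1) show ?thesis by blast
qed

lemma ring_alg: "ring alg"
  unfolding presented_alg_def by (rule rel.quotient_is_ring)

lemma cls_hom: "cls \<in> ring_hom (free_alg G) alg"
proof -
  have "cls = (+>\<^bsub>free_alg G\<^esub>) rel_ideal"
    by (simp add: presented_class_def fun_eq_iff)
  then show ?thesis using rel.rcos_ring_hom by (simp add: presented_alg_def)
qed

lemmas cls_closed [simp] = ring_hom_memE(1)[OF cls_hom]

lemma cls_ops:
  "a \<in> carrier (free_alg G) \<Longrightarrow> b \<in> carrier (free_alg G) \<Longrightarrow> cls (a * b) = cls a \<otimes>\<^bsub>alg\<^esub> cls b"
  "a \<in> carrier (free_alg G) \<Longrightarrow> b \<in> carrier (free_alg G) \<Longrightarrow> cls (a + b) = cls a \<oplus>\<^bsub>alg\<^esub> cls b"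
  "cls 1 = \<one>\<^bsub>alg\<^esub>"
  using ring_hom_memE[OF cls_hom] by auto

lemma cls_zero: "cls 0 = \<zero>\<^bsub>alg\<^esub>"
  using ring_hom_zero[OF cls_hom ring_free_alg ring_alg] by simp

lemma cls_eq_iff:
  "a \<in> carrier (free_alg G) \<Longrightarrow> b \<in> carrier (free_alg G) \<Longrightarrow> cls a = cls b \<longleftrightarrow> a - b \<in> rel_ideal"
  using ring.quotient_eq_iff_same_a_r_cos[OF ring_free_alg ideal_rel_ideal, of a b]
  by (simp add: presented_class_def a_minus_def)

lemma cls_uminus:
  assumes "a \<in> carrier (free_alg G)"
  shows "cls (- a) = \<ominus>\<^bsub>alg\<^esub> cls a"
proof -
  interpret ring alg by (rule ring_alg)
  have "cls (- a) \<oplus>\<^bsub>alg\<^esub> cls a = \<zero>\<^bsub>alg\<^esub>"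
    using cls_ops(2)[of "- a" a] assms by (simp add: cls_zero)
  then show ?thesis using minus_equality assms by simp
qed

lemma carrier_alg: "carrier alg = cls ` carrier (free_alg G)"
  by (auto simp: presented_alg_def FactRing_def A_RCOSETS_def' presented_class_def)

lemma alg_cases [consumes 1]:
  assumes "a \<in> carrier alg"
  obtains f where "f \<in> carrier (free_alg G)" "a = cls f"
  using assms by (auto simp: carrier_alg)

text \<open>An additive map on the free algebra that kills the relations descends to the quotient.  Its
  value on a coset is read off on an arbitrary representative.\<close>

definition descend :: "('g free_elt \<Rightarrow> 'b) \<Rightarrow> 'g free_elt set \<Rightarrow> 'b" where
  "descend h = (\<lambda>a \<in> carrier alg. h (SOME f. f \<in> carrier (free_alg G) \<and> cls f = a))"

lemma descend_cls:
  assumes "\<And>a b. a \<in> carrier (free_alg G) \<Longrightarrow> b \<in> carrier (free_alg G) \<Longrightarrow> a - b \<in> rel_ideal \<Longrightarrow> h a = h b"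
    and "f \<in> carrier (free_alg G)"
  shows "descend h (cls f) = h f"
proof -
  define g where "g = (SOME g. g \<in> carrier (free_alg G) \<and> cls g = cls f)"
  have "g \<in> carrier (free_alg G) \<and> cls g = cls f"
    unfolding g_def by (rule someI_ex) (use assms(2) in auto)
  then have "h g = h f" using assms cls_eq_iff by blast
  then show ?thesis using assms(2) by (simp add: descend_def g_def)
qed

lemma descend_extensional: "descend h \<in> extensional (carrier alg)"
  by (simp add: descend_def)

text \<open>This gives the uniqueness half of the definite descriptions of reflections and of the action.\<close>

lemma ring_hom_alg_eqI:
  assumes S: "ring S" and h: "h \<in> ring_hom alg S" "h' \<in> ring_hom alg S"
    and ext: "h \<in> extensional (carrier alg)" "h' \<in> extensional (carrier alg)"
    and gen: "\<And>g. g \<in> G \<Longrightarrow> h (cls (free_gen g)) = h' (cls (free_gen g))"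
  shows "h = h'"
proof (rule extensionalityI[OF ext])
  interpret A: ring alg by (rule ring_alg)
  have minus: "k (cls (a - b)) = k (cls a) \<ominus>\<^bsub>S\<^esub> k (cls b)"
    if "k \<in> ring_hom alg S" "a \<in> carrier (free_alg G)" "b \<in> carrier (free_alg G)" for k a b
  proof -
    interpret k: ring_hom_ring alg S k by (rule ring_hom_ringI2[OF ring_alg S that(1)])
    have "cls (a - b) = cls a \<oplus>\<^bsub>alg\<^esub> \<ominus>\<^bsub>alg\<^esub> cls b"
      using that cls_ops(2)[of a "- b"] by (simp add: cls_uminus)
    then show ?thesis using that by (simp add: a_minus_def)
  qed
  fix x assume "x \<in> carrier alg"
  then obtain f where f: "f \<in> carrier (free_alg G)" "x = cls f" by (rule alg_cases)
  from f(1) have "h (cls f) = h' (cls f)"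
  proof (induction rule: free_alg_induct)
    case one
    then show ?case using h by (simp add: cls_ops ring_hom_one)
  next
    case (gen g f)
    then show ?case
      using h assms(6) by (simp add: cls_ops ring_hom_mult)
  next
    case (diff a b)
    then show ?case using h by (simp add: minus)
  qed
  then show "h x = h' x" using f by simp
qed

end

section \<open>Modules over a free algebra\<close>

text \<open>A choice of one additive operator per generator is the same as a module over the free algebra.
  Reflections, the nilHecke action and the model of skew polynomials are all built in this way.\<close>

definition action :: "('g \<Rightarrow> ('a \<Rightarrow>\<^sub>0 int) \<Rightarrow> ('a \<Rightarrow>\<^sub>0 int)) \<Rightarrow> 'g free_elt \<Rightarrow> ('a \<Rightarrow>\<^sub>0 int) \<Rightarrow> ('a \<Rightarrow>\<^sub>0 int)"
  where "action \<phi> f m = frag_extend (\<lambda>w. foldr \<phi> (letters w) m) f"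

locale additive_operators =
  fixes \<phi> :: "'g \<Rightarrow> ('a \<Rightarrow>\<^sub>0 int) \<Rightarrow> ('a \<Rightarrow>\<^sub>0 int)"
  assumes op_diff: "\<And>g a b. \<phi> g (a - b) = \<phi> g a - \<phi> g b"
begin

lemma op_0 [simp]: "\<phi> g 0 = 0"
  using op_diff[of g 0 0] by simp

lemma op_uminus: "\<phi> g (- a) = - \<phi> g a"
  using op_diff[of g 0 a] by simp

lemma op_add: "\<phi> g (a + b) = \<phi> g a + \<phi> g b"
  using op_diff[of g a "- b"] by (simp add: op_uminus)

lemma op_cmul: "\<phi> g (frag_cmul c a) = frag_cmul c (\<phi> g a)"
proof -
  have nat: "\<phi> g (frag_cmul (int k) a) = frag_cmul (int k) (\<phi> g a)" for k
    by (induction k) (simp_all add: frag_cmul_distrib op_add)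
  show ?thesis
  proof (cases "0 \<le> c")
    case True
    then show ?thesis using nat[of "nat c"] by simp
  next
    case False
    then show ?thesis using nat[of "nat (- c)"] by (simp add: op_uminus flip: minus_frag_cmul)
  qed
qed

lemma action_diff: "action \<phi> (f - g) m = action \<phi> f m - action \<phi> g m"
  by (simp add: action_def frag_extend_diff)

lemma action_add: "action \<phi> (f + g) m = action \<phi> f m + action \<phi> g m"
  by (simp add: action_def frag_extend_add)

lemma action_0 [simp]: "action \<phi> 0 m = 0"
  by (simp add: action_def)

lemma action_cmul: "action \<phi> (frag_cmul c f) m = frag_cmul c (action \<phi> f m)"
  by (simp add: action_def frag_extend_cmul)

lemma action_sum: "action \<phi> (\<Sum>i\<in>F. f i) m = (\<Sum>i\<in>F. action \<phi> (f i) m)"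
  by (induction F rule: infinite_finite_induct) (auto simp: action_add)

lemma action_1 [simp]: "action \<phi> 1 m = m"
  by (simp add: action_def one_eq_empty_word)

lemma action_gen [simp]: "action \<phi> (free_gen g) m = \<phi> g m"
  by (simp add: action_def free_gen_def)

lemma action_gen_mult: "action \<phi> (free_gen g * f) m = \<phi> g (action \<phi> f m)"
proof -
  have "Poly_Mapping.keys f \<subseteq> UNIV" by simp
  then show ?thesis
  proof (induction f rule: frag_induction)
    case (one w)
    then show ?case by (cases w) (simp add: free_gen_mult_word action_def)
  next
    case (diff a b)
    then show ?case by (simp add: right_diff_distrib action_diff op_diff)
  qed auto
qed

lemma action_mult: "action \<phi> (f * g) m = action \<phi> f (action \<phi> g m)"
proof -
  have "f \<in> carrier (free_alg UNIV)" by simp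
  then show ?thesis
    by (induction f rule: free_alg_induct)
      (auto simp: mult.assoc action_gen_mult left_diff_distrib action_diff)
qed

lemma action_diff_right: "action \<phi> f (a - b) = action \<phi> f a - action \<phi> f b"
proof -
  have "f \<in> carrier (free_alg UNIV)" by simp
  then show ?thesis
    by (induction f rule: free_alg_induct)
      (auto simp: action_gen_mult action_diff op_diff)
qed

lemma action_0_right [simp]: "action \<phi> f 0 = 0"
  using action_diff_right[of f 0 0] by simp

lemma action_uminus_right: "action \<phi> f (- a) = - action \<phi> f a"
  using action_diff_right[of f 0 a] by simp

lemma action_add_right: "action \<phi> f (a + b) = action \<phi> f a + action \<phi> f b"
  using action_diff_right[of f a "- b"] by (simp add: action_uminus_right)

text \<open>To see that a quotient acts it is enough to check its defining relations.  The target is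
  allowed to be a quotient too: \<open>N\<close> is what is being factored out.\<close>

lemma action_rel_ideal:
  assumes "presentation G R"
    and N: "0 \<in> N" "\<And>a b. a \<in> N \<Longrightarrow> b \<in> N \<Longrightarrow> a - b \<in> N"
    and gN: "\<And>g m. g \<in> G \<Longrightarrow> m \<in> N \<Longrightarrow> \<phi> g m \<in> N"
    and gM: "\<And>g m. g \<in> G \<Longrightarrow> m \<in> M \<Longrightarrow> \<phi> g m \<in> M"
    and M: "\<And>a b. a \<in> M \<Longrightarrow> b \<in> M \<Longrightarrow> a - b \<in> M"
    and rels: "\<And>r m. r \<in> R \<Longrightarrow> m \<in> M \<Longrightarrow> action \<phi> r m \<in> N"
    and f: "f \<in> genideal (free_alg G) R" and m: "m \<in> M"
  shows "action \<phi> f m \<in> N"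
proof -
  interpret presentation G R by fact
  have aN: "action \<phi> a m \<in> N" if "a \<in> carrier (free_alg G)" "m \<in> N" for a m
    using that
    by (induction rule: free_alg_induct) (auto simp: action_gen_mult action_diff intro: N gN)
  have aM: "action \<phi> a m \<in> M" if "a \<in> carrier (free_alg G)" "m \<in> M" for a m
    using that
    by (induction rule: free_alg_induct) (auto simp: action_gen_mult action_diff intro: M gM)
  have "\<forall>m\<in>M. action \<phi> f m \<in> N"
    using f
    by (induction rule: rel_ideal_induct) (auto simp: action_mult action_diff intro: rels N aN aM)
  with m show ?thesis by blast
qed

end

section \<open>Reflections and Demazure operators on the free algebra\<close>

text \<open>The reflection \<open>s\<^sub>i\<close> sends \<open>x\<^sub>j\<close> to minus the variable with this index; the type B reflection, \<open>i = n\<close>,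
  moves no index.\<close>

definition refl_index :: "nat \<Rightarrow> nat \<Rightarrow> nat \<Rightarrow> nat" where
  "refl_index n i j = (if i < n \<and> j = i then i + 1 else if i < n \<and> j = i + 1 then i else j)"

lemma refl_index_inj: "refl_index n i j = refl_index n i k \<longleftrightarrow> j = k"
  by (auto simp: refl_index_def)

lemma refl_index_range: "i \<in> {1..n} \<Longrightarrow> j \<in> {1..n} \<Longrightarrow> refl_index n i j \<in> {1..n}"
  by (auto simp: refl_index_def)

lemma pol_gens_iff [simp]: "GenX j \<in> pol_gens n \<longleftrightarrow> j \<in> {1..n}" "GenD j \<notin> pol_gens n"
  by (auto simp: pol_gens_def)

lemma nh_gens_iff [simp]: "GenX j \<in> nh_gens n \<longleftrightarrow> j \<in> {1..n}" "GenD j \<in> nh_gens n \<longleftrightarrow> j \<in> {1..n}"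
  by (auto simp: nh_gens_def)

lemma pol_gens_cases:
  assumes "g \<in> pol_gens n"
  obtains j where "g = GenX j" "j \<in> {1..n}"
  using assms by (auto simp: pol_gens_def)

text \<open>The twisted Leibniz rule, read as a recursion on the first letter.  Words containing a Demazure
  generator get the default value \<open>0\<close>, as only words in the variables matter.\<close>

primrec demazure_word :: "nat \<Rightarrow> nat \<Rightarrow> generator list \<Rightarrow> generator free_elt" where
  "demazure_word n i [] = 0"
| "demazure_word n i (g # w) =
    (case g of
       GenX j \<Rightarrow> (if j \<in> {i, i + 1} then frag_of (FM w) else 0)
                  - xvar (refl_index n i j) * demazure_word n i w
     | GenD _ \<Rightarrow> 0)"

definition demazure :: "nat \<Rightarrow> nat \<Rightarrow> generator free_elt \<Rightarrow> generator free_elt" where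
  "demazure n i = frag_extend (\<lambda>w. demazure_word n i (letters w))"

definition nh_op :: "nat \<Rightarrow> generator \<Rightarrow> generator free_elt \<Rightarrow> generator free_elt" where
  "nh_op n g = (case g of GenX j \<Rightarrow> (*) (xvar j) | GenD i \<Rightarrow> demazure n i)"

lemma demazure_0 [simp]: "demazure n i 0 = 0"
  by (simp add: demazure_def)

lemma demazure_1 [simp]: "demazure n i 1 = 0"
  by (simp add: demazure_def one_eq_empty_word)

lemma demazure_diff: "demazure n i (a - b) = demazure n i a - demazure n i b"
  by (simp add: demazure_def frag_extend_diff)

lemma demazure_add: "demazure n i (a + b) = demazure n i a + demazure n i b"
  by (simp add: demazure_def frag_extend_add)

lemma demazure_uminus: "demazure n i (- a) = - demazure n i a"
  using demazure_diff[of n i 0 a] by simp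

lemma demazure_x:
  "demazure n i (xvar j * f) =
    (if j \<in> {i, i + 1} then f else 0) - xvar (refl_index n i j) * demazure n i f"
proof -
  have "Poly_Mapping.keys f \<subseteq> UNIV" by simp
  then show ?thesis
  proof (induction f rule: frag_induction)
    case (one w)
    then show ?case by (cases w) (simp add: free_gen_mult_word demazure_def)
  next
    case (diff a b)
    then show ?case by (simp add: right_diff_distrib demazure_diff)
  qed auto
qed

lemma demazure_closed:
  assumes "f \<in> carrier (free_alg (pol_gens n))" "i \<in> {1..n}"
  shows "demazure n i f \<in> carrier (free_alg (pol_gens n))"
  using assms
proof (induction rule: free_alg_induct)
  case (gen g f)
  then obtain j where "g = GenX j" "j \<in> {1..n}" by (elim pol_gens_cases)
  then show ?case
    using gen refl_index_range[of i n j] by (auto simp: demazure_x)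
qed (auto simp: demazure_diff)

definition refl_op :: "nat \<Rightarrow> nat \<Rightarrow> generator \<Rightarrow> generator free_elt \<Rightarrow> generator free_elt" where
  "refl_op n i g m = (case g of GenX j \<Rightarrow> - (xvar (refl_index n i j) * m) | GenD _ \<Rightarrow> 0)"

definition reflect :: "nat \<Rightarrow> nat \<Rightarrow> generator free_elt \<Rightarrow> generator free_elt" where
  "reflect n i f = action (refl_op n i) f 1"

interpretation refl_op: additive_operators "refl_op n i" for n i
  by standard (auto simp: refl_op_def algebra_simps split: generator.split)

interpretation nh_op: additive_operators "nh_op n" for n
  by standard (auto simp: nh_op_def algebra_simps demazure_diff split: generator.split)

lemma reflect_x: "reflect n i (xvar j * f) = - (xvar (refl_index n i j) * reflect n i f)"
  by (simp add: reflect_def refl_op.action_gen_mult refl_op_def)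

lemma reflect_1 [simp]: "reflect n i 1 = 1"
  by (simp add: reflect_def)

lemma reflect_diff: "reflect n i (a - b) = reflect n i a - reflect n i b"
  by (simp add: reflect_def refl_op.action_diff)

lemma reflect_add: "reflect n i (a + b) = reflect n i a + reflect n i b"
  by (simp add: reflect_def refl_op.action_add)

lemma reflect_mult:
  assumes "f \<in> carrier (free_alg (pol_gens n))"
  shows "reflect n i (f * g) = reflect n i f * reflect n i g"
  using assms
proof (induction rule: free_alg_induct)
  case (gen g f)
  then show ?case by (elim pol_gens_cases) (simp add: mult.assoc reflect_x)
qed (auto simp: left_diff_distrib reflect_diff)

lemma reflect_closed:
  assumes "f \<in> carrier (free_alg (pol_gens n))" "i \<in> {1..n}"
  shows "reflect n i f \<in> carrier (free_alg (pol_gens n))"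
  using assms
proof (induction rule: free_alg_induct)
  case (gen g f)
  then obtain j where "g = GenX j" "j \<in> {1..n}" by (elim pol_gens_cases)
  then show ?case
    using gen refl_index_range[of i n j] by (auto simp: reflect_x)
qed (auto simp: reflect_diff)

lemma demazure_mult:
  assumes "f \<in> carrier (free_alg (pol_gens n))"
  shows "demazure n i (f * g) = demazure n i f * g + reflect n i f * demazure n i g"
  using assms
proof (induction rule: free_alg_induct)
  case (gen g f)
  then show ?case by (elim pol_gens_cases) (simp add: mult.assoc reflect_x demazure_x algebra_simps)
qed (auto simp: algebra_simps reflect_diff demazure_diff)

text \<open>The relations among the Demazure operators hold on the free algebra itself.  Each asserts that
  some operator \<open>T\<close> vanishes.  Moving \<open>T\<close> past a variable turns out to give \<open>T (x\<^sub>j m) = \<plusminus> x\<^sub>k (T m)\<close>,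
  and \<open>T\<close> kills \<open>1\<close>, so it kills every word.\<close>

lemma demazure_square:
  assumes "m \<in> carrier (free_alg (pol_gens n))"
  shows "demazure n i (demazure n i m) = 0"
  using assms
proof (induction rule: free_alg_induct)
  case (gen g f)
  then show ?case
    by (elim pol_gens_cases) (auto simp: demazure_x demazure_diff demazure_uminus demazure_add refl_index_def)
qed (auto simp: demazure_diff)

lemma demazure_far:
  assumes "m \<in> carrier (free_alg (pol_gens n))" "i + 1 < k" "k \<le> n"
  shows "demazure n i (demazure n k m) = - demazure n k (demazure n i m)"
  using assms
proof (induction rule: free_alg_induct)
  case (gen g f)
  from gen(1) obtain j where "g = GenX j" "j \<in> {1..n}" by (elim pol_gens_cases)
  then show ?case using gen(3-)
    by (auto simp: demazure_x demazure_diff demazure_uminus demazure_add refl_index_def)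
qed (auto simp: demazure_diff)

lemma demazure_braid:
  assumes "m \<in> carrier (free_alg (pol_gens n))" "i + 1 < n"
  shows "demazure n i (demazure n (i+1) (demazure n i m)) =
    demazure n (i+1) (demazure n i (demazure n (i+1) m))"
  using assms
proof (induction rule: free_alg_induct)
  case (gen g f)
  from gen(1) obtain j where "g = GenX j" "j \<in> {1..n}" by (elim pol_gens_cases)
  then show ?case using gen(3-) demazure_square[OF gen(2)]
    by (auto simp: demazure_x demazure_diff demazure_uminus demazure_add refl_index_def demazure_closed)
qed (auto simp: demazure_diff)

text \<open>Here \<open>T x\<^sub>j = x\<^sub>j T\<close> for both \<open>j = n - 1\<close> and \<open>j = n\<close>; the terms with three Demazure operators that
  appear on the way cancel between the two summands of \<open>T\<close>.\<close>

lemma demazure_braid4: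
  assumes "m \<in> carrier (free_alg (pol_gens n))" "2 \<le> n"
  shows "demazure n n (demazure n (n-1) (demazure n n (demazure n (n-1) m))) =
    - demazure n (n-1) (demazure n n (demazure n (n-1) (demazure n n m)))"
  using assms
proof (induction rule: free_alg_induct)
  case (gen g f)
  from gen(1) obtain j where "g = GenX j" "j \<in> {1..n}" by (elim pol_gens_cases)
  then show ?case using gen(3-)
    by (auto simp: demazure_x demazure_diff demazure_uminus demazure_add refl_index_def demazure_closed 
       demazure_square algebra_simps gen(2))
qed (auto simp: demazure_diff)

section \<open>Endomorphism rings\<close>

text \<open>Needed because the uniqueness of ring homomorphisms into an endomorphism ring, and sums inside
  it, presuppose that it is a ring.\<close>

lemma ring_End_ring:
  assumes "ring A"
  shows "ring (End_ring A)"
proof -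
  interpret A: ring A by fact
  let ?E = "End_ring A"
  have mem: "f \<in> carrier ?E \<longleftrightarrow> f \<in> extensional (carrier A) \<and> f \<in> carrier A \<rightarrow> carrier A \<and>
      (\<forall>x\<in>carrier A. \<forall>y\<in>carrier A. f (x \<oplus>\<^bsub>A\<^esub> y) = f x \<oplus>\<^bsub>A\<^esub> f y)" for f
    by (auto simp: End_ring_def hom_def)
  show ?thesis
  proof (rule ringI)
    show "abelian_group ?E"
    proof (rule abelian_groupI)
      fix f assume f: "f \<in> carrier ?E"
      show "\<exists>g\<in>carrier ?E. g \<oplus>\<^bsub>?E\<^esub> f = \<zero>\<^bsub>?E\<^esub>"
      proof
        show "(\<lambda>a\<in>carrier A. \<ominus>\<^bsub>A\<^esub> f a) \<in> carrier ?E"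
          using f unfolding mem by (auto simp: Pi_iff A.minus_add)
        show "(\<lambda>a\<in>carrier A. \<ominus>\<^bsub>A\<^esub> f a) \<oplus>\<^bsub>?E\<^esub> f = \<zero>\<^bsub>?E\<^esub>"
          using f unfolding mem by (auto simp: End_ring_def Pi_iff A.l_neg intro!: restrict_ext)
      qed
    next
      fix f g assume "f \<in> carrier ?E" "g \<in> carrier ?E"
      then show "f \<oplus>\<^bsub>?E\<^esub> g \<in> carrier ?E"
        unfolding mem by (auto simp: End_ring_def Pi_iff A.a_ac)
      show "f \<oplus>\<^bsub>?E\<^esub> g = g \<oplus>\<^bsub>?E\<^esub> f"
        using \<open>f \<in> carrier ?E\<close> \<open>g \<in> carrier ?E\<close> unfolding mem
        by (auto simp: End_ring_def Pi_iff A.a_ac intro!: restrict_ext)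
    next
      show "\<zero>\<^bsub>?E\<^esub> \<in> carrier ?E"
        unfolding mem by (auto simp: End_ring_def)
    next
      fix f g h assume "f \<in> carrier ?E" "g \<in> carrier ?E" "h \<in> carrier ?E"
      then show "f \<oplus>\<^bsub>?E\<^esub> g \<oplus>\<^bsub>?E\<^esub> h = f \<oplus>\<^bsub>?E\<^esub> (g \<oplus>\<^bsub>?E\<^esub> h)"
        unfolding mem by (auto simp: End_ring_def Pi_iff A.a_ac intro!: restrict_ext)
    next
      fix f assume "f \<in> carrier ?E"
      then show "\<zero>\<^bsub>?E\<^esub> \<oplus>\<^bsub>?E\<^esub> f = f"
        unfolding mem by (auto simp: End_ring_def Pi_iff fun_eq_iff extensional_def)
    qed
    show "Group.monoid ?E"
    proof (rule monoidI)
      fix f g assume "f \<in> carrier ?E" "g \<in> carrier ?E"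
      then show "f \<otimes>\<^bsub>?E\<^esub> g \<in> carrier ?E"
        unfolding mem by (auto simp: End_ring_def Pi_iff compose_def)
    next
      show "\<one>\<^bsub>?E\<^esub> \<in> carrier ?E"
        unfolding mem by (auto simp: End_ring_def)
    next
      fix f g h assume "f \<in> carrier ?E" "g \<in> carrier ?E" "h \<in> carrier ?E"
      then show "f \<otimes>\<^bsub>?E\<^esub> g \<otimes>\<^bsub>?E\<^esub> h = f \<otimes>\<^bsub>?E\<^esub> (g \<otimes>\<^bsub>?E\<^esub> h)"
        unfolding mem by (auto simp: End_ring_def Pi_iff compose_def intro!: restrict_ext)
    next
      fix f assume "f \<in> carrier ?E"
      then show "\<one>\<^bsub>?E\<^esub> \<otimes>\<^bsub>?E\<^esub> f = f" "f \<otimes>\<^bsub>?E\<^esub> \<one>\<^bsub>?E\<^esub> = f"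
        unfolding mem by (auto simp: End_ring_def Pi_iff compose_def fun_eq_iff extensional_def)
    qed
  next
    fix f g h assume "f \<in> carrier ?E" "g \<in> carrier ?E" "h \<in> carrier ?E"
    then show "(f \<oplus>\<^bsub>?E\<^esub> g) \<otimes>\<^bsub>?E\<^esub> h = f \<otimes>\<^bsub>?E\<^esub> h \<oplus>\<^bsub>?E\<^esub> g \<otimes>\<^bsub>?E\<^esub> h"
      and "h \<otimes>\<^bsub>?E\<^esub> (f \<oplus>\<^bsub>?E\<^esub> g) = h \<otimes>\<^bsub>?E\<^esub> f \<oplus>\<^bsub>?E\<^esub> h \<otimes>\<^bsub>?E\<^esub> g"
      unfolding mem by (auto simp: End_ring_def Pi_iff compose_def intro!: restrict_ext)
  qed
qed

lemma End_ring_add_closed: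
  assumes "d \<in> carrier (End_ring A)" "a \<in> carrier A" "b \<in> carrier A"
  shows "d a \<in> carrier A" "d (a \<oplus>\<^bsub>A\<^esub> b) = d a \<oplus>\<^bsub>A\<^esub> d b"
  using assms by (auto simp: End_ring_def hom_def)

lemma End_ring_minus:
  assumes "ring A" "d \<in> carrier (End_ring A)" "a \<in> carrier A"
  shows "d (\<ominus>\<^bsub>A\<^esub> a) = \<ominus>\<^bsub>A\<^esub> d a"
proof -
  interpret group_hom "add_monoid A" "add_monoid A" d
    using assms ring.is_abelian_group[OF assms(1)]
    by (intro group_hom.intro group_hom_axioms.intro)
      (auto simp: End_ring_def abelian_group.a_group)
  show ?thesis using hom_inv assms(3) by (simp add: a_inv_def)
qed

section \<open>The action on skew polynomials\<close>

lemma reflect_0 [simp]: "reflect n i 0 = 0"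
  by (simp add: reflect_def)

text \<open>For \<open>n = 0\<close> the generator \<open>\<partial>\<^sub>n\<close> and its relations would refer to letters outside the alphabet.\<close>

locale positive_rank =
  fixes n :: nat
  assumes n_pos: "1 \<le> n"
begin

lemma pol_rels_closed: "pol_rels n \<subseteq> carrier (free_alg (pol_gens n))"
  by (auto simp: pol_rels_def)

lemma nh_rels_closed: "nh_rels n \<subseteq> carrier (free_alg (nh_gens n))"
  using n_pos by (auto simp: nh_rels_def pol_rels_def)

sublocale pol: presentation "pol_gens n" "pol_rels n"
  by standard (rule pol_rels_closed)

sublocale nh: presentation "nh_gens n" "nh_rels n"
  by standard (rule nh_rels_closed)

abbreviation free_pol :: "generator free_elt set" where "free_pol \<equiv> carrier (free_alg (pol_gens n))"
abbreviation free_nh :: "generator free_elt set" where "free_nh \<equiv> carrier (free_alg (nh_gens n))"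

lemma Pol_eq: "Pol n = pol.alg" and pol_x_eq: "pol_x n j = pol.cls (xvar j)"
  and NH_eq: "NH n = nh.alg" and nh_class_eq: "nh_class n = nh.cls"
  by (simp_all add: Pol_def pol_x_def NH_def nh_class_def fun_eq_iff)

lemma free_pol_nh: "f \<in> free_pol \<Longrightarrow> f \<in> free_nh"
  by (rule carrier_mono[of "pol_gens n"]) (auto simp: pol_gens_def nh_gens_def)

lemma pol_rel: "j \<in> {1..n} \<Longrightarrow> k \<in> {1..n} \<Longrightarrow> j \<noteq> k \<Longrightarrow> xvar j * xvar k + xvar k * xvar j \<in> pol_rels n"
  by (auto simp: pol_rels_def)

text \<open>The two summands of an anticommutator contribute \<open>x\<^sub>k - x\<^bsub>\<sigma> k\<^esub>\<close> when \<open>\<partial>(x\<^sub>j) = 1\<close> and \<open>x\<^sub>j - x\<^bsub>\<sigma> j\<^esub>\<close> when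
  \<open>\<partial>(x\<^sub>k) = 1\<close>, where \<open>\<sigma>\<close> is the permutation of indices; these vanish or cancel.\<close>

lemma demazure_pol_rel:
  assumes "r \<in> pol_rels n" "i \<in> {1..n}"
  shows "demazure n i r = 0"
proof -
  obtain j k where r: "r = xvar j * xvar k + xvar k * xvar j" "j \<in> {1..n}" "k \<in> {1..n}" "j \<noteq> k"
    using assms by (auto simp: pol_rels_def)
  have x: "demazure n i (xvar j) = (if j \<in> {i, i + 1} then 1 else 0)" for j
    using demazure_x[of n i j 1] by simp
  show ?thesis
    using r assms(2) by (auto simp: demazure_add demazure_x x refl_index_def)
qed

lemma reflect_pol_rel:
  assumes "r \<in> pol_rels n" "i \<in> {1..n}"
  shows "reflect n i r \<in> pol_rels n"
proof -
  obtain j k where r: "r = xvar j * xvar k + xvar k * xvar j" "j \<in> {1..n}" "k \<in> {1..n}" "j \<noteq> k"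
    using assms by (auto simp: pol_rels_def)
  have x: "reflect n i (xvar j) = - xvar (refl_index n i j)" for j
    using reflect_x[of n i j 1] by simp
  show ?thesis
    using r assms(2) pol_rel[of "refl_index n i j" "refl_index n i k"]
    by (simp add: reflect_add reflect_x x refl_index_range[simplified] refl_index_inj)
qed

lemma reflect_ideal: "f \<in> pol.rel_ideal \<Longrightarrow> i \<in> {1..n} \<Longrightarrow> reflect n i f \<in> pol.rel_ideal"
proof (induction rule: pol.rel_ideal_induct)
  case (rel r)
  then show ?case by (simp only: reflect_pol_rel pol.rel_ideal_rel)
qed (auto simp: reflect_mult reflect_diff reflect_closed
      intro: pol.rel_ideal_left pol.rel_ideal_right pol.rel_ideal_diff)

text \<open>By the Leibniz rule the ideal is preserved only together with its image under the reflection,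
  so all three memberships are carried through the induction.\<close>

lemma demazure_ideal:
  assumes "f \<in> pol.rel_ideal" "i \<in> {1..n}"
  shows "demazure n i f \<in> pol.rel_ideal"
proof -
  have "f \<in> pol.rel_ideal \<and> reflect n i f \<in> pol.rel_ideal \<and> demazure n i f \<in> pol.rel_ideal"
    using assms
  proof (induction rule: pol.rel_ideal_induct)
    case (rel r)
    then show ?case
      by (simp add: demazure_pol_rel pol.rel_ideal_rel reflect_pol_rel)
  qed (auto simp: demazure_mult demazure_diff reflect_mult reflect_diff reflect_closed demazure_closed
      intro!: pol.rel_ideal_add
      intro: pol.rel_ideal_left pol.rel_ideal_right pol.rel_ideal_diff)
  then show ?thesis by blast
qed

lemma ring_Pol: "ring (Pol n)"
  by (simp add: Pol_eq pol.ring_alg)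

lemma odd_refl_cls:
  assumes i: "i \<in> {1..n}" and f: "f \<in> free_pol"
  shows "odd_refl n i (pol.cls f) = pol.cls (reflect n i f)"
proof -
  let ?P = "\<lambda>s. s \<in> ring_hom (Pol n) (Pol n) \<inter> extensional (carrier (Pol n)) \<and>
     (\<forall>j \<in> {1..n}. s (pol_x n j) =
        (if i < n \<and> j = i then \<ominus>\<^bsub>Pol n\<^esub> pol_x n (i + 1)
         else if i < n \<and> j = i + 1 then \<ominus>\<^bsub>Pol n\<^esub> pol_x n i
         else \<ominus>\<^bsub>Pol n\<^esub> pol_x n j))"
  define s where "s = pol.descend (\<lambda>m. pol.cls (reflect n i m))"
  have s: "s (pol.cls f) = pol.cls (reflect n i f)" if "f \<in> free_pol" for f
    unfolding s_def
    by (rule pol.descend_cls)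
      (use that i in \<open>auto simp: pol.cls_eq_iff reflect_closed reflect_ideal simp flip: reflect_diff\<close>)
  have "s \<in> ring_hom (Pol n) (Pol n)"
    unfolding Pol_eq
  proof (rule ring_hom_memI)
    fix x y assume "x \<in> carrier pol.alg" "y \<in> carrier pol.alg"
    then show "s x \<in> carrier pol.alg" "s (x \<otimes>\<^bsub>pol.alg\<^esub> y) = s x \<otimes>\<^bsub>pol.alg\<^esub> s y"
      "s (x \<oplus>\<^bsub>pol.alg\<^esub> y) = s x \<oplus>\<^bsub>pol.alg\<^esub> s y"
      by (auto elim!: pol.alg_cases simp: s reflect_closed[OF _ i] reflect_mult reflect_add
          simp flip: pol.cls_ops)
  next
    show "s \<one>\<^bsub>pol.alg\<^esub> = \<one>\<^bsub>pol.alg\<^esub>" using s[of 1] by (simp add: pol.cls_ops)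
  qed
  moreover have "s (pol_x n j) = (if i < n \<and> j = i then \<ominus>\<^bsub>Pol n\<^esub> pol_x n (i + 1)
         else if i < n \<and> j = i + 1 then \<ominus>\<^bsub>Pol n\<^esub> pol_x n i
         else \<ominus>\<^bsub>Pol n\<^esub> pol_x n j)" if "j \<in> {1..n}" for j
    using s[of "xvar j"] that i reflect_x[of n i j 1] refl_index_range[of i n j]
    by (auto simp: pol_x_eq Pol_eq pol.cls_uminus[symmetric] refl_index_def)
  ultimately have P: "?P s"
    by (auto simp: s_def Pol_eq pol.descend_extensional)
  have "odd_refl n i = s"
    unfolding odd_refl_def
  proof (rule the_equality)
    fix t assume t: "?P t"
    show "t = s"
      using P t
      by (intro pol.ring_hom_alg_eqI[OF pol.ring_alg])
        (auto simp: Pol_eq[symmetric] pol_x_eq[symmetric] elim!: pol_gens_cases)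
  qed (rule P)
  then show ?thesis by (simp add: s f)
qed

text \<open>Any map with the defining properties agrees with the explicit one, since the Leibniz rule
  determines it along the first letter of each word.\<close>

lemma odd_demazure_unique:
  assumes i: "i \<in> {1..n}"
    and d: "d \<in> carrier (End_ring (Pol n)) \<and> d \<one>\<^bsub>Pol n\<^esub> = \<zero>\<^bsub>Pol n\<^esub> \<and>
     (\<forall>j \<in> {1..n}. d (pol_x n j) = (if j \<in> {i, i + 1} then \<one>\<^bsub>Pol n\<^esub> else \<zero>\<^bsub>Pol n\<^esub>)) \<and>
     (\<forall>f \<in> carrier (Pol n). \<forall>g \<in> carrier (Pol n).
        d (f \<otimes>\<^bsub>Pol n\<^esub> g) = d f \<otimes>\<^bsub>Pol n\<^esub> g \<oplus>\<^bsub>Pol n\<^esub> odd_refl n i f \<otimes>\<^bsub>Pol n\<^esub> d g)"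
    and f: "f \<in> free_pol"
  shows "d (pol.cls f) = pol.cls (demazure n i f)"
  using f
proof (induction rule: free_alg_induct)
  case one
  then show ?case using d by (simp add: pol.cls_ops(3) pol.cls_zero Pol_eq)
next
  case (gen g f)
  then obtain j where g: "g = GenX j" "j \<in> {1..n}" by (elim pol_gens_cases)
  have r: "reflect n i (xvar j) = - xvar (refl_index n i j)"
    using reflect_x[of n i j 1] by simp
  have x: "d (pol.cls (xvar j)) = pol.cls (if j \<in> {i, i + 1} then 1 else 0)"
    using d g by (auto simp: pol_x_eq[symmetric] Pol_eq pol.cls_ops(3) pol.cls_zero)
  have "d (pol.cls (xvar j * f)) = d (pol.cls (xvar j) \<otimes>\<^bsub>Pol n\<^esub> pol.cls f)"
    using gen g by (simp add: pol.cls_ops Pol_eq)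
  also have "\<dots> = d (pol.cls (xvar j)) \<otimes>\<^bsub>Pol n\<^esub> pol.cls f \<oplus>\<^bsub>Pol n\<^esub>
      odd_refl n i (pol.cls (xvar j)) \<otimes>\<^bsub>Pol n\<^esub> d (pol.cls f)"
    using d gen g by (simp add: Pol_eq)
  also have "\<dots> = pol.cls ((if j \<in> {i, i + 1} then 1 else 0) * f +
      (- xvar (refl_index n i j)) * demazure n i f)"
    unfolding x gen.IH odd_refl_cls[OF i, of "xvar j", simplified, OF g(2)[simplified]] r Pol_eq
    using gen g i refl_index_range[OF i g(2)] by (subst pol.cls_ops | simp add: demazure_closed)+
  finally show ?case by (simp add: g demazure_x)
next
  case (diff a b)
  interpret P: ring pol.alg by (rule pol.ring_alg)
  have "d (pol.cls (a - b)) = d (pol.cls a \<oplus>\<^bsub>pol.alg\<^esub> \<ominus>\<^bsub>pol.alg\<^esub> pol.cls b)"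
    using diff pol.cls_ops(2)[of a "- b"] by (simp add: pol.cls_uminus)
  also have "\<dots> = d (pol.cls a) \<oplus>\<^bsub>pol.alg\<^esub> \<ominus>\<^bsub>pol.alg\<^esub> d (pol.cls b)"
    using d diff End_ring_add_closed(2)[of d pol.alg] End_ring_minus[OF pol.ring_alg, of d]
    by (simp add: Pol_eq)
  also have "\<dots> = pol.cls (demazure n i (a - b))"
    using diff i pol.cls_ops(2)[of "demazure n i a" "- demazure n i b"]
    by (simp add: demazure_closed pol.cls_uminus demazure_diff)
  finally show ?case .
qed

lemma descend_in_End:
  assumes add: "\<And>a b. a \<in> free_pol \<Longrightarrow> b \<in> free_pol \<Longrightarrow> h (a + b) = h a + h b"
    and diff: "\<And>a b. a \<in> free_pol \<Longrightarrow> b \<in> free_pol \<Longrightarrow> h (a - b) = h a - h b"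
    and closed: "\<And>a. a \<in> free_pol \<Longrightarrow> h a \<in> free_pol"
    and ideal: "\<And>a. a \<in> pol.rel_ideal \<Longrightarrow> h a \<in> pol.rel_ideal"
  shows "pol.descend (\<lambda>m. pol.cls (h m)) \<in> carrier (End_ring (Pol n))"
    and "f \<in> free_pol \<Longrightarrow> pol.descend (\<lambda>m. pol.cls (h m)) (pol.cls f) = pol.cls (h f)"
proof -
  let ?d = "pol.descend (\<lambda>m. pol.cls (h m))"
  have d: "?d (pol.cls f) = pol.cls (h f)" if "f \<in> free_pol" for f
    by (rule pol.descend_cls)
      (use that in \<open>auto simp: pol.cls_eq_iff closed ideal simp flip: diff\<close>)
  have "?d \<in> hom (add_monoid pol.alg) (add_monoid pol.alg)"
  proof (rule homI)
    fix x y assume "x \<in> carrier (add_monoid pol.alg)" "y \<in> carrier (add_monoid pol.alg)"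
    then have "x \<in> carrier pol.alg" "y \<in> carrier pol.alg" by auto
    then show "?d x \<in> carrier (add_monoid pol.alg)"
      "?d (x \<otimes>\<^bsub>add_monoid pol.alg\<^esub> y) = ?d x \<otimes>\<^bsub>add_monoid pol.alg\<^esub> ?d y"
      by (auto elim!: pol.alg_cases simp: d closed add simp flip: pol.cls_ops)
  qed
  then show "?d \<in> carrier (End_ring (Pol n))"
    by (auto simp: End_ring_def Pol_eq pol.descend_extensional)
  show "f \<in> free_pol \<Longrightarrow> ?d (pol.cls f) = pol.cls (h f)" by (rule d)
qed

lemma odd_demazure_eq:
  assumes i: "i \<in> {1..n}"
  shows "odd_demazure n i = pol.descend (\<lambda>m. pol.cls (demazure n i m))"
proof -
  let ?P = "\<lambda>d. d \<in> carrier (End_ring (Pol n)) \<and> d \<one>\<^bsub>Pol n\<^esub> = \<zero>\<^bsub>Pol n\<^esub> \<and>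
     (\<forall>j \<in> {1..n}. d (pol_x n j) = (if j \<in> {i, i + 1} then \<one>\<^bsub>Pol n\<^esub> else \<zero>\<^bsub>Pol n\<^esub>)) \<and>
     (\<forall>f \<in> carrier (Pol n). \<forall>g \<in> carrier (Pol n).
        d (f \<otimes>\<^bsub>Pol n\<^esub> g) = d f \<otimes>\<^bsub>Pol n\<^esub> g \<oplus>\<^bsub>Pol n\<^esub> odd_refl n i f \<otimes>\<^bsub>Pol n\<^esub> d g)"
  let ?d = "pol.descend (\<lambda>m. pol.cls (demazure n i m))"
  note d = descend_in_End[of "demazure n i", OF demazure_add demazure_diff
      demazure_closed[OF _ i] demazure_ideal[OF _ i]]
  have "?d (pol_x n j) = (if j \<in> {i, i + 1} then \<one>\<^bsub>Pol n\<^esub> else \<zero>\<^bsub>Pol n\<^esub>)" if "j \<in> {1..n}" for j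
    using d(2)[of "xvar j"] demazure_x[of n i j 1] that
    by (auto simp: pol_x_eq Pol_eq pol.cls_ops(3) pol.cls_zero)
  moreover have "?d \<one>\<^bsub>Pol n\<^esub> = \<zero>\<^bsub>Pol n\<^esub>"
    using d(2)[of 1] by (simp add: Pol_eq pol.cls_ops(3) pol.cls_zero)
  moreover have "?d (f \<otimes>\<^bsub>Pol n\<^esub> g) = ?d f \<otimes>\<^bsub>Pol n\<^esub> g \<oplus>\<^bsub>Pol n\<^esub> odd_refl n i f \<otimes>\<^bsub>Pol n\<^esub> ?d g"
    if "f \<in> carrier (Pol n)" "g \<in> carrier (Pol n)" for f g
    using that i unfolding Pol_eq
    by (auto elim!: pol.alg_cases simp: d odd_refl_cls demazure_closed reflect_closed
        demazure_mult simp flip: pol.cls_ops)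
  ultimately have P: "?P ?d" using d(1) by blast
  show "odd_demazure n i = ?d"
    unfolding odd_demazure_def
  proof (rule the_equality)
    fix d' assume d': "?P d'"
    then have ext: "d' \<in> extensional (carrier pol.alg)"
      by (simp add: End_ring_def Pol_eq)
    show "d' = ?d"
    proof (rule extensionalityI[OF ext pol.descend_extensional])
      fix x assume "x \<in> carrier pol.alg"
      then obtain f where "f \<in> free_pol" "x = pol.cls f" by (rule pol.alg_cases)
      then show "d' x = ?d x"
        using odd_demazure_unique[OF i d'] d(2) by simp
    qed
  qed (rule P)
qed

abbreviation act :: "generator free_elt \<Rightarrow> generator free_elt \<Rightarrow> generator free_elt" where
  "act \<equiv> action (nh_op n)"

lemma nh_op_simps [simp]: "nh_op n (GenX j) m = xvar j * m" "nh_op n (GenD i) m = demazure n i m"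
  by (simp_all add: nh_op_def)

lemma nh_gens_cases:
  assumes "g \<in> nh_gens n"
  obtains j where "g = GenX j" "j \<in> {1..n}" | i where "g = GenD i" "i \<in> {1..n}"
  using assms by (auto simp: nh_gens_def)

lemma nh_op_closed: "g \<in> nh_gens n \<Longrightarrow> m \<in> free_pol \<Longrightarrow> nh_op n g m \<in> free_pol"
  by (elim nh_gens_cases) (simp_all add: demazure_closed)

lemma nh_op_ideal:
  assumes "g \<in> nh_gens n" "m \<in> pol.rel_ideal"
  shows "nh_op n g m \<in> pol.rel_ideal"
  using assms(1)
proof (cases rule: nh_gens_cases)
  case (1 j)
  then show ?thesis using pol.rel_ideal_left[of "xvar j" m] assms(2) by simp
next
  case (2 i)
  then show ?thesis using demazure_ideal[of m i] assms(2) by simp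
qed

lemma act_closed: "f \<in> free_nh \<Longrightarrow> m \<in> free_pol \<Longrightarrow> act f m \<in> free_pol"
  by (induction rule: free_alg_induct)
    (simp_all add: nh_op.action_gen_mult nh_op.action_diff nh_op_closed)

lemma act_ideal_right: "f \<in> free_nh \<Longrightarrow> m \<in> pol.rel_ideal \<Longrightarrow> act f m \<in> pol.rel_ideal"
  by (induction rule: free_alg_induct)
    (simp_all add: nh_op.action_gen_mult nh_op.action_diff nh_op_ideal pol.rel_ideal_diff)

lemma act_pol: "f \<in> free_pol \<Longrightarrow> act f m = f * m"
  by (induction rule: free_alg_induct)
    (auto simp: nh_op.action_gen_mult nh_op.action_diff algebra_simps elim!: pol_gens_cases)

lemma act_nh_rel:
  assumes "r \<in> nh_rels n" "m \<in> free_pol"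
  shows "act r m \<in> pol.rel_ideal"
proof (cases "r \<in> pol_rels n")
  case True
  then show ?thesis
    using act_pol[of r m] pol_rels_closed assms(2) pol.rel_ideal_rel pol.rel_ideal_right by auto
next
  case False
  have far: "demazure n i (demazure n k m) + demazure n k (demazure n i m) = 0"
    if "1 < \<bar>int i - int k\<bar>" "i \<le> n" "k \<le> n" for i k
    using that demazure_far[OF assms(2), of i k] demazure_far[OF assms(2), of k i]
    by (cases "i < k") auto
  have "act r m = 0"
    using False assms unfolding nh_rels_def
    by (auto simp: nh_op.action_add nh_op.action_diff nh_op.action_mult demazure_square
        demazure_braid[simplified] demazure_braid4[simplified] far demazure_x refl_index_def split: if_splits)
  then show ?thesis by simp
qed

text \<open>Hence the nilHecke algebra acts on the skew polynomials, although the operators are defined one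
  level higher, on the free algebra.\<close>

lemma act_nh_ideal: "f \<in> nh.rel_ideal \<Longrightarrow> m \<in> free_pol \<Longrightarrow> act f m \<in> pol.rel_ideal"
  by (rule nh_op.action_rel_ideal[OF nh.presentation_axioms, where M = free_pol])
    (simp_all add: pol.rel_ideal_diff nh_op_ideal nh_op_closed act_nh_rel)

lemma End_eqI:
  assumes "d \<in> extensional (carrier (Pol n))" "d' \<in> extensional (carrier (Pol n))"
    and "\<And>m. m \<in> free_pol \<Longrightarrow> d (pol.cls m) = d' (pol.cls m)"
  shows "d = d'"
  using assms by (intro extensionalityI[of d "carrier (Pol n)"]) (auto simp: Pol_eq elim!: pol.alg_cases)

definition act_End :: "generator free_elt \<Rightarrow> generator free_elt set \<Rightarrow> generator free_elt set" where
  "act_End f = pol.descend (\<lambda>m. pol.cls (act f m))"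

lemma act_End:
  assumes "f \<in> free_nh"
  shows "act_End f \<in> carrier (End_ring (Pol n))"
    and "m \<in> free_pol \<Longrightarrow> act_End f (pol.cls m) = pol.cls (act f m)"
  unfolding act_End_def using assms
  by (intro descend_in_End; simp add: nh_op.action_add_right nh_op.action_diff_right act_closed act_ideal_right)+

lemma act_End_extensional:
  "act_End f \<in> extensional (carrier (Pol n))" "act_End f \<in> extensional (carrier pol.alg)"
  by (simp_all add: act_End_def Pol_eq pol.descend_extensional)

lemma act_End_cong:
  assumes "f \<in> free_nh" "g \<in> free_nh" "f - g \<in> nh.rel_ideal"
  shows "act_End f = act_End g"
  using assms
  by (intro End_eqI act_End_extensional)
    (simp add: act_End pol.cls_eq_iff act_closed act_nh_ideal flip: nh_op.action_diff)

lemma nh_action_class: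
  assumes "f \<in> free_nh"
  shows "nh_action n (nh_class n f) = act_End f"
proof -
  let ?P = "\<lambda>\<rho>. \<rho> \<in> ring_hom (NH n) (End_ring (Pol n)) \<inter> extensional (carrier (NH n)) \<and>
     (\<forall>i \<in> {1..n}. \<rho> (nh_class n (xvar i)) = (\<lambda>f \<in> carrier (Pol n). pol_x n i \<otimes>\<^bsub>Pol n\<^esub> f)) \<and>
     (\<forall>i \<in> {1..n}. \<rho> (nh_class n (del i)) = odd_demazure n i)"
  define \<rho> where "\<rho> = nh.descend act_End"
  have \<rho>: "\<rho> (nh.cls f) = act_End f" if "f \<in> free_nh" for f
    unfolding \<rho>_def by (rule nh.descend_cls) (auto intro: act_End_cong that)
  have E: "x \<oplus>\<^bsub>End_ring (Pol n)\<^esub> y = (\<lambda>a \<in> carrier (Pol n). x a \<oplus>\<^bsub>Pol n\<^esub> y a)"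
    "x \<otimes>\<^bsub>End_ring (Pol n)\<^esub> y = compose (carrier (Pol n)) x y"
    "\<one>\<^bsub>End_ring (Pol n)\<^esub> = (\<lambda>a \<in> carrier (Pol n). a)" for x y
    by (simp_all add: End_ring_def)
  have hom: "\<rho> \<in> ring_hom (NH n) (End_ring (Pol n))"
    unfolding NH_eq
  proof (rule ring_hom_memI)
    fix x assume "x \<in> carrier nh.alg"
    then show "\<rho> x \<in> carrier (End_ring (Pol n))"
      by (auto elim!: nh.alg_cases simp: \<rho> act_End)
  next
    fix x y assume "x \<in> carrier nh.alg" "y \<in> carrier nh.alg"
    then obtain f g where fg: "f \<in> free_nh" "x = nh.cls f" "g \<in> free_nh" "y = nh.cls g"
      by (auto elim!: nh.alg_cases)
    show "\<rho> (x \<otimes>\<^bsub>nh.alg\<^esub> y) = \<rho> x \<otimes>\<^bsub>End_ring (Pol n)\<^esub> \<rho> y"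
      unfolding E by (rule End_eqI)
        (use fg in \<open>simp_all add: \<rho> act_End act_End_extensional compose_def act_closed nh_op.action_mult
          Pol_eq flip: nh.cls_ops\<close>)
    show "\<rho> (x \<oplus>\<^bsub>nh.alg\<^esub> y) = \<rho> x \<oplus>\<^bsub>End_ring (Pol n)\<^esub> \<rho> y"
      unfolding E by (rule End_eqI)
        (use fg in \<open>simp_all add: \<rho> act_End act_End_extensional act_closed nh_op.action_add
          Pol_eq flip: nh.cls_ops pol.cls_ops\<close>)
  next
    show "\<rho> \<one>\<^bsub>nh.alg\<^esub> = \<one>\<^bsub>End_ring (Pol n)\<^esub>"
      unfolding E by (rule End_eqI)
        (simp_all add: \<rho> act_End act_End_extensional Pol_eq flip: nh.cls_ops)
  qed
  moreover have "\<rho> (nh.cls (xvar i)) = (\<lambda>f \<in> carrier (Pol n). pol_x n i \<otimes>\<^bsub>Pol n\<^esub> f)"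
    if "i \<in> {1..n}" for i
    by (rule End_eqI) (use that in \<open>simp_all add: \<rho> act_End act_End_extensional Pol_eq pol_x_eq
      flip: pol.cls_ops\<close>)
  moreover have "\<rho> (nh.cls (del i)) = odd_demazure n i" if "i \<in> {1..n}" for i
    using that by (simp add: \<rho> act_End_def odd_demazure_eq)
  ultimately have P: "?P \<rho>"
    by (simp add: nh_class_eq \<rho>_def NH_eq nh.descend_extensional)
  have "nh_action n = \<rho>"
    unfolding nh_action_def
  proof (rule the_equality)
    fix \<tau> assume t: "?P \<tau>"
    show "\<tau> = \<rho>"
      using P t
      by (intro nh.ring_hom_alg_eqI[OF ring_End_ring[OF ring_Pol]])
        (auto simp: NH_eq[symmetric] nh_class_eq[symmetric] elim!: nh_gens_cases)
  qed (rule P)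
  then show ?thesis by (simp add: nh_class_eq \<rho> assms)
qed

end

section \<open>The Weyl group of type B\<close>

lemma word_prod_Nil [simp]: "word_prod n [] = id"
  by (simp add: word_prod_def)

lemma word_prod_Cons [simp]: "word_prod n (k # ks) = simple_refl n k \<circ> word_prod n ks"
  by (simp add: word_prod_def)

lemma word_prod_append: "word_prod n (ks @ ls) = word_prod n ks \<circ> word_prod n ls"
  by (induction ks) (auto simp: comp_assoc)

text \<open>With \<open>e\<^bsub>-a\<^esub> = - e\<^sub>a\<close>, every root of the group is a difference \<open>e\<^sub>a - e\<^sub>b\<close> up to a factor: a pair \<open>(a, b)\<close>
  of signed indices.  This is the reflection in that root; for \<open>b = -a\<close> it is a sign change.\<close>

definition root_refl :: "int \<Rightarrow> int \<Rightarrow> int \<Rightarrow> int" where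
  "root_refl a b x =
    (if x = a then b else if x = b then a else if x = - a then - b else if x = - b then - a else x)"

text \<open>Braid moves only take place at the head of a word; moves further inside arise from
  \<open>consI\<close>.  This matches the induction on words below.\<close>

inductive braid_equiv :: "nat \<Rightarrow> nat list \<Rightarrow> nat list \<Rightarrow> bool" for n where
  reflI: "braid_equiv n ks ks"
| symI: "braid_equiv n ks ls \<Longrightarrow> braid_equiv n ls ks"
| transI: "braid_equiv n ks ls \<Longrightarrow> braid_equiv n ls ms \<Longrightarrow> braid_equiv n ks ms"
| consI: "braid_equiv n ks ls \<Longrightarrow> k \<in> {1..n} \<Longrightarrow> braid_equiv n (k # ks) (k # ls)"
| far: "1 \<le> i \<Longrightarrow> i + 1 < j \<Longrightarrow> j \<le> n \<Longrightarrow> set ks \<subseteq> {1..n} \<Longrightarrow> braid_equiv n (i # j # ks) (j # i # ks)"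
| braid3: "1 \<le> i \<Longrightarrow> i + 1 < n \<Longrightarrow> set ks \<subseteq> {1..n} \<Longrightarrow>
    braid_equiv n (i # (i + 1) # i # ks) ((i + 1) # i # (i + 1) # ks)"
| braid4: "2 \<le> n \<Longrightarrow> set ks \<subseteq> {1..n} \<Longrightarrow>
    braid_equiv n (n # (n - 1) # n # (n - 1) # ks) ((n - 1) # n # (n - 1) # n # ks)"

context positive_rank
begin

abbreviation s :: "nat \<Rightarrow> int \<Rightarrow> int" where "s \<equiv> simple_refl n"
abbreviation W :: "(int \<Rightarrow> int) set" where "W \<equiv> weyl_B n"
abbreviation letters_B :: "nat list set" where "letters_B \<equiv> lists {1..n}"

abbreviation winv :: "(int \<Rightarrow> int) \<Rightarrow> int \<Rightarrow> int" where "winv \<equiv> inv_into UNIV"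

definition signed :: "int set" where
  "signed = {x. 1 \<le> \<bar>x\<bar> \<and> \<bar>x\<bar> \<le> int n}"

text \<open>The \<open>i\<close>-th simple root is the pair \<open>(i, simple_snd i)\<close>.\<close>

definition simple_snd :: "nat \<Rightarrow> int" where
  "simple_snd i = (if i < n then int i + 1 else - int n)"

text \<open>The order \<open>1, 2, \<dots>, n, -n, \<dots>, -1\<close> of signed indices, turned into strictly decreasing numbers with
  \<open>height (-x) = - height x\<close>.  A root \<open>(a, b)\<close> is positive iff \<open>height b < height a\<close>.\<close>

definition height :: "int \<Rightarrow> int" where
  "height x = (if 0 < x then int n + 1 - x else - (int n + 1) - x)"

lemma s_less:
  "1 \<le> i \<Longrightarrow> i < n \<Longrightarrow> s i x =
    (if x = int i then int i + 1 else if x = int i + 1 then int i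
     else if x = - int i then - int i - 1 else if x = - int i - 1 then - int i else x)"
  by (smt (verit) simple_refl_def Transposition.transpose_def comp_apply of_nat_1 of_nat_le_iff)

lemma s_last: "s n x = (if x = int n then - int n else if x = - int n then int n else x)"
  by (simp add: simple_refl_def Transposition.transpose_def)

lemma s_cases:
  assumes "i \<in> {1..n}"
  obtains "1 \<le> i" "i < n" | "i = n"
  using assms by force

lemma s_apply:
  assumes "i \<in> {1..n}"
  shows "s i x = root_refl (int i) (simple_snd i) x"
  using assms
proof (cases rule: s_cases)
  case 1
  then show ?thesis by (simp add: s_less root_refl_def simple_snd_def)
next
  case 2
  then show ?thesis by (simp add: s_last root_refl_def simple_snd_def)
qed

lemma s_odd:
  assumes "i \<in> {1..n}" shows "s i (- x) = - s i x"
  using assms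
proof (cases rule: s_cases)
  case 1
  then show ?thesis by (smt (verit) s_less of_nat_1 of_nat_le_iff)
next
  case 2
  then show ?thesis by (simp add: s_last)
qed

lemma s_s [simp]: assumes "i \<in> {1..n}" shows "s i (s i x) = x"
  using assms
proof (cases rule: s_cases)
  case 1
  then show ?thesis by (smt (verit) s_less of_nat_1 of_nat_le_iff)
next
  case 2
  then show ?thesis by (simp add: s_last)
qed

lemma s_comp_s: "i \<in> {1..n} \<Longrightarrow> s i \<circ> s i = id"
  by (auto simp: fun_eq_iff)

lemma s_signed: assumes "i \<in> {1..n}" shows "s i x \<in> signed \<longleftrightarrow> x \<in> signed"
  using assms
proof (cases rule: s_cases)
  case 1
  have "1 \<le> int i" "int i < int n" using 1 by auto
  then show ?thesis unfolding s_less[OF 1] signed_def mem_Collect_eq by (smt (verit))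
next
  case 2
  then show ?thesis using n_pos by (auto simp: s_last signed_def)
qed

lemma height_uminus: "x \<in> signed \<Longrightarrow> height (- x) = - height x"
  by (auto simp: height_def signed_def)

lemma height_inj: "x \<in> signed \<Longrightarrow> y \<in> signed \<Longrightarrow> height x = height y \<longleftrightarrow> x = y"
  by (auto simp: height_def signed_def)

lemma bij_s: "i \<in> {1..n} \<Longrightarrow> bij (s i)"
  by (metis s_comp_s o_bij)

lemma word_bij: "set ks \<subseteq> {1..n} \<Longrightarrow> bij (word_prod n ks)"
  by (induction ks) (auto intro!: bij_comp bij_s)

lemma word_inv: "set ks \<subseteq> {1..n} \<Longrightarrow> winv (word_prod n ks) = word_prod n (rev ks)"
proof (induction ks)
  case (Cons k ks)
  have "winv (s k \<circ> word_prod n ks) = winv (word_prod n ks) \<circ> winv (s k)"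
    using Cons by (intro o_inv_distrib bij_s word_bij) auto
  also have "winv (s k) = s k"
    using Cons by (intro inv_unique_comp s_comp_s) auto
  finally show ?case using Cons by (simp add: word_prod_append)
qed auto

lemma word_odd: "set ks \<subseteq> {1..n} \<Longrightarrow> word_prod n ks (- x) = - word_prod n ks x"
  by (induction ks) (auto simp: s_odd simp del: atLeastAtMost_iff)

lemma word_signed: "set ks \<subseteq> {1..n} \<Longrightarrow> word_prod n ks x \<in> signed \<longleftrightarrow> x \<in> signed"
  by (induction ks) (auto simp: s_signed simp del: atLeastAtMost_iff)

lemma weyl_B_words: "w \<in> W \<longleftrightarrow> (\<exists>ks. set ks \<subseteq> {1..n} \<and> word_prod n ks = w)"
proof
  have comp: "x \<otimes>\<^bsub>BijGroup UNIV\<^esub> y = x \<circ> y" if "bij x" "bij y" for x y :: "int \<Rightarrow> int"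
    using that by (simp add: BijGroup_def Bij_def compose_def comp_def restrict_def)
  {
    assume "w \<in> W"
    then show "\<exists>ks. set ks \<subseteq> {1..n} \<and> word_prod n ks = w"
      unfolding weyl_B_def
    proof (induction rule: generate.induct)
      case one
      show ?case by (rule exI[of _ "[]"]) (simp add: BijGroup_def fun_eq_iff)
    next
      case (incl h)
      then obtain k where "k \<in> {1..n}" "h = s k" by auto
      then show ?case by (intro exI[of _ "[k]"]) auto
    next
      case (inv h)
      then obtain k where k: "k \<in> {1..n}" "h = s k" by auto
      then have "inv\<^bsub>BijGroup UNIV\<^esub> h = s k"
        using inv_BijGroup[of h UNIV] bij_s[OF k(1)] inv_unique_comp[OF s_comp_s[OF k(1)] s_comp_s[OF k(1)]]
        by (simp add: Bij_def restrict_def)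
      then show ?case using k by (intro exI[of _ "[k]"]) auto
    next
      case (eng h h')
      then obtain ks ls where "set ks \<subseteq> {1..n}" "word_prod n ks = h" "set ls \<subseteq> {1..n}" "word_prod n ls = h'"
        by auto
      then show ?case using word_bij
        by (intro exI[of _ "ks @ ls"]) (auto simp: word_prod_append comp)
    qed
  }
  assume "\<exists>ks. set ks \<subseteq> {1..n} \<and> word_prod n ks = w"
  then obtain ks where "set ks \<subseteq> {1..n}" "word_prod n ks = w" by auto
  then show "w \<in> W"
  proof (induction ks arbitrary: w)
    case Nil
    have "\<one>\<^bsub>BijGroup (UNIV :: int set)\<^esub> = id" by (simp add: BijGroup_def fun_eq_iff)
    moreover have "w = id" using Nil by (simp add: id_def)
    ultimately show ?case unfolding weyl_B_def by (metis generate.one)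
  next
    case (Cons k ks)
    then have "s k \<in> W" "word_prod n ks \<in> W"
      by (auto simp: weyl_B_def intro: generate.incl)
    then have "s k \<otimes>\<^bsub>BijGroup UNIV\<^esub> word_prod n ks \<in> W"
      unfolding weyl_B_def by (rule generate.eng)
    moreover have "w = s k \<circ> word_prod n ks" using Cons.prems word_prod_Cons by metis
    moreover have "bij (s k)" "bij (word_prod n ks)"
      using Cons.prems(1) bij_s[of k] word_bij[of ks] by simp_all
    ultimately show ?case using comp by metis
  qed
qed

lemma weyl_cases:
  assumes "w \<in> W"
  obtains ks where "set ks \<subseteq> {1..n}" "w = word_prod n ks"
  using assms weyl_B_words by auto

lemma weyl_s: "i \<in> {1..n} \<Longrightarrow> w \<in> W \<Longrightarrow> s i \<circ> w \<in> W"
  unfolding weyl_B_words by (elim exE, rule exI[of _ "i # ks" for ks]) auto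

lemma weyl_comp: "v \<in> W \<Longrightarrow> w \<in> W \<Longrightarrow> v \<circ> w \<in> W"
  unfolding weyl_B_words by (metis set_append Un_least word_prod_append)

lemma weyl_bij: "w \<in> W \<Longrightarrow> bij w"
  by (metis weyl_B_words word_bij)

lemma weyl_inv: "w \<in> W \<Longrightarrow> winv w \<in> W"
  unfolding weyl_B_words by (metis word_inv set_rev)

lemma weyl_odd: "w \<in> W \<Longrightarrow> w (- x) = - w x"
  by (auto elim!: weyl_cases simp: word_odd)

lemma weyl_signed: "w \<in> W \<Longrightarrow> w x \<in> signed \<longleftrightarrow> x \<in> signed"
  by (auto elim!: weyl_cases simp: word_signed)

lemma inv_s_comp: "i \<in> {1..n} \<Longrightarrow> w \<in> W \<Longrightarrow> winv (s i \<circ> w) = winv w \<circ> s i"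
  using o_inv_distrib[OF bij_s weyl_bij, of i w] inv_unique_comp[OF s_comp_s s_comp_s, of i]
  by simp

lemma weyl_s_s: "i \<in> {1..n} \<Longrightarrow> s i \<circ> (s i \<circ> w) = w"
  by (auto simp: fun_eq_iff)

definition len :: "(int \<Rightarrow> int) \<Rightarrow> nat" where
  "len w = (LEAST l. \<exists>ks. set ks \<subseteq> {1..n} \<and> word_prod n ks = w \<and> length ks = l)"

lemma len_le: "set ks \<subseteq> {1..n} \<Longrightarrow> len (word_prod n ks) \<le> length ks"
  unfolding len_def by (rule Least_le) auto

lemma len_attained:
  assumes "w \<in> W"
  obtains ks where "set ks \<subseteq> {1..n}" "word_prod n ks = w" "length ks = len w"
proof -
  have "\<exists>l ks. set ks \<subseteq> {1..n} \<and> word_prod n ks = w \<and> length ks = l"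
    using assms weyl_B_words by auto
  from LeastI_ex[OF this] show thesis unfolding len_def[symmetric] using that by auto
qed

lemma reduced_iff:
  "reduced_expression n w ks \<longleftrightarrow> set ks \<subseteq> {1..n} \<and> word_prod n ks = w \<and> length ks = len w"
proof
  assume r: "reduced_expression n w ks"
  then have "w \<in> W" by (auto simp: weyl_B_words reduced_expression_def)
  then obtain ls where "set ls \<subseteq> {1..n}" "word_prod n ls = w" "length ls = len w" by (rule len_attained)
  then show "set ks \<subseteq> {1..n} \<and> word_prod n ks = w \<and> length ks = len w"
    using r len_le[of ks] by (auto simp: reduced_expression_def intro!: antisym)
next
  assume r: "set ks \<subseteq> {1..n} \<and> word_prod n ks = w \<and> length ks = len w"
  then show "reduced_expression n w ks"
    unfolding reduced_expression_def by (metis len_le)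
qed

lemma reduced_exists:
  assumes "w \<in> W"
  obtains ks where "reduced_expression n w ks"
  using len_attained[OF assms] reduced_iff by metis

lemma len_s_le: "i \<in> {1..n} \<Longrightarrow> w \<in> W \<Longrightarrow> len (s i \<circ> w) \<le> Suc (len w)"
  by (erule len_attained) (use len_le[of "i # _"] in fastforce)

lemma len_inv: assumes "w \<in> W" shows "len (winv w) = len w"
proof -
  have le: "len (winv w) \<le> len w" if "w \<in> W" for w
    using that by (metis len_attained len_le length_rev set_rev word_inv)
  show ?thesis using le[OF assms] le[OF weyl_inv[OF assms]] weyl_bij[OF assms] by (simp add: inv_inv_eq)
qed

lemma len_0: "w \<in> W \<Longrightarrow> len w = 0 \<Longrightarrow> w = id"
  by (metis len_attained length_0_conv word_prod_Nil)

lemma len_id: "len id = 0"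
  using len_le[of "[]"] by simp

text \<open>Left descents, expressed by the inverse of \<open>w\<close> making the simple root negative; that they are the
  letters which shorten \<open>w\<close> is the content of \<open>len_descent\<close> and \<open>len_ascent\<close>.\<close>

definition descent :: "nat \<Rightarrow> (int \<Rightarrow> int) \<Rightarrow> bool" where
  "descent i w \<longleftrightarrow> height (winv w (int i)) < height (winv w (simple_snd i))"

lemma s_conj:
  "i \<in> {1..n} \<Longrightarrow> s i (root_refl a b x) = root_refl (s i a) (s i b) (s i x)"
proof -
  assume i: "i \<in> {1..n}"
  have inj: "s i u = s i v \<longleftrightarrow> u = v" for u v using s_s[OF i] by metis
  show ?thesis unfolding root_refl_def s_odd[OF i, symmetric] inj by auto
qed

text \<open>A simple reflection exchanges signed indices of neighbouring heights and fixes the others, so the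
  only positive root that it makes negative is its own.\<close>

lemma simple_root_only:
  assumes "k \<in> {1..n}" "a \<in> signed" "b \<in> signed" "height b < height a" "height (s k a) \<le> height (s k b)"
  shows "root_refl a b = s k"
  using assms(1)
proof (cases rule: s_cases)
  case 1
  have k: "1 \<le> int k" "int k < int n" using 1 by auto
  have "(a = int k \<and> b = int k + 1) \<or> (a = - int k - 1 \<and> b = - int k)"
    using k assms(2-) unfolding s_less[OF 1] signed_def height_def mem_Collect_eq by (smt (verit))
  then show ?thesis
    unfolding fun_eq_iff s_less[OF 1] root_refl_def using k by (smt (verit))
next
  case 2
  then have "a = int n \<and> b = - int n"
    using assms(2-) unfolding s_last signed_def height_def mem_Collect_eq 2 by (smt (verit))
  then show ?thesis
    unfolding fun_eq_iff s_last root_refl_def 2 by auto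
qed

text \<open>The strong exchange condition.  If \<open>w\<inverse>\<close> makes the positive root \<open>(a, b)\<close> negative, follow the root
  through the word from the left: the first letter that makes it negative is the reflection
  in the current root, and multiplying by the reflection in \<open>(a, b)\<close> deletes exactly that letter.\<close>

lemma exchange:
  assumes "set ks \<subseteq> {1..n}" "a \<in> signed" "b \<in> signed" "height b < height a"
    and "height (word_prod n (rev ks) a) < height (word_prod n (rev ks) b)"
  shows "\<exists>ls. set ls \<subseteq> {1..n} \<and> Suc (length ls) = length ks \<and>
    root_refl a b \<circ> word_prod n ks = word_prod n ls"
  using assms
proof (induction ks arbitrary: a b)
  case (Cons k ks)
  then have k: "k \<in> {1..n}" by auto
  show ?case
  proof (cases "height (s k b) < height (s k a)")
    case True
    then have "\<exists>ls. set ls \<subseteq> {1..n} \<and> Suc (length ls) = length ks \<and>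
      root_refl (s k a) (s k b) \<circ> word_prod n ks = word_prod n ls"
      using Cons.prems k by (intro Cons.IH) (auto simp: word_prod_append s_signed)
    then obtain ls where ls: "set ls \<subseteq> {1..n}" "Suc (length ls) = length ks"
      "root_refl (s k a) (s k b) \<circ> word_prod n ks = word_prod n ls"
      by blast
    have "root_refl a b (s k x) = s k (root_refl (s k a) (s k b) x)" for x
      using s_conj[OF k, of "s k a" "s k b" x] k by simp
    then have "root_refl a b \<circ> word_prod n (k # ks) = word_prod n (k # ls)"
      unfolding word_prod_Cons ls(3)[symmetric] by (simp add: fun_eq_iff)
    then show ?thesis using ls(1,2) k by (intro exI[of _ "k # ls"]) (simp del: word_prod_Cons)
  next
    case False
    then have "root_refl a b = s k"
      using Cons.prems k by (intro simple_root_only) auto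
    then show ?thesis using Cons.prems k by (intro exI[of _ ks]) (auto simp: fun_eq_iff)
  qed
qed auto

lemma simple_root:
  assumes "i \<in> {1..n}"
  shows "int i \<in> signed" "simple_snd i \<in> signed" "height (simple_snd i) < height (int i)"
    "int i \<noteq> simple_snd i" "s i (int i) = simple_snd i" "s i (simple_snd i) = int i"
  using assms n_pos by (auto elim!: s_cases simp: signed_def simple_snd_def height_def s_less s_last)

lemma descent_s:
  assumes "i \<in> {1..n}" "w \<in> W"
  shows "descent i (s i \<circ> w) \<longleftrightarrow> \<not> descent i w"
proof -
  have "height (winv w (int i)) \<noteq> height (winv w (simple_snd i))"
    using simple_root[OF assms(1)] weyl_signed[OF weyl_inv[OF assms(2)]]
      bij_is_inj[OF weyl_bij[OF weyl_inv[OF assms(2)]]]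
    by (auto simp: height_inj inj_eq)
  then show ?thesis
    using assms simple_root[OF assms(1)] by (auto simp: descent_def inv_s_comp)
qed

lemma len_descent:
  assumes "i \<in> {1..n}" "w \<in> W" "descent i w"
  shows "len w = Suc (len (s i \<circ> w))"
proof -
  obtain ks where ks: "set ks \<subseteq> {1..n}" "word_prod n ks = w" "length ks = len w"
    using len_attained[OF assms(2)] .
  then obtain ls where ls: "set ls \<subseteq> {1..n}" "Suc (length ls) = length ks"
    "root_refl (int i) (simple_snd i) \<circ> word_prod n ks = word_prod n ls"
    using exchange[of ks "int i" "simple_snd i"] simple_root[OF assms(1)] assms(3)
    by (auto simp: descent_def simp flip: word_inv)
  have "root_refl (int i) (simple_snd i) = s i"
    using s_apply[OF assms(1)] by (simp add: fun_eq_iff)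
  then have "len (s i \<circ> w) \<le> length ls"
    using ls ks len_le[of ls] by simp
  moreover have "len w \<le> Suc (len (s i \<circ> w))"
    using len_s_le[OF assms(1) weyl_s[OF assms(1,2)]] assms(1) by (simp add: weyl_s_s)
  ultimately show ?thesis using ks ls by simp
qed

lemma len_ascent:
  assumes "i \<in> {1..n}" "w \<in> W" "\<not> descent i w"
  shows "len (s i \<circ> w) = Suc (len w)"
  using len_descent[OF assms(1) weyl_s[OF assms(1,2)]] descent_s[OF assms(1,2)] assms
  by (simp add: weyl_s_s)

lemma reduced_Cons:
  assumes "reduced_expression n w (i # u)"
  shows "i \<in> {1..n}" "w \<in> W" "reduced_expression n (s i \<circ> w) u" "descent i w"
proof -
  have r: "i \<in> {1..n}" "set u \<subseteq> {1..n}" "w = s i \<circ> word_prod n u" "len w = Suc (length u)"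
    using assms by (auto simp: reduced_iff)
  show "i \<in> {1..n}" by fact
  show w: "w \<in> W" unfolding weyl_B_words using r by (intro exI[of _ "i # u"]) auto
  have u: "s i \<circ> w = word_prod n u" using r by (simp add: weyl_s_s)
  have le: "len (s i \<circ> w) \<le> length u" using u r len_le[of u] by simp
  then show d: "descent i w"
    using len_ascent[OF r(1) w] r(4) by fastforce
  show "reduced_expression n (s i \<circ> w) u"
    using r u len_descent[OF r(1) w d] by (simp add: reduced_iff)
qed

lemma reduced_ConsI:
  "i \<in> {1..n} \<Longrightarrow> w \<in> W \<Longrightarrow> descent i w \<Longrightarrow> reduced_expression n (s i \<circ> w) u \<Longrightarrow>
    reduced_expression n w (i # u)"
  by (auto simp: reduced_iff len_descent weyl_s_s)

section \<open>Matsumoto's theorem\<close>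

lemma descent_less:
  "i < n \<Longrightarrow> descent i w \<longleftrightarrow> height (winv w (int i)) < height (winv w (int i + 1))"
  by (simp add: descent_def simple_snd_def)

lemma descent_last: "descent n w \<longleftrightarrow> height (winv w (int n)) < height (winv w (- int n))"
  by (simp add: descent_def simple_snd_def)

lemma s_triple:
  assumes "i \<in> {1..n}" "j \<in> {1..n}"
  shows "s i (s j (s i x)) = root_refl (s i (int j)) (s i (simple_snd j)) x"
  using s_conj[OF assms(1), of "int j" "simple_snd j" "s i x"] assms by (simp add: s_apply[OF assms(2)])

text \<open>Two reduced expressions of one element may start with different letters \<open>i\<close>, \<open>j\<close>.  Then both are
  descents, and the alternating words in \<open>i\<close> and \<open>j\<close> of full length \<open>2\<close>, \<open>3\<close> or \<open>4\<close> can be split off on the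
  left; a single braid move connects the two resulting expressions.\<close>

lemma two_descents:
  assumes ij: "i \<in> {1..n}" "j \<in> {1..n}" "i < j" and w: "w \<in> W" and d: "descent i w" "descent j w"
  obtains p q where "reduced_expression n w (i # p)" "reduced_expression n w (j # q)"
    "braid_equiv n (i # p) (j # q)"
proof -
  consider "i + 1 < j" | "j = i + 1" "j < n" | "j = n" "i = n - 1" "2 \<le> n"
    using ij by fastforce
  then show thesis
  proof cases
    case 1
    have i: "1 \<le> i" "i < n" using 1 ij by auto
    have fix_j: "s i (int j) = int j" "s i (simple_snd j) = simple_snd j"
      using i 1 ij by (simp_all add: s_less simple_snd_def)
    have fix_i: "s j (int i) = int i" "s j (simple_snd i) = simple_snd i"
      using i 1 ij by (cases "j < n"; simp add: s_less s_last simple_snd_def)+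
    have d2: "descent j (s i \<circ> w)" "descent i (s j \<circ> w)"
      using d ij(1,2) w by (simp_all add: descent_def inv_s_comp fix_i fix_j del: atLeastAtMost_iff)
    have comm: "s j \<circ> (s i \<circ> w) = s i \<circ> (s j \<circ> w)"
      using s_conj[OF ij(1), of "int j" "simple_snd j"] s_apply[OF ij(2)]
      by (simp add: fun_eq_iff fix_j)
    obtain p where p: "reduced_expression n (s j \<circ> (s i \<circ> w)) p"
      using reduced_exists ij w weyl_s by metis
    show thesis
    proof (rule that[of "j # p" "i # p"])
      show "reduced_expression n w (i # j # p)"
        using p d d2 ij w by (intro reduced_ConsI weyl_s) auto
      show "reduced_expression n w (j # i # p)"
        using p d d2 ij w comm by (intro reduced_ConsI weyl_s) auto
      show "braid_equiv n (i # j # p) (j # i # p)"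
        using 1 ij p by (intro braid_equiv.far) (auto simp: reduced_iff)
    qed
  next
    case 2
    let ?v = "winv w"
    have i: "1 \<le> i" "i < n" "1 \<le> j" "j < n" using ij 2 by auto
    have inc: "height (?v (int i)) < height (?v (int i + 1))" "height (?v (int i + 1)) < height (?v (int i + 2))"
      using d 2 i by (auto simp: descent_less algebra_simps)
    have "s j (int i) = int i" "s j (int i + 1) = int i + 2" "s i (int j) = int i" "s i (int j + 1) = int i + 2"
      using i 2 by (simp_all add: s_less)
    then have braid: "s j \<circ> (s i \<circ> (s j \<circ> w)) = s i \<circ> (s j \<circ> (s i \<circ> w))"
      using s_triple[OF ij(1,2)] s_triple[OF ij(2,1)] i
      by (simp add: fun_eq_iff simple_snd_def)
    obtain p where p: "reduced_expression n (s i \<circ> (s j \<circ> (s i \<circ> w))) p"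
      using reduced_exists ij w weyl_s by metis
    have d2: "descent j (s i \<circ> w)" "descent i (s j \<circ> (s i \<circ> w))"
      "descent i (s j \<circ> w)" "descent j (s i \<circ> (s j \<circ> w))"
      using inc i 2 w by (simp_all add: descent_less inv_s_comp weyl_s s_less algebra_simps)
    show thesis
    proof (rule that[of "j # i # p" "i # j # p"])
      show "reduced_expression n w (i # j # i # p)"
        using p d d2 ij w by (intro reduced_ConsI weyl_s) auto
      show "reduced_expression n w (j # i # j # p)"
        using p d d2 ij w braid by (intro reduced_ConsI weyl_s) auto
      show "braid_equiv n (i # j # i # p) (j # i # j # p)"
        unfolding 2(1) using i 2 p by (intro braid_equiv.braid3) (auto simp: reduced_iff)
    qed
  next
    case 3
    let ?v = "winv w"
    have i: "1 \<le> i" "i < n" "int i = int n - 1" using ij 3 by auto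
    have S: "int i \<in> signed" "int n \<in> signed" using i by (auto simp: signed_def)
    have odd: "?v (- x) = - ?v x" for x using weyl_odd[OF weyl_inv[OF w]] .
    have neg: "height (?v (- x)) = - height (?v x)" if "x \<in> signed" for x
      using that weyl_signed[OF weyl_inv[OF w]] by (simp add: odd height_uminus)
    have inc: "height (?v (int i)) < height (?v (int n))" "height (?v (int n)) < 0"
      using d 3 i neg[OF S(2)] by (simp_all add: descent_less descent_last)
    have n: "n \<in> {1..n}" using n_pos by simp
    obtain p where p: "reduced_expression n (s n \<circ> (s i \<circ> (s n \<circ> (s i \<circ> w)))) p"
      using reduced_exists ij(1) n w weyl_s by metis
    have vs: "winv (s k \<circ> u) x = winv u (s k x)" if "k \<in> {1..n}" "u \<in> W" for k u x
      using that by (simp add: inv_s_comp)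
    have sv: "s i (int i) = int n" "s i (int n) = int i" "s i (- int i) = - int n" "s i (- int n) = - int i"
      "s n (int i) = int i" "s n (- int i) = - int i" "s n (int n) = - int n" "s n (- int n) = int n"
      using i by (auto simp: s_less s_last)
    have triple: "s i (s n (s i x)) = root_refl (int i) (- int i) x" for x
      using s_triple[OF ij(1) n] by (simp add: simple_snd_def sv)
    have braid: "s n \<circ> (s i \<circ> (s n \<circ> (s i \<circ> w))) = s i \<circ> (s n \<circ> (s i \<circ> (s n \<circ> w)))"
      using s_conj[OF n, of "int i" "- int i"] by (simp add: fun_eq_iff triple sv)
    note D = descent_less[OF i(2)] descent_last
    have i1: "int i + 1 = int n" using i by simp
    have d2: "descent n (s i \<circ> w)" "descent i (s n \<circ> (s i \<circ> w))" "descent n (s i \<circ> (s n \<circ> (s i \<circ> w)))"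
      "descent i (s n \<circ> w)" "descent n (s i \<circ> (s n \<circ> w))" "descent i (s n \<circ> (s i \<circ> (s n \<circ> w)))"
      unfolding D i1 using inc neg[OF S(1)] neg[OF S(2)] ij(1) n w
      by (simp_all add: vs weyl_s sv del: atLeastAtMost_iff)
    have i': "i = n - 1" using 3 by simp
    show thesis
    proof (rule that[of "n # i # n # p" "i # n # i # p"])
      show "reduced_expression n w (i # n # i # n # p)"
        using p d d2 ij n w 3 by (intro reduced_ConsI weyl_s) auto
      show "reduced_expression n w (j # i # n # i # p)"
        unfolding \<open>j = n\<close> using p d d2 ij n w braid 3 by (intro reduced_ConsI weyl_s) auto
      show "braid_equiv n (i # n # i # n # p) (j # i # n # i # p)"
        unfolding \<open>j = n\<close> i' using 3 p by (intro braid_equiv.symI[OF braid_equiv.braid4]) (auto simp: reduced_iff)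
    qed
  qed
qed

text \<open>Induction on the length: two reduced words with the same first letter are compared by the
  induction hypothesis; otherwise \<open>two_descents\<close> supplies words with these first letters
  that differ by a single braid move.\<close>

theorem matsumoto:
  assumes "reduced_expression n w ks" "reduced_expression n w ls"
  shows "braid_equiv n ks ls"
  using assms
proof (induction "length ks" arbitrary: w ks ls)
  case 0
  moreover have "length ls = length ks" using 0 by (simp only: reduced_iff)
  ultimately have "ks = []" "ls = []" by simp_all
  then show ?case by (simp add: braid_equiv.reflI)
next
  case (Suc l)
  from Suc.hyps Suc.prems obtain i u j v where ks: "ks = i # u" and ls: "ls = j # v"
    by (cases ks; cases ls) (auto simp: reduced_iff)
  have IH: "braid_equiv n (k # p) (k # q)"
    if "reduced_expression n w (k # p)" "reduced_expression n w (k # q)" for k p q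
  proof (rule braid_equiv.consI)
    have "l = length p" using Suc.hyps(2) Suc.prems(1) that(1) by (simp add: reduced_iff)
    then show "braid_equiv n p q"
      using Suc.hyps(1) reduced_Cons(3)[OF that(1)] reduced_Cons(3)[OF that(2)] by blast
    show "k \<in> {1..n}" using reduced_Cons(1)[OF that(1)] .
  qed
  note i = reduced_Cons[OF Suc.prems(1)[unfolded ks]]
  note j = reduced_Cons[OF Suc.prems(2)[unfolded ls]]
  show ?case
  proof (cases "i = j")
    case True
    then show ?thesis using IH Suc.prems ks ls by simp
  next
    case False
    then obtain p q where pq: "reduced_expression n w (i # p)" "reduced_expression n w (j # q)"
      "braid_equiv n (i # p) (j # q)"
      using two_descents[of i j w] two_descents[of j i w] i j
      by (metis braid_equiv.symI linorder_neqE_nat)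
    then show ?thesis
      using IH[of i u p] IH[of j q v] Suc.prems ks ls by (metis braid_equiv.transI)
  qed
qed

text \<open>At the first letter \<open>k\<close>, from the right, where the word fails to be reduced, \<open>k\<close> is a descent of the
  remaining word, which therefore is braid equivalent to one starting with \<open>k\<close>.\<close>

lemma not_reduced_square:
  assumes "set ks \<subseteq> {1..n}" "\<not> reduced_expression n (word_prod n ks) ks"
  shows "\<exists>p i q. i \<in> {1..n} \<and> set p \<subseteq> {1..n} \<and> set q \<subseteq> {1..n} \<and> braid_equiv n ks (p @ i # i # q)"
  using assms
proof (induction ks)
  case Nil
  then show ?case by (simp add: reduced_iff len_id id_def[symmetric])
next
  case (Cons k u)
  then have k: "k \<in> {1..n}" "set u \<subseteq> {1..n}" by auto
  show ?case
  proof (cases "reduced_expression n (word_prod n u) u")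
    case False
    then obtain p i q where "i \<in> {1..n}" "set p \<subseteq> {1..n}" "set q \<subseteq> {1..n}" "braid_equiv n u (p @ i # i # q)"
      using Cons.IH k by blast
    then show ?thesis
      using k(1) by (intro exI[of _ "k # p"] exI[of _ i] exI[of _ q])
        (auto intro: braid_equiv.consI simp del: atLeastAtMost_iff)
  next
    case True
    have W: "word_prod n u \<in> W" using k weyl_B_words by auto
    have "descent k (word_prod n u)"
    proof (rule ccontr)
      assume "\<not> descent k (word_prod n u)"
      then have "len (word_prod n (k # u)) = Suc (len (word_prod n u))"
        using len_ascent[OF k(1) W] word_prod_Cons by metis
      then show False
        using True Cons.prems reduced_iff by (metis length_Cons)
    qed
    moreover obtain p where p: "reduced_expression n (s k \<circ> word_prod n u) p"
      using reduced_exists[OF weyl_s[OF k(1) W]] .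
    ultimately have "reduced_expression n (word_prod n u) (k # p)"
      using k(1) W by (intro reduced_ConsI)
    then have "braid_equiv n (k # u) (k # k # p)"
      using True k(1) by (intro braid_equiv.consI matsumoto)
    then show ?thesis
      using k(1) p by (intro exI[of _ "[]"] exI[of _ k] exI[of _ p]) (simp add: reduced_iff)
  qed
qed

section \<open>The longest element\<close>

definition w_long :: "int \<Rightarrow> int" where
  "w_long x = (if x \<in> signed then - x else x)"

text \<open>The palindrome \<open>k, \<dots>, n, \<dots>, k\<close>; it spells the sign change of the \<open>k\<close>-th coordinate.\<close>

definition sign_word :: "nat \<Rightarrow> nat list" where
  "sign_word k = [k..<n] @ n # rev [k..<n]"

definition long_word :: "nat list" where
  "long_word = concat (map sign_word [1..<Suc n])"

lemma word_prod_sign_word: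
  "k \<in> {1..n} \<Longrightarrow> word_prod n (sign_word k) x = (if \<bar>x\<bar> = int k then - x else x)"
proof (induction "n - k" arbitrary: k x)
  case 0
  then show ?case by (auto simp: sign_word_def s_last)
next
  case (Suc d)
  then have k: "1 \<le> k" "k < n" by auto
  have "sign_word k = k # sign_word (Suc k) @ [k]"
    using k by (simp add: sign_word_def upt_conv_Cons)
  moreover have "word_prod n (sign_word (Suc k)) y = (if \<bar>y\<bar> = int (Suc k) then - y else y)" for y
    using Suc k by (intro Suc.hyps) auto
  ultimately have eq: "word_prod n (sign_word k) x = s k (if \<bar>s k x\<bar> = int k + 1 then - s k x else s k x)"
    by (simp add: word_prod_append)
  have v: "s k (int k) = int k + 1" "s k (int k + 1) = int k"
    "s k (- int k) = - (int k + 1)" "s k (- (int k + 1)) = - int k"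
    using s_less[OF k] k by simp_all
  consider "x = int k" | "x = - int k" | "x = int k + 1" | "x = - (int k + 1)"
    | "\<bar>x\<bar> \<noteq> int k" "\<bar>x\<bar> \<noteq> int k + 1" by linarith
  then show ?case
  proof cases
    case 5
    then have "s k x = x" using s_less[OF k, of x] by auto
    then show ?thesis using eq 5 by simp
  qed (use eq v v(2)[unfolded add.commute[of _ 1]] in simp_all)
qed

lemma sign_word_set: "k \<in> {1..n} \<Longrightarrow> set (sign_word k) \<subseteq> {1..n}"
  by (auto simp: sign_word_def)

lemma long_word_set: "set long_word \<subseteq> {1..n}"
proof -
  have "set (sign_word k) \<subseteq> {1..n}" if "k \<in> set [1..<Suc n]" for k
    using that n_pos by (intro sign_word_set) auto
  then show ?thesis unfolding long_word_def set_concat set_map by blast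
qed

lemma word_prod_long_word: "word_prod n long_word = w_long"
proof
  fix x
  have "word_prod n (concat (map sign_word [1..<Suc m])) x =
      (if 1 \<le> \<bar>x\<bar> \<and> \<bar>x\<bar> \<le> int m then - x else x)" if "m \<le> n" for m
    using that
  proof (induction m arbitrary: x)
    case (Suc m)
    let ?y = "if \<bar>x\<bar> = int (Suc m) then - x else x"
    have "word_prod n (concat (map sign_word [1..<Suc (Suc m)])) x =
        word_prod n (concat (map sign_word [1..<Suc m])) ?y"
      using Suc.prems word_prod_sign_word[of "Suc m" x] by (simp add: word_prod_append)
    also have "\<dots> = (if 1 \<le> \<bar>?y\<bar> \<and> \<bar>?y\<bar> \<le> int m then - ?y else ?y)"
      using Suc.prems by (intro Suc.IH) simp
    also have "\<dots> = (if 1 \<le> \<bar>x\<bar> \<and> \<bar>x\<bar> \<le> int (Suc m) then - x else x)"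
      by (cases "\<bar>x\<bar> = int (Suc m)") auto
    finally show ?case .
  qed auto
  from this[of n] show "word_prod n long_word x = w_long x"
    by (simp add: long_word_def w_long_def signed_def)
qed

lemma w_long_W: "w_long \<in> W"
  unfolding weyl_B_words
  by (rule exI[of _ long_word], rule conjI[OF long_word_set word_prod_long_word])

lemma w_long_w_long: "w_long \<circ> w_long = id"
proof
  fix x show "(w_long \<circ> w_long) x = id x"
  proof (cases "x \<in> signed")
    case True
    then have "- x \<in> signed" by (simp add: signed_def)
    with True show ?thesis by (simp add: w_long_def)
  qed (simp add: w_long_def)
qed

lemma w_long_s:
  assumes "i \<in> {1..n}"
  shows "w_long \<circ> (s i \<circ> w) = s i \<circ> (w_long \<circ> w)"
proof
  fix x show "(w_long \<circ> (s i \<circ> w)) x = (s i \<circ> (w_long \<circ> w)) x"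
    using s_signed[OF assms, of "w x"] s_odd[OF assms, of "w x"]
    by (cases "w x \<in> signed") (simp_all add: w_long_def)
qed

lemma inv_w_long: "w \<in> W \<Longrightarrow> winv (w_long \<circ> w) = winv w \<circ> w_long"
  using o_inv_distrib[OF weyl_bij[OF w_long_W] weyl_bij]
    inv_unique_comp[OF w_long_w_long w_long_w_long] by simp

lemma descent_w_long:
  assumes "i \<in> {1..n}" "w \<in> W"
  shows "descent i (w_long \<circ> w) \<longleftrightarrow> \<not> descent i w"
proof -
  have iw: "winv w \<in> W" using weyl_inv assms by simp
  have "height (winv w (int i)) \<noteq> height (winv w (simple_snd i))"
    using simple_root[OF assms(1)] weyl_signed[OF iw] bij_is_inj[OF weyl_bij[OF iw]]
    by (auto simp: height_inj inj_eq)
  moreover have height_long: "height (winv (w_long \<circ> w) x) = - height (winv w x)" if "x \<in> signed" for x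
  proof -
    have "winv (w_long \<circ> w) x = winv w (w_long x)"
      by (simp only: inv_w_long[OF assms(2)] comp_apply)
    also have "\<dots> = - winv w x"
      using that weyl_odd[OF iw, of x] by (simp only: w_long_def if_True)
    finally show ?thesis
      using height_uminus weyl_signed[OF iw] that by metis
  qed
  ultimately show ?thesis
    unfolding descent_def height_long[OF simple_root(1)[OF assms(1)]]
      height_long[OF simple_root(2)[OF assms(1)]] by linarith
qed

text \<open>Composition with \<open>-1\<close> reverses the order of heights, so it turns descents into ascents.  Hence the
  sum of both lengths does not change when \<open>w\<close> is multiplied by a simple reflection.\<close>

lemma len_w_long:
  assumes "w \<in> W"
  shows "len w + len (w_long \<circ> w) = len w_long"
proof -
  obtain ks where "set ks \<subseteq> {1..n}" "w = word_prod n ks" using assms by (rule weyl_cases)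
  then show ?thesis
  proof (induction ks arbitrary: w)
    case Nil
    then have "w = id" by (simp only: word_prod_Nil)
    then show ?case by (simp only: len_id comp_id add_0)
  next
    case (Cons k ks)
    then have k: "k \<in> {1..n}" "word_prod n ks \<in> W" by (auto simp: weyl_B_words)
    let ?u = "word_prod n ks"
    have "len w + len (w_long \<circ> w) = len (s k \<circ> ?u) + len (s k \<circ> (w_long \<circ> ?u))"
      unfolding Cons.prems(2) word_prod_Cons w_long_s[OF k(1)] ..
    also have "\<dots> = len ?u + len (w_long \<circ> ?u)"
      using len_descent[OF k] len_ascent[OF k] descent_w_long[OF k]
        len_descent[OF k(1) weyl_comp[OF w_long_W k(2)]] len_ascent[OF k(1) weyl_comp[OF w_long_W k(2)]]
      by (cases "descent k ?u") auto
    also have "\<dots> = len w_long"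
      by (rule Cons.IH[OF _ refl]) (use Cons.prems(1) in simp)
    finally show ?case .
  qed
qed

lemma len_le_w_long: "w \<in> W \<Longrightarrow> len w \<le> len w_long"
  using len_w_long by (metis le_add1)

lemma len_eq_w_long:
  assumes "w \<in> W" "len w = len w_long"
  shows "w = w_long"
proof -
  have "w_long \<circ> w = id"
    using len_w_long[OF assms(1)] assms len_0[OF weyl_comp[OF w_long_W assms(1)]] by simp
  then have "w_long \<circ> (w_long \<circ> w) = w_long" by simp
  then show ?thesis using w_long_w_long by (simp add: comp_assoc[symmetric])
qed

end

section \<open>Congruence up to sign and spanning sets\<close>

context presentation
begin

text \<open>Signs in the skew setting are plentiful but rarely matter.  Working up to sign, variables
  commute and braid moves are equalities; only sums require more care.\<close>

definition sim :: "'g free_elt \<Rightarrow> 'g free_elt \<Rightarrow> bool" where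
  "sim a b \<longleftrightarrow> a - b \<in> rel_ideal \<or> a + b \<in> rel_ideal"

lemma sim_refl [simp]: "sim a a"
  by (simp add: sim_def)

lemma sim_sym: "sim a b \<Longrightarrow> sim b a"
  unfolding sim_def using rel_ideal_uminus[of "a - b"] by (auto simp: add.commute)

lemma sim_trans [trans]:
  assumes "sim a b" "sim b c"
  shows "sim a c"
proof -
  have "a - c = (a - b) + (b - c)" "a - c = (a + b) - (b + c)"
    "a + c = (a - b) + (b + c)" "a + c = (a + b) - (b - c)"
    by simp_all
  then show ?thesis
    using assms unfolding sim_def by (metis rel_ideal_add rel_ideal_diff)
qed

lemma sim_left: "c \<in> carrier (free_alg G) \<Longrightarrow> sim a b \<Longrightarrow> sim (c * a) (c * b)"
  unfolding sim_def using rel_ideal_left[of c "a - b"] rel_ideal_left[of c "a + b"]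
  by (auto simp: algebra_simps)

lemma sim_right: "c \<in> carrier (free_alg G) \<Longrightarrow> sim a b \<Longrightarrow> sim (a * c) (b * c)"
  unfolding sim_def using rel_ideal_right[of "a - b" c] rel_ideal_right[of "a + b" c]
  by (auto simp: algebra_simps)

lemma sim_uminus [simp]: "sim (- a) b \<longleftrightarrow> sim a b" "sim a (- b) \<longleftrightarrow> sim a b"
proof -
  have "- a - b = - (a + b)" "- a + b = - (a - b)" by simp_all
  then show "sim (- a) b \<longleftrightarrow> sim a b" unfolding sim_def by (metis rel_ideal_uminus_iff)
  show "sim a (- b) \<longleftrightarrow> sim a b" by (auto simp: sim_def)
qed

lemma sim_congruent: "a - b \<in> rel_ideal \<Longrightarrow> sim a b"
  by (simp add: sim_def)

lemma sim_0: "sim a 0 \<longleftrightarrow> a \<in> rel_ideal"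
  by (simp add: sim_def)

inductive spanned :: "('i \<Rightarrow> 'g free_elt) \<Rightarrow> 'i set \<Rightarrow> 'g free_elt \<Rightarrow> bool" for v I where
  ideal: "f \<in> rel_ideal \<Longrightarrow> spanned v I f"
| base: "i \<in> I \<Longrightarrow> spanned v I (v i)"
| diff: "spanned v I f \<Longrightarrow> spanned v I g \<Longrightarrow> spanned v I (f - g)"

lemma spanned_uminus: "spanned v I f \<Longrightarrow> spanned v I (- f)"
  using spanned.diff[OF spanned.ideal[OF rel_ideal_0], of v I f] by simp

lemma spanned_add: "spanned v I f \<Longrightarrow> spanned v I g \<Longrightarrow> spanned v I (f + g)"
  using spanned.diff[OF _ spanned_uminus, of v I f g] by simp

lemma spanned_congruent: "f - g \<in> rel_ideal \<Longrightarrow> spanned v I g \<Longrightarrow> spanned v I f"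
  using spanned_add[OF spanned.ideal, of "f - g" v I g] by simp

lemma spanned_sim:
  assumes "sim f g" "spanned v I g"
  shows "spanned v I f"
  using assms spanned_congruent[of f g v I] spanned_congruent[of f "- g" v I] spanned_uminus[of v I g]
  unfolding sim_def by auto

text \<open>Closure rules make \<open>spanned\<close> convenient for inductions; this recovers the explicit sums.\<close>

lemma spanned_combination:
  assumes "spanned v I f"
  shows "\<exists>F c. finite F \<and> F \<subseteq> I \<and> f - (\<Sum>i\<in>F. frag_cmul (c i) (v i)) \<in> rel_ideal"
  using assms
proof (induction rule: spanned.induct)
  case (ideal f)
  then show ?case by (intro exI[of _ "{}"]) auto
next
  case (base i)
  then show ?case by (intro exI[of _ "{i}"] exI[of _ "\<lambda>_. 1"]) auto
next
  case (diff f g)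
  then obtain F c H d where F: "finite F" "F \<subseteq> I" "f - (\<Sum>i\<in>F. frag_cmul (c i) (v i)) \<in> rel_ideal"
    and H: "finite H" "H \<subseteq> I" "g - (\<Sum>i\<in>H. frag_cmul (d i) (v i)) \<in> rel_ideal"
    by auto
  let ?c = "\<lambda>i. if i \<in> F then c i else 0" and ?d = "\<lambda>i. if i \<in> H then d i else 0"
  have "(\<Sum>i\<in>F. frag_cmul (c i) (v i)) = (\<Sum>i\<in>F \<union> H. frag_cmul (?c i) (v i))"
    using F(1) H(1) by (intro sum.mono_neutral_cong_left) auto
  moreover have "(\<Sum>i\<in>H. frag_cmul (d i) (v i)) = (\<Sum>i\<in>F \<union> H. frag_cmul (?d i) (v i))"
    using F(1) H(1) by (intro sum.mono_neutral_cong_left) auto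
  ultimately have "f - g - (\<Sum>i\<in>F \<union> H. frag_cmul (?c i - ?d i) (v i)) \<in> rel_ideal"
    using rel_ideal_diff[OF F(3) H(3)]
    by (simp add: frag_cmul_diff_distrib sum_subtractf algebra_simps)
  then show ?case
    using F H by (intro exI[of _ "F \<union> H"] exI[of _ "\<lambda>i. ?c i - ?d i"]) auto
qed

end

section \<open>Skew monomials\<close>

definition x_word :: "nat list \<Rightarrow> generator free_elt" where
  "x_word js = prod_list (map xvar js)"

lemma x_word_simps [simp]: "x_word [] = 1" "x_word (j # js) = xvar j * x_word js"
  "x_word (js @ ks) = x_word js * x_word ks"
  by (simp_all add: x_word_def)

lemma x_word_replicate: "x_word (replicate k j) = xvar j ^ k"
  by (simp add: x_word_def prod_list_replicate)

lemma x_word_concat: "x_word (concat jss) = prod_list (map x_word jss)"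
  by (induction jss) auto

lemma x_monomial_x_word:
  "x_monomial n r = x_word (concat (map (\<lambda>i. replicate (r i) i) [1..<Suc n]))"
  by (simp add: x_monomial_def x_word_concat o_def x_word_replicate)

lemma del_word_simps [simp]: "del_word [] = 1" "del_word (k # ks) = del k * del_word ks"
  "del_word (ks @ ls) = del_word ks * del_word ls"
  by (simp_all add: del_word_def)

text \<open>Skew multiplication on the free abelian group on exponent vectors: moving \<open>x\<^sub>j\<close> into place past
  \<open>x\<^sub>1\<^bsup>r 1\<^esup> \<dots> x\<^bsub>j-1\<^esub>\<^bsup>r (j-1)\<^esup>\<close> costs the sign.  It is a faithful model of the skew polynomials and
  shows that their monomials are independent over the integers.\<close>

definition skew_op :: "generator \<Rightarrow> ((nat \<Rightarrow> nat) \<Rightarrow>\<^sub>0 int) \<Rightarrow> ((nat \<Rightarrow> nat) \<Rightarrow>\<^sub>0 int)" where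
  "skew_op g = (case g of
     GenX j \<Rightarrow> frag_extend (\<lambda>r. frag_cmul ((- 1) ^ (\<Sum>i = 1..<j. r i)) (frag_of (r(j := Suc (r j)))))
   | GenD _ \<Rightarrow> (\<lambda>_. 0))"

interpretation skew_op: additive_operators skew_op
  by standard (auto simp: skew_op_def frag_extend_diff split: generator.split)

context positive_rank
begin

lemma x_word_closed [simp]: "set js \<subseteq> {1..n} \<Longrightarrow> x_word js \<in> free_pol"
  by (induction js) auto

lemma x_monomial_closed [simp]: "x_monomial n r \<in> free_pol"
  unfolding x_monomial_x_word by (rule x_word_closed) auto

lemma del_word_closed [simp]: "set ks \<subseteq> {1..n} \<Longrightarrow> del_word ks \<in> free_nh"
  by (induction ks) auto

lemma pol_rels_nh: "pol_rels n \<subseteq> nh_rels n"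
  unfolding nh_rels_def by blast

lemma pol_ideal_nh: "f \<in> pol.rel_ideal \<Longrightarrow> f \<in> nh.rel_ideal"
proof (induction rule: pol.rel_ideal_induct)
  case (rel r)
  then show ?case using pol_rels_nh nh.rel_ideal_rel by blast
qed (auto simp: free_pol_nh intro: nh.rel_ideal_diff nh.rel_ideal_left nh.rel_ideal_right)

lemma pol_sim_nh: "pol.sim f g \<Longrightarrow> nh.sim f g"
  by (auto simp: pol.sim_def nh.sim_def pol_ideal_nh)

lemma x_swap:
  assumes "j \<in> {1..n}" "k \<in> {1..n}" "f \<in> free_pol"
  shows "pol.sim (xvar j * (xvar k * f)) (xvar k * (xvar j * f))"
proof (cases "j = k")
  case False
  then have "(xvar j * xvar k + xvar k * xvar j) * f \<in> pol.rel_ideal"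
    using assms by (intro pol.rel_ideal_right pol.rel_ideal_rel pol_rel)
  then show ?thesis by (simp add: pol.sim_def algebra_simps)
qed simp

lemma x_word_front:
  "set (us @ j # vs) \<subseteq> {1..n} \<Longrightarrow> pol.sim (x_word (us @ j # vs)) (x_word (j # us @ vs))"
proof (induction us)
  case (Cons u us)
  then have "pol.sim (x_word ((u # us) @ j # vs)) (xvar u * x_word (j # us @ vs))"
    using pol.sim_left[of "xvar u" "x_word (us @ j # vs)" "x_word (j # us @ vs)"] by simp
  also have "pol.sim \<dots> (x_word (j # (u # us) @ vs))"
    using x_swap[of u j "x_word (us @ vs)"] Cons.prems by simp
  finally show ?case .
qed simp

lemma x_word_mset:
  "mset js = mset ks \<Longrightarrow> set js \<subseteq> {1..n} \<Longrightarrow> pol.sim (x_word js) (x_word ks)"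
proof (induction js arbitrary: ks)
  case (Cons j js)
  then have "j \<in> set ks" by (metis list.set_intros(1) set_mset_mset)
  then obtain us vs where ks: "ks = us @ j # vs" by (meson split_list)
  have "set ks \<subseteq> {1..n}" using Cons.prems by (metis set_mset_mset)
  have "pol.sim (x_word (j # js)) (x_word (j # us @ vs))"
    using Cons.IH[of "us @ vs"] Cons.prems ks pol.sim_left[of "xvar j"] by simp
  also have "pol.sim \<dots> (x_word ks)"
    unfolding ks using \<open>set ks \<subseteq> {1..n}\<close> ks by (intro pol.sim_sym[OF x_word_front]) simp
  finally show ?case .
qed simp

lemma count_monomial_word:
  "count (mset (concat (map (\<lambda>i. replicate (r i) i) [1..<Suc n]))) j = (if j \<in> {1..n} then r j else 0)"
proof -
  have "m \<le> n \<Longrightarrow> count (mset (concat (map (\<lambda>i. replicate (r i) i) [1..<Suc m]))) j =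
      (if j \<in> {1..m} then r j else 0)" for m
    by (induction m) auto
  then show ?thesis by blast
qed

lemma x_word_monomial:
  assumes "set js \<subseteq> {1..n}" "\<And>j. j \<in> {1..n} \<Longrightarrow> count (mset js) j = r j"
  shows "pol.sim (x_word js) (x_monomial n r)"
  unfolding x_monomial_x_word
proof (rule x_word_mset[OF _ assms(1)], rule multiset_eqI)
  fix j
  show "count (mset js) j = count (mset (concat (map (\<lambda>i. replicate (r i) i) [1..<Suc n]))) j"
    using assms unfolding count_monomial_word by (auto simp: count_eq_zero_iff)
qed

lemma x_times_monomial:
  assumes "j \<in> {1..n}"
  shows "pol.sim (xvar j * x_monomial n r) (x_monomial n (r(j := Suc (r j))))"
proof -
  have "pol.sim (x_word (j # concat (map (\<lambda>i. replicate (r i) i) [1..<Suc n])))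
      (x_monomial n (r(j := Suc (r j))))"
  proof (rule x_word_monomial)
    show "count (mset (j # concat (map (\<lambda>i. replicate (r i) i) [1..<Suc n]))) k =
        (r(j := Suc (r j))) k" if "k \<in> {1..n}" for k
      using that assms count_monomial_word[of r k] by auto
  qed (use assms in auto)
  then show ?thesis by (simp add: x_monomial_x_word)
qed

lemma exponents_upd: "r \<in> exponents n \<Longrightarrow> j \<in> {1..n} \<Longrightarrow> r(j := k) \<in> exponents n"
  by (auto simp: exponents_def PiE_iff extensional_def)

lemma pol_spanned:
  assumes "f \<in> free_pol"
  shows "pol.spanned (x_monomial n) (exponents n) f"
  using assms
proof (induction rule: free_alg_induct)
  case one
  let ?z = "\<lambda>i\<in>{1..n}. 0 :: nat"
  have "pol.sim (x_word []) (x_monomial n ?z)"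
    by (rule x_word_monomial) auto
  moreover have "?z \<in> exponents n" by (auto simp: exponents_def)
  ultimately show ?case
    using pol.spanned_sim pol.spanned.base x_word_simps(1) by metis
next
  case (gen g f)
  then obtain j where j: "g = GenX j" "j \<in> {1..n}" by (elim pol_gens_cases)
  from gen.IH show ?case unfolding j
  proof (induction rule: pol.spanned.induct)
    case (ideal f)
    then show ?case using j by (intro pol.spanned.ideal pol.rel_ideal_left) auto
  next
    case (base r)
    show ?case
      using base j(2)
      by (intro pol.spanned_sim[OF x_times_monomial[OF j(2)]] pol.spanned.base exponents_upd)
  next
    case (diff f g)
    then show ?case by (simp add: right_diff_distrib pol.spanned.diff)
  qed
qed (rule pol.spanned.diff)

lemma skew_op_of:
  "skew_op (GenX j) (frag_of r) = frag_cmul ((- 1) ^ (\<Sum>i = 1..<j. r i)) (frag_of (r(j := Suc (r j))))"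
  by (simp add: skew_op_def)

lemma skew_op_swap:
  assumes "1 \<le> j" "j < k"
  shows "skew_op (GenX j) (skew_op (GenX k) m) + skew_op (GenX k) (skew_op (GenX j) m) = 0"
proof -
  have "Poly_Mapping.keys m \<subseteq> UNIV" by simp
  then show ?thesis
  proof (induction m rule: frag_induction)
    case (one r)
    have "(\<Sum>i = 1..<j. (r(k := Suc (r k))) i) = (\<Sum>i = 1..<j. r i)"
      using assms by (intro sum.cong) auto
    moreover have "(\<Sum>i = 1..<k. (r(j := Suc (r j))) i) = Suc (\<Sum>i = 1..<k. r i)"
      using assms by (subst (1 2) sum.remove[of _ j]) auto
    ultimately show ?case
      using assms
      by (simp add: skew_op_of skew_op.op_cmul fun_upd_twist flip: frag_cmul_distrib)
  next
    case (diff a b)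
    have "skew_op (GenX j) (skew_op (GenX k) (a - b)) + skew_op (GenX k) (skew_op (GenX j) (a - b)) =
        (skew_op (GenX j) (skew_op (GenX k) a) + skew_op (GenX k) (skew_op (GenX j) a)) -
        (skew_op (GenX j) (skew_op (GenX k) b) + skew_op (GenX k) (skew_op (GenX j) b))"
      by (simp add: skew_op.op_diff)
    then show ?case using diff by simp
  qed auto
qed

lemma skew_action_ideal:
  assumes "f \<in> pol.rel_ideal"
  shows "action skew_op f m = 0"
proof -
  have "action skew_op r m = 0" if "r \<in> pol_rels n" for r m
  proof -
    obtain j k where r: "r = xvar j * xvar k + xvar k * xvar j" "j \<in> {1..n}" "k \<in> {1..n}" "j \<noteq> k"
      using \<open>r \<in> pol_rels n\<close> unfolding pol_rels_def by blast
    then show ?thesis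
      using skew_op_swap[of j k m] skew_op_swap[of k j m]
      by (cases "j < k") (auto simp: skew_op.action_add skew_op.action_mult add.commute)
  qed
  then have "action skew_op f m \<in> {0}"
    by (intro skew_op.action_rel_ideal[OF pol.presentation_axioms _ _ _ _ _ _ assms, where M = UNIV]) auto
  then show ?thesis by simp
qed

text \<open>The variables of a monomial are applied in the order \<open>x\<^sub>n, \<dots>, x\<^sub>1\<close>, so no sign ever occurs.\<close>

lemma skew_action_monomial:
  assumes "r \<in> exponents n"
  shows "action skew_op (x_monomial n r) (frag_of (\<lambda>i\<in>{1..n}. 0)) = frag_of r"
proof -
  let ?z = "\<lambda>i\<in>{1..n}. 0 :: nat"
  have pow: "action skew_op (xvar j ^ k) (frag_of z) = frag_of (z(j := z j + k))"
    if "\<And>i. i \<in> {1..<j} \<Longrightarrow> z i = 0" for j k z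
  proof (induction k)
    case (Suc k)
    let ?z' = "z(j := z j + k)"
    have 0: "(\<Sum>i = 1..<j. ?z' i) = 0" using that by simp
    have "action skew_op (xvar j ^ Suc k) (frag_of z) = skew_op (GenX j) (frag_of ?z')"
      by (simp only: power_Suc skew_op.action_mult skew_op.action_gen Suc)
    also have "\<dots> = frag_of (?z'(j := Suc (?z' j)))"
      by (simp only: skew_op_of 0 power_0 frag_cmul_one)
    also have "?z'(j := Suc (?z' j)) = z(j := z j + Suc k)" by simp
    finally show ?case .
  qed simp
  have "d \<le> n \<Longrightarrow> action skew_op (prod_list (map (\<lambda>i. xvar i ^ r i) [Suc n - d..<Suc n])) (frag_of ?z) =
      frag_of (\<lambda>i. if Suc n - d \<le> i \<and> i \<le> n then r i else ?z i)" for d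
  proof (induction d)
    case 0
    have "(\<lambda>i. if Suc n - 0 \<le> i \<and> i \<le> n then r i else ?z i) = ?z" by (rule ext) simp
    moreover have "[Suc n - 0..<Suc n] = []" by simp
    ultimately show ?case by (simp only: list.map prod_list.Nil skew_op.action_1)
  next
    case (Suc d)
    let ?j = "n - d"
    have upt: "[Suc n - Suc d..<Suc n] = ?j # [Suc n - d..<Suc n]"
      using Suc.prems upt_conv_Cons[of ?j "Suc n"] by (simp add: Suc_diff_le del: upt_Suc)
    have "action skew_op (prod_list (map (\<lambda>i. xvar i ^ r i) [Suc n - Suc d..<Suc n])) (frag_of ?z) =
      action skew_op (xvar ?j ^ r ?j) (frag_of (\<lambda>i. if Suc n - d \<le> i \<and> i \<le> n then r i else ?z i))"
      using Suc.prems unfolding upt list.map prod_list.Cons skew_op.action_mult by (subst Suc.IH) simp_all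
    also have "\<dots> = frag_of ((\<lambda>i. if Suc n - d \<le> i \<and> i \<le> n then r i else ?z i)(?j := r ?j))"
      using Suc.prems by (subst pow) auto
    also have "(\<lambda>i. if Suc n - d \<le> i \<and> i \<le> n then r i else ?z i)(?j := r ?j) =
      (\<lambda>i. if Suc n - Suc d \<le> i \<and> i \<le> n then r i else ?z i)"
      using Suc.prems by (auto simp: fun_eq_iff)
    finally show ?case .
  qed
  from this[of n] have "action skew_op (x_monomial n r) (frag_of ?z) =
    frag_of (\<lambda>i. if 1 \<le> i \<and> i \<le> n then r i else ?z i)"
    by (simp add: x_monomial_def)
  also have "(\<lambda>i. if 1 \<le> i \<and> i \<le> n then r i else ?z i) = r"
    using assms by (auto simp: exponents_def fun_eq_iff PiE_iff extensional_def)
  finally show ?thesis .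
qed

lemma x_monomials_independent:
  assumes "finite F" "F \<subseteq> exponents n" "(\<Sum>r\<in>F. frag_cmul (c r) (x_monomial n r)) \<in> pol.rel_ideal" "r \<in> F"
  shows "c r = 0"
proof -
  let ?z = "frag_of (\<lambda>i\<in>{1..n}. 0 :: nat)"
  have "0 = (\<Sum>r\<in>F. frag_cmul (c r) (action skew_op (x_monomial n r) ?z))"
    using skew_action_ideal[OF assms(3), of ?z]
    by (simp add: skew_op.action_sum skew_op.action_cmul)
  also have "\<dots> = (\<Sum>r\<in>F. frag_cmul (c r) (frag_of r))"
    using assms(2) by (intro sum.cong refl arg_cong[where f = "frag_cmul _"] skew_action_monomial) auto
  finally have "0 = Poly_Mapping.lookup (\<Sum>r\<in>F. frag_cmul (c r) (frag_of r)) r" by (metis lookup_zero)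
  also have "\<dots> = (\<Sum>s\<in>F. if s = r then c s else 0)"
    by (auto simp: lookup_sum intro!: sum.cong)
  also have "\<dots> = c r" using assms by simp
  finally show ?thesis by simp
qed

section \<open>A spanning set\<close>

lemma nh_square: "i \<in> {1..n} \<Longrightarrow> del i * del i \<in> nh.rel_ideal"
  by (rule nh.rel_ideal_rel, cases "i = n") (auto simp: nh_rels_def)

lemma nh_far: "1 \<le> i \<Longrightarrow> i + 1 < j \<Longrightarrow> j \<le> n \<Longrightarrow> del j * del i + del i * del j \<in> nh.rel_ideal"
proof (rule nh.rel_ideal_rel)
  assume ij: "1 \<le> i" "i + 1 < j" "j \<le> n"
  show "del j * del i + del i * del j \<in> nh_rels n"
  proof (cases "j = n")
    case True
    then have "del j * del i + del i * del j \<in> {del n * del i + del i * del n | i. 1 \<le> i \<and> i + 2 \<le> n}"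
      using ij by fastforce
    then show ?thesis unfolding nh_rels_def by blast
  next
    case False
    then have "del j * del i + del i * del j \<in> {del i * del j + del j * del i | i j.
        i \<in> {1..<n} \<and> j \<in> {1..<n} \<and> \<bar>int i - int j\<bar> > 1}"
      using ij by fastforce
    then show ?thesis unfolding nh_rels_def by blast
  qed
qed

lemma nh_braid3:
  assumes "1 \<le> i" "i + 1 < n"
  shows "del i * del (i+1) * del i - del (i+1) * del i * del (i+1) \<in> nh.rel_ideal"
  by (rule nh.rel_ideal_rel) (use assms in \<open>unfold nh_rels_def, blast\<close>)

lemma nh_braid4:
  assumes "2 \<le> n"
  shows "del n * del (n-1) * del n * del (n-1) + del (n-1) * del n * del (n-1) * del n \<in> nh.rel_ideal"
  by (rule nh.rel_ideal_rel) (use assms in \<open>unfold nh_rels_def, simp\<close>)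

lemma del_word_braid: "braid_equiv n ks ls \<Longrightarrow> nh.sim (del_word ks) (del_word ls)"
proof (induction rule: braid_equiv.induct)
  case (symI ks ls)
  then show ?case using nh.sim_sym by blast
next
  case (transI ks ls ms)
  then show ?case by (blast intro: nh.sim_trans)
next
  case (consI ks ls k)
  then show ?case by (simp add: nh.sim_left)
next
  case (far i j ks)
  have "(del j * del i + del i * del j) * del_word ks \<in> nh.rel_ideal"
    using far by (intro nh.rel_ideal_right nh_far) auto
  then show ?case by (simp add: nh.sim_def algebra_simps)
next
  case (braid3 i ks)
  have "(del i * del (i+1) * del i - del (i+1) * del i * del (i+1)) * del_word ks \<in> nh.rel_ideal"
    using braid3 by (intro nh.rel_ideal_right nh_braid3) auto
  then show ?case by (simp add: nh.sim_def algebra_simps)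
next
  case (braid4 ks)
  have "(del n * del (n-1) * del n * del (n-1) + del (n-1) * del n * del (n-1) * del n) * del_word ks
      \<in> nh.rel_ideal"
    using braid4 by (intro nh.rel_ideal_right nh_braid4) auto
  then show ?case by (simp add: nh.sim_def algebra_simps)
qed simp

lemma del_word_reduced:
  "reduced_expression n w ks \<Longrightarrow> reduced_expression n w ls \<Longrightarrow> nh.sim (del_word ks) (del_word ls)"
  by (rule del_word_braid[OF matsumoto])

lemma del_word_not_reduced:
  assumes "set ks \<subseteq> {1..n}" "\<not> reduced_expression n (word_prod n ks) ks"
  shows "del_word ks \<in> nh.rel_ideal"
proof -
  obtain p i q where p: "i \<in> {1..n}" "set p \<subseteq> {1..n}" "set q \<subseteq> {1..n}" "braid_equiv n ks (p @ i # i # q)"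
    using not_reduced_square[OF assms] by blast
  have "del_word p * ((del i * del i) * del_word q) \<in> nh.rel_ideal"
    using p by (intro nh.rel_ideal_left nh.rel_ideal_right nh_square) auto
  then have "nh.sim (del_word (p @ i # i # q)) 0"
    by (simp add: nh.sim_0 mult.assoc)
  then show ?thesis
    using nh.sim_trans[OF del_word_braid[OF p(4)]] nh.sim_0 by blast
qed

lemma spanned_times_del_word:
  assumes red: "\<And>w. w \<in> W \<Longrightarrow> reduced_expression n w (red w)"
    and f: "f \<in> free_pol" and ks: "set ks \<subseteq> {1..n}"
  shows "nh.spanned (\<lambda>(w, r). x_monomial n r * del_word (red w)) (W \<times> exponents n) (f * del_word ks)"
    (is "nh.spanned ?v ?I _")
proof (cases "reduced_expression n (word_prod n ks) ks")
  case False
  then have "f * del_word ks \<in> nh.rel_ideal"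
    using f ks by (intro nh.rel_ideal_left free_pol_nh del_word_not_reduced)
  then show ?thesis by (rule nh.spanned.ideal)
next
  case True
  let ?w = "word_prod n ks"
  have w: "?w \<in> W" using ks weyl_B_words by blast
  have "set (red ?w) \<subseteq> {1..n}" using red[OF w] by (simp add: reduced_iff)
  then have closed: "del_word (red ?w) \<in> free_nh" by simp
  from pol_spanned[OF f] have "nh.spanned ?v ?I (f * del_word (red ?w))"
  proof (induction rule: pol.spanned.induct)
    case (ideal f)
    then show ?case by (intro nh.spanned.ideal nh.rel_ideal_right pol_ideal_nh closed)
  next
    case (base r)
    then show ?case using nh.spanned.base[of "(?w, r)" ?I ?v] w by simp
  next
    case (diff f g)
    then show ?case by (simp add: left_diff_distrib nh.spanned.diff)
  qed
  then show ?thesis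
    using nh.sim_left[OF free_pol_nh[OF f] del_word_reduced[OF True red[OF w]]] nh.spanned_sim by blast
qed

lemma del_x:
  assumes "i \<in> {1..n}" "j \<in> {1..n}"
  shows "del i * xvar j - ((if j \<in> {i, i + 1} then 1 else 0) - xvar (refl_index n i j) * del i) \<in> nh.rel_ideal"
proof (rule nh.rel_ideal_rel)
  consider "i < n" "j = i" | "i < n" "j = i + 1" | "i < n" "j \<noteq> i" "j \<noteq> i + 1" | "i = n" "j = n"
    | "i = n" "j < n" using assms by fastforce
  then show "del i * xvar j - ((if j \<in> {i, i + 1} then 1 else 0) - xvar (refl_index n i j) * del i) \<in> nh_rels n"
  proof cases
    case 1
    then have "del i * xvar i + xvar (i+1) * del i - 1 \<in> nh_rels n"
      using assms unfolding nh_rels_def by fastforce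
    then show ?thesis using 1 by (simp add: refl_index_def algebra_simps)
  next
    case 2
    then have "xvar i * del i + del i * xvar (i+1) - 1 \<in> nh_rels n"
      using assms unfolding nh_rels_def by fastforce
    then show ?thesis using 2 by (simp add: refl_index_def algebra_simps)
  next
    case 3
    then have "del i * xvar j + xvar j * del i \<in> nh_rels n"
      using assms unfolding nh_rels_def by fastforce
    then show ?thesis using 3 by (simp add: refl_index_def algebra_simps)
  next
    case 4
    have "del n * xvar n + xvar n * del n - 1 \<in> nh_rels n"
      unfolding nh_rels_def by blast
    then show ?thesis using 4 by (simp add: refl_index_def algebra_simps)
  next
    case 5
    then have "del n * xvar j + xvar j * del n \<in> nh_rels n"
      using assms unfolding nh_rels_def by fastforce
    then show ?thesis using 5 by (simp add: refl_index_def algebra_simps)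
  qed
qed

text \<open>The Leibniz rule as a relation in the nilHecke algebra: it moves a Demazure generator to the
  right of a polynomial.\<close>

lemma del_pol:
  assumes "f \<in> free_pol" "i \<in> {1..n}"
  shows "del i * f - (demazure n i f + reflect n i f * del i) \<in> nh.rel_ideal"
  using assms
proof (induction rule: free_alg_induct)
  case (gen g f)
  then obtain j where j: "g = GenX j" "j \<in> {1..n}" by (elim pol_gens_cases)
  let ?x = "xvar (refl_index n i j)" and ?d = "if j \<in> {i, i + 1} then 1 else 0 :: generator free_elt"
  have "del i * (xvar j * f) - (demazure n i (xvar j * f) + reflect n i (xvar j * f) * del i) =
      (del i * xvar j - (?d - ?x * del i)) * f - ?x * (del i * f - (demazure n i f + reflect n i f * del i))"
    by (auto simp: demazure_x reflect_x algebra_simps)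
  moreover have "(del i * xvar j - (?d - ?x * del i)) * f \<in> nh.rel_ideal"
    using gen j by (intro nh.rel_ideal_right[OF del_x] free_pol_nh) auto
  moreover have "?x * (del i * f - (demazure n i f + reflect n i f * del i)) \<in> nh.rel_ideal"
    using gen j refl_index_range[of i n j] by (intro nh.rel_ideal_left) auto
  ultimately show ?case using j by (simp add: nh.rel_ideal_diff)
next
  case (diff a b)
  then have "(del i * a - (demazure n i a + reflect n i a * del i)) -
      (del i * b - (demazure n i b + reflect n i b * del i)) \<in> nh.rel_ideal"
    using nh.rel_ideal_diff by blast
  then show ?case by (simp add: demazure_diff reflect_diff algebra_simps)
qed simp

lemma nh_spanned:
  assumes red: "\<And>w. w \<in> W \<Longrightarrow> reduced_expression n w (red w)"
    and f: "f \<in> free_nh"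
  shows "nh.spanned (\<lambda>(w, r). x_monomial n r * del_word (red w)) (W \<times> exponents n) f"
    (is "nh.spanned ?v ?I _")
  using f
proof (induction rule: free_alg_induct)
  case one
  show ?case using spanned_times_del_word[OF red, of 1 "[]"] by simp
next
  case (gen g f)
  from gen.IH show ?case
  proof (induction rule: nh.spanned.induct)
    case (ideal f)
    then show ?case using gen by (intro nh.spanned.ideal nh.rel_ideal_left) simp
  next
    case (diff f g)
    then show ?case by (simp add: right_diff_distrib nh.spanned.diff)
  next
    case (base wr)
    then obtain w r where wr: "wr = (w, r)" "w \<in> W" by auto
    have ks: "set (red w) \<subseteq> {1..n}" using red[OF wr(2)] by (simp add: reduced_iff)
    from gen(1) show ?case
    proof (cases rule: nh_gens_cases)
      case (1 j)
      then show ?thesis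
        using spanned_times_del_word[OF red, of "xvar j * x_monomial n r" "red w"] ks wr
        by (simp add: mult.assoc)
    next
      case (2 i)
      let ?p = "x_monomial n r"
      have "nh.spanned ?v ?I (demazure n i ?p * del_word (red w) + reflect n i ?p * del_word (i # red w))"
        using 2 ks by (intro nh.spanned_add spanned_times_del_word[OF red] demazure_closed reflect_closed) auto
      moreover have "(del i * ?p - (demazure n i ?p + reflect n i ?p * del i)) * del_word (red w) \<in> nh.rel_ideal"
        using 2 ks by (intro nh.rel_ideal_right del_pol) auto
      ultimately show ?thesis
        using wr 2 by (auto simp: algebra_simps intro: nh.spanned_congruent)
    qed
  qed
qed (rule nh.spanned.diff)

section \<open>The longest operator does not vanish\<close>

lemma demazure_sim: "pol.sim f g \<Longrightarrow> i \<in> {1..n} \<Longrightarrow> pol.sim (demazure n i f) (demazure n i g)"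
  unfolding pol.sim_def using demazure_ideal[of "f - g" i] demazure_ideal[of "f + g" i]
  by (auto simp: demazure_diff demazure_add)

lemma act_del_word_sim:
  "pol.sim f g \<Longrightarrow> set ks \<subseteq> {1..n} \<Longrightarrow> pol.sim (act (del_word ks) f) (act (del_word ks) g)"
  by (induction ks) (auto simp: nh_op.action_gen_mult demazure_sim)

lemma act_del_word_closed:
  "f \<in> free_pol \<Longrightarrow> set ks \<subseteq> {1..n} \<Longrightarrow> act (del_word ks) f \<in> free_pol"
  by (simp add: act_closed)

lemma demazure_skip:
  assumes "i \<in> {1..n}" "set js \<subseteq> {1..n}" "i \<notin> set js" "i + 1 \<notin> set js" "m \<in> free_pol"
  shows "pol.sim (demazure n i (x_word js * m)) (x_word js * demazure n i m)"
  using assms(2-4)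
proof (induction js)
  case (Cons j js)
  have "demazure n i (x_word (j # js) * m) = - (xvar j * demazure n i (x_word js * m))"
    using Cons.prems by (simp add: mult.assoc demazure_x refl_index_def)
  moreover have "pol.sim (xvar j * demazure n i (x_word js * m)) (xvar j * (x_word js * demazure n i m))"
    using Cons by (intro pol.sim_left) auto
  ultimately show ?case by (simp add: mult.assoc)
qed simp

lemma demazure_pair:
  assumes "i \<in> {1..n}" "i < n" "m \<in> free_pol"
  shows "pol.sim (demazure n i (xvar i * (xvar (i+1) * m))) (xvar i * (xvar (i+1) * demazure n i m))"
proof -
  have "demazure n i (xvar i * (xvar (i+1) * m)) = xvar (i+1) * (xvar i * demazure n i m)"
    using assms by (simp add: demazure_x refl_index_def algebra_simps)
  then show ?thesis
    using x_swap[of "i+1" i "demazure n i m"] assms by (simp add: demazure_closed)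
qed

lemma mset_split:
  assumes "set pre \<subseteq> {i, i + 1}" "count (mset pre) i = count (mset js) i"
    "count (mset pre) (i + 1) = count (mset js) (i + 1)"
  shows "mset js = mset (pre @ filter (\<lambda>j. j \<noteq> i \<and> j \<noteq> i + 1) js)"
proof (rule multiset_eqI)
  fix j
  show "count (mset js) j = count (mset (pre @ filter (\<lambda>j. j \<noteq> i \<and> j \<noteq> i + 1) js)) j"
    using assms by (cases "j = i \<or> j = i + 1") (auto simp: count_eq_zero_iff count_mset_0_iff)
qed

text \<open>The monomial \<open>x\<^sub>k \<cdots> x\<^sub>j x\<^bsub>j+1\<^esub>\<^sup>2 \<cdots> x\<^sub>n\<^sup>2\<close>.  It is chosen so that \<open>\<partial>\<^sub>j\<close> turns it, up to sign, into the
  one for \<open>j + 1\<close>, and so that for \<open>j = k\<close> it commutes up to sign with all \<open>\<partial>\<^sub>i\<close>, \<open>i > k\<close>.\<close>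

definition stair :: "nat \<Rightarrow> nat \<Rightarrow> nat list" where
  "stair k j = [k..<Suc j] @ concat (map (\<lambda>j. [j, j]) [Suc j..<Suc n])"

lemma count_stair:
  assumes "k \<le> j" "j \<le> n"
  shows "count (mset (stair k j)) i = (if k \<le> i \<and> i \<le> j then 1 else if j < i \<and> i \<le> n then 2 else 0)"
proof -
  have 1: "count (mset [k..<Suc j]) i = (if k \<le> i \<and> i \<le> j then 1 else 0)"
    using distinct_count_atmost_1[of "[k..<Suc j]"] by (simp del: upt_Suc)
  have "j \<le> m \<Longrightarrow> count (mset (concat (map (\<lambda>j. [j, j]) [Suc j..<Suc m]))) i = (if j < i \<and> i \<le> m then 2 else 0)" for m
    by (induction m rule: dec_induct) auto
  then show ?thesis using 1 assms by (auto simp: stair_def simp del: upt_Suc)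
qed

lemma stair_set: "1 \<le> k \<Longrightarrow> j \<le> n \<Longrightarrow> set (stair k j) \<subseteq> {1..n}"
  by (auto simp: stair_def)

lemma stair_end: "stair k n = [k..<Suc n]"
  by (simp add: stair_def)

text \<open>Up to sign \<open>\<partial>\<^sub>j\<close> commutes with \<open>x\<^sub>j x\<^bsub>j+1\<^esub>\<close>, and \<open>\<partial>\<^sub>j(x\<^bsub>j+1\<^esub>) = 1\<close>; so it removes one factor \<open>x\<^bsub>j+1\<^esub>\<close>.\<close>

lemma demazure_stair_step:
  assumes "1 \<le> k" "k \<le> j" "j < n"
  shows "pol.sim (demazure n j (x_word (stair k j))) (x_word (stair k (Suc j)))"
proof -
  let ?rest = "filter (\<lambda>i. i \<noteq> j \<and> i \<noteq> j + 1) (stair k j)"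
  have j: "j \<in> {1..n}" "j + 1 \<in> {1..n}" using assms by auto
  have rest: "set ?rest \<subseteq> {1..n}" "j \<notin> set ?rest" "j + 1 \<notin> set ?rest"
    using stair_set[of k j] assms by auto
  let ?R = "x_word ?rest"
  have R: "?R \<in> free_pol" using rest(1) by simp
  have "pol.sim (demazure n j ?R) 0"
    using demazure_skip[OF j(1) rest, of 1] by simp
  have split: "mset (stair k j) = mset ([j, j + 1, j + 1] @ ?rest)"
    using assms by (intro mset_split) (simp_all add: count_stair)
  have "pol.sim (demazure n j (x_word (stair k j))) (demazure n j (x_word ([j, j + 1, j + 1] @ ?rest)))"
    using split stair_set[of k j] assms j by (intro demazure_sim x_word_mset) auto
  also have "pol.sim \<dots> (xvar j * (xvar (j + 1) * demazure n j (xvar (j + 1) * ?R)))"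
    using demazure_pair[OF j(1) assms(3), of "xvar (j + 1) * ?R"] R j by simp
  also have "pol.sim \<dots> (xvar j * (xvar (j + 1) * ?R))"
  proof (intro pol.sim_left)
    have "demazure n j (xvar (j + 1) * ?R) - ?R = - (xvar j * demazure n j ?R)"
      using assms by (simp add: demazure_x refl_index_def)
    moreover have "xvar j * demazure n j ?R \<in> pol.rel_ideal"
      using \<open>pol.sim (demazure n j ?R) 0\<close> j by (intro pol.rel_ideal_left) (simp_all add: pol.sim_0)
    ultimately show "pol.sim (demazure n j (xvar (j + 1) * ?R)) ?R"
      by (intro pol.sim_congruent) simp
  qed (use j in auto)
  also have "pol.sim \<dots> (x_word (stair k (Suc j)))"
  proof -
    have "mset (stair k (Suc j)) = mset ([j, j + 1] @ filter (\<lambda>i. i \<noteq> j \<and> i \<noteq> j + 1) (stair k (Suc j)))"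
      using assms by (intro mset_split) (simp_all add: count_stair)
    moreover have "mset (filter (\<lambda>i. i \<noteq> j \<and> i \<noteq> j + 1) (stair k (Suc j))) = mset ?rest"
      using assms by (intro multiset_eqI) (auto simp: count_stair)
    ultimately have "mset ([j, j + 1] @ ?rest) = mset (stair k (Suc j))" by simp
    then have "pol.sim (x_word ([j, j + 1] @ ?rest)) (x_word (stair k (Suc j)))"
      using rest j by (intro x_word_mset) auto
    then show ?thesis by simp
  qed
  finally show ?thesis .
qed

lemma demazure_strip:
  assumes "1 \<le> k" "k \<le> j" "j \<le> n"
  shows "pol.sim (demazure n j (x_word [k..<Suc j])) (x_word [k..<j])"
proof -
  have "pol.sim (demazure n j (x_word [k..<j] * xvar j)) (x_word [k..<j] * demazure n j (xvar j))"
    using assms by (intro demazure_skip) auto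
  moreover have "demazure n j (xvar j) = 1"
    using demazure_x[of n j j 1] by simp
  ultimately show ?thesis using assms by simp
qed

text \<open>The first half of the palindrome lowers the squares one by one until \<open>x\<^sub>k \<cdots> x\<^sub>n\<close> is left; then
  \<open>\<partial>\<^sub>n, \<dots>, \<partial>\<^sub>k\<close> strip off the variables from the right.\<close>

lemma act_sign_word:
  assumes "k \<in> {1..n}"
  shows "pol.sim (act (del_word (sign_word k)) (x_word (stair k k))) 1"
proof -
  have k: "1 \<le> k" "k \<le> n" using assms by auto
  have up: "pol.sim (act (del_word (rev [k..<j])) (x_word (stair k k))) (x_word (stair k j))"
    if "k \<le> j" "j \<le> n" for j
    using that
  proof (induction j rule: dec_induct)
    case (step j)
    have "act (del_word (rev [k..<Suc j])) (x_word (stair k k)) =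
        demazure n j (act (del_word (rev [k..<j])) (x_word (stair k k)))"
      using step by (simp add: nh_op.action_gen_mult)
    also have "pol.sim \<dots> (demazure n j (x_word (stair k j)))"
      using step k by (intro demazure_sim) auto
    also have "pol.sim \<dots> (x_word (stair k (Suc j)))"
      using step k by (intro demazure_stair_step) auto
    finally show ?case .
  qed simp
  have down: "pol.sim (act (del_word [n - d..<n]) (x_word [k..<n])) (x_word [k..<n - d])"
    if "d \<le> n - k" for d
    using that
  proof (induction d)
    case (Suc d)
    let ?j = "n - Suc d"
    have j: "Suc ?j = n - d" "k \<le> ?j" "?j < n" using Suc.prems k by auto
    have "[?j..<n] = ?j # [n - d..<n]" using j by (metis upt_conv_Cons)
    then have "act (del_word [?j..<n]) (x_word [k..<n]) =
        demazure n ?j (act (del_word [n - d..<n]) (x_word [k..<n]))"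
      by (simp add: nh_op.action_gen_mult)
    also have "pol.sim \<dots> (demazure n ?j (x_word [k..<n - d]))"
      using Suc j k by (intro demazure_sim) auto
    also have "pol.sim \<dots> (x_word [k..<?j])"
      using demazure_strip[of k ?j] j k by simp
    finally show ?case .
  qed simp
  have "act (del_word (sign_word k)) (x_word (stair k k)) =
      act (del_word [k..<n]) (demazure n n (act (del_word (rev [k..<n])) (x_word (stair k k))))"
    by (simp add: sign_word_def nh_op.action_mult)
  also have "pol.sim \<dots> (act (del_word [k..<n]) (demazure n n (x_word [k..<Suc n])))"
    using up[of n] k stair_end[of k] by (intro act_del_word_sim demazure_sim) auto
  also have "pol.sim \<dots> (act (del_word [k..<n]) (x_word [k..<n]))"
    using k by (intro act_del_word_sim demazure_strip) auto
  also have "pol.sim \<dots> 1"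
    using down[of "n - k"] k by simp
  finally show ?thesis .
qed

text \<open>For \<open>i > k\<close> the monomial is a multiple of \<open>(x\<^sub>i x\<^bsub>i+1\<^esub>)\<^sup>2\<close>, or of \<open>x\<^sub>n\<^sup>2\<close> if \<open>i = n\<close>, by variables on which
  \<open>\<partial>\<^sub>i\<close> vanishes; with all of these \<open>\<partial>\<^sub>i\<close> commutes up to sign.\<close>

lemma demazure_stair:
  assumes "1 \<le> k" "k < i" "i \<le> n" "m \<in> free_pol"
  shows "pol.sim (demazure n i (x_word (stair k k) * m)) (x_word (stair k k) * demazure n i m)"
proof -
  let ?rest = "filter (\<lambda>j. j \<noteq> i \<and> j \<noteq> i + 1) (stair k k)"
  let ?pre = "if i < n then [i, i + 1, i, i + 1] else [i, i]"
  have i: "i \<in> {1..n}" using assms by auto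
  have pre: "set ?pre \<subseteq> {1..n}" using assms by auto
  have rest: "set ?rest \<subseteq> {1..n}" "i \<notin> set ?rest" "i + 1 \<notin> set ?rest"
    using stair_set[of k k] assms by auto
  have split: "mset (stair k k) = mset (?pre @ ?rest)"
    using assms by (intro mset_split) (auto simp: count_stair)
  have sim: "pol.sim (x_word (stair k k)) (x_word (?pre @ ?rest))"
    using split stair_set[of k k] assms by (intro x_word_mset) auto
  have commute: "pol.sim (demazure n i (x_word ?pre * f)) (x_word ?pre * demazure n i f)" if f: "f \<in> free_pol" for f
  proof (cases "i < n")
    case True
    have "pol.sim (demazure n i (xvar i * (xvar (i+1) * (xvar i * (xvar (i+1) * f)))))
        (xvar i * (xvar (i+1) * demazure n i (xvar i * (xvar (i+1) * f))))"
      using f True i by (intro demazure_pair) auto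
    also have "pol.sim \<dots> (xvar i * (xvar (i+1) * (xvar i * (xvar (i+1) * demazure n i f))))"
      using f True i by (intro pol.sim_left demazure_pair) auto
    finally show ?thesis using True by (simp add: mult.assoc)
  next
    case False
    then have "i = n" using assms by simp
    then show ?thesis by (simp add: mult.assoc demazure_x refl_index_def right_diff_distrib)
  qed
  have R: "x_word ?rest \<in> free_pol" using rest by simp
  have P: "x_word ?pre \<in> free_pol" using pre by (rule x_word_closed)
  have "pol.sim (demazure n i (x_word (stair k k) * m)) (demazure n i (x_word ?pre * (x_word ?rest * m)))"
    using pol.sim_right[OF assms(4) sim] i by (intro demazure_sim) (simp_all add: mult.assoc)
  also have "pol.sim \<dots> (x_word ?pre * demazure n i (x_word ?rest * m))"
    using R assms(4) by (intro commute) auto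
  also have "pol.sim \<dots> (x_word ?pre * (x_word ?rest * demazure n i m))"
    using i rest assms(4) P by (intro pol.sim_left demazure_skip)
  also have "pol.sim \<dots> (x_word (stair k k) * demazure n i m)"
    using pol.sim_sym[OF pol.sim_right[OF demazure_closed[OF assms(4) i] sim]] by (simp add: mult.assoc)
  finally show ?thesis .
qed

lemma act_stair:
  assumes "1 \<le> k" "k \<le> n" "set ks \<subseteq> {k<..n}" "m \<in> free_pol"
  shows "pol.sim (act (del_word ks) (x_word (stair k k) * m)) (x_word (stair k k) * act (del_word ks) m)"
  using assms(3)
proof (induction ks)
  case (Cons i ks)
  have ks: "set ks \<subseteq> {1..n}" "i \<in> {1..n}" using Cons.prems assms(1) by auto
  have "pol.sim (demazure n i (act (del_word ks) (x_word (stair k k) * m)))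
      (demazure n i (x_word (stair k k) * act (del_word ks) m))"
    using Cons ks by (intro demazure_sim) auto
  also have "pol.sim \<dots> (x_word (stair k k) * demazure n i (act (del_word ks) m))"
    using Cons.prems assms ks by (intro demazure_stair act_del_word_closed) auto
  finally show ?case by (simp add: nh_op.action_gen_mult)
qed simp

text \<open>Up to sign this is \<open>x\<^sub>1 x\<^sub>2\<^sup>3 x\<^sub>3\<^sup>5 \<cdots> x\<^sub>n\<^bsup>2n-1\<^esup>\<close>, of degree \<open>n\<^sup>2\<close>, the length of the longest element.\<close>

definition stair_product :: "generator free_elt" where
  "stair_product = x_word (concat (map (\<lambda>k. stair k k) [1..<Suc n]))"

lemma stair_product_closed: "stair_product \<in> free_pol"
  unfolding stair_product_def by (rule x_word_closed) (auto simp: stair_def)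

lemma act_long_word: "pol.sim (act (del_word long_word) stair_product) 1"
proof -
  have "pol.sim (act (del_word (concat (map sign_word [Suc n - d..<Suc n])))
      (x_word (concat (map (\<lambda>k. stair k k) [Suc n - d..<Suc n])))) 1" if "d \<le> n" for d
    using that
  proof (induction d)
    case (Suc d)
    let ?k = "n - d"
    let ?ks = "concat (map sign_word [Suc n - d..<Suc n])"
    let ?m = "x_word (concat (map (\<lambda>k. stair k k) [Suc n - d..<Suc n]))"
    have k: "1 \<le> ?k" "?k \<le> n" "?k \<in> {1..n}" "Suc n - d = Suc ?k" using Suc.prems by auto
    have upt: "[Suc n - Suc d..<Suc n] = ?k # [Suc n - d..<Suc n]"
      using Suc.prems upt_conv_Cons[of ?k "Suc n"] by (simp add: Suc_diff_le del: upt_Suc)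
    have ks: "set ?ks \<subseteq> {?k<..n}" unfolding k(4) by (auto simp: sign_word_def)
    have m: "?m \<in> free_pol"
      using k(1) by (intro x_word_closed) (auto simp: stair_def k(4))
    have sk: "set (sign_word ?k) \<subseteq> {1..n}" using sign_word_set k(3) .
    have "pol.sim (act (del_word (sign_word ?k)) (act (del_word ?ks) (x_word (stair ?k ?k) * ?m)))
        (act (del_word (sign_word ?k)) (x_word (stair ?k ?k) * act (del_word ?ks) ?m))"
      by (rule act_del_word_sim[OF act_stair[OF k(1,2) ks m] sk])
    also have "pol.sim \<dots> (act (del_word (sign_word ?k)) (x_word (stair ?k ?k) * 1))"
    proof (rule act_del_word_sim[OF pol.sim_left[OF x_word_closed[OF stair_set[OF k(1,2)]]] sk])
      show "pol.sim (act (del_word ?ks) ?m) 1" using Suc.prems by (intro Suc.IH) simp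
    qed
    also have "pol.sim \<dots> 1"
      using act_sign_word[OF k(3)] by simp
    finally show ?case
      unfolding upt list.map concat.simps del_word_simps x_word_simps nh_op.action_mult .
  qed simp
  from this[of n] show ?thesis by (simp add: long_word_def stair_product_def)
qed

end

section \<open>Integral combinations\<close>

lemma free_alg_add_pow:
  assumes "a \<in> carrier (free_alg G)"
  shows "add_pow (free_alg G) (k :: int) a = frag_cmul k a"
proof -
  interpret F: ring "free_alg G" by (rule ring_free_alg)
  have nat: "add_pow (free_alg G) (m :: nat) a = frag_cmul (int m) a" for m
  proof (induction m)
    case 0
    show ?case using F.add.nat_pow_0 by simp
  next
    case (Suc m)
    then show ?case
      using F.add.nat_pow_Suc by (simp add: frag_cmul_distrib)
  qed
  show ?thesis
  proof (cases "0 \<le> k")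
    case True
    then show ?thesis by (simp add: add_pow_int_ge nat)
  next
    case False
    then show ?thesis
      using assms by (simp add: add_pow_int_lt nat free_alg_minus)
  qed
qed

lemma free_mult_cmul:
  fixes a b :: "'g free_elt"
  shows "a * frag_cmul k b = frag_cmul k (a * b)"
proof -
  interpret additive_operators "\<lambda>_ :: unit. (*) a"
    by standard (rule right_diff_distrib)
  show ?thesis by (rule op_cmul)
qed

lemma free_cmul_mult:
  fixes a b :: "'g free_elt"
  shows "frag_cmul k a * b = frag_cmul k (a * b)"
proof -
  interpret additive_operators "\<lambda>_ :: unit. (\<lambda>a. a * b)"
    by standard (rule left_diff_distrib)
  show ?thesis by (rule op_cmul)
qed

lemma frag_cmul_diff_distrib2: "frag_cmul k (a - b) = frag_cmul k a - frag_cmul k b"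
  using frag_cmul_distrib2[of k a "- b"] frag_cmul_distrib2[of k "a - b" b] by (simp add: algebra_simps)

text \<open>Sums formed in a quotient or in an endomorphism ring are images of sums of representatives.\<close>

lemma additive_combination:
  assumes A: "abelian_group A"
    and closed: "\<And>a. a \<in> carrier (free_alg G) \<Longrightarrow> h a \<in> carrier A"
    and add: "\<And>a b. a \<in> carrier (free_alg G) \<Longrightarrow> b \<in> carrier (free_alg G) \<Longrightarrow> h (a + b) = h a \<oplus>\<^bsub>A\<^esub> h b"
    and F: "finite F" "\<And>i. i \<in> F \<Longrightarrow> f i \<in> carrier (free_alg G)"
  shows "(\<Oplus>\<^bsub>A\<^esub>i\<in>F. add_pow A (c i :: int) (h (f i))) = h (\<Sum>i\<in>F. frag_cmul (c i) (f i))"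
proof -
  interpret A: abelian_group A by fact
  interpret F: ring "free_alg G" by (rule ring_free_alg)
  interpret h: group_hom "add_monoid (free_alg G)" "add_monoid A" h
    by (intro group_hom.intro group_hom_axioms.intro homI F.a_group A.a_group) (auto simp: closed add)
  have cmul: "add_pow A k (h a) = h (frag_cmul k a)" if "a \<in> carrier (free_alg G)" for k a
    using h.hom_int_pow[of a k] that free_alg_add_pow[OF that, of k] by (simp add: add_pow_def)
  have zero: "h 0 = \<zero>\<^bsub>A\<^esub>" using h.hom_one by simp
  show ?thesis
    using F
  proof (induction F)
    case empty
    then show ?case by (simp add: zero)
  next
    case (insert i F)
    then have "h (\<Sum>i\<in>insert i F. frag_cmul (c i) (f i)) =
        h (frag_cmul (c i) (f i)) \<oplus>\<^bsub>A\<^esub> h (\<Sum>i\<in>F. frag_cmul (c i) (f i))"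
      by (simp add: add carrier_sum)
    moreover have "(\<Oplus>\<^bsub>A\<^esub>i\<in>insert i F. add_pow A (c i) (h (f i))) =
        add_pow A (c i) (h (f i)) \<oplus>\<^bsub>A\<^esub> (\<Oplus>\<^bsub>A\<^esub>i\<in>F. add_pow A (c i) (h (f i)))"
      using insert by (intro A.finsum_insert) (auto simp: cmul closed)
    ultimately show ?case using insert by (simp add: cmul)
  qed
qed

lemma int_independentI:
  assumes A: "abelian_group A"
    and closed: "\<And>a. a \<in> carrier (free_alg G) \<Longrightarrow> h a \<in> carrier A"
    and add: "\<And>a b. a \<in> carrier (free_alg G) \<Longrightarrow> b \<in> carrier (free_alg G) \<Longrightarrow> h (a + b) = h a \<oplus>\<^bsub>A\<^esub> h b"
    and f: "\<And>i. i \<in> I \<Longrightarrow> f i \<in> carrier (free_alg G)"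
    and indep: "\<And>F c i. finite F \<Longrightarrow> F \<subseteq> I \<Longrightarrow> h (\<Sum>i\<in>F. frag_cmul (c i) (f i)) = \<zero>\<^bsub>A\<^esub> \<Longrightarrow> i \<in> F \<Longrightarrow> c i = 0"
  shows "int_independent A (\<lambda>i. h (f i)) I"
  unfolding int_independent_def
proof (intro conjI allI impI ballI)
  show "(\<lambda>i. h (f i)) \<in> I \<rightarrow> carrier A" using closed f by auto
next
  fix F c i
  assume "finite F \<and> F \<subseteq> I \<and> (\<Oplus>\<^bsub>A\<^esub>i\<in>F. add_pow A (c i :: int) (h (f i))) = \<zero>\<^bsub>A\<^esub>" "i \<in> F"
  then show "c i = 0"
    using additive_combination[where h = h and f = f and c = c and F = F, OF A closed add]
      f indep[of F c i] by (auto simp: subset_iff)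
qed

section \<open>Linear independence\<close>

text \<open>The anti-automorphism that exchanges the two families: the relations of the nilHecke algebra are
  stable under it.\<close>

definition reversal :: "'g free_elt \<Rightarrow> 'g free_elt" where
  "reversal = frag_extend (\<lambda>w. frag_of (FM (rev (letters w))))"

lemma reversal_diff: "reversal (a - b) = reversal a - reversal b"
  by (simp add: reversal_def frag_extend_diff)

lemma reversal_add: "reversal (a + b) = reversal a + reversal b"
  by (simp add: reversal_def frag_extend_add)

lemma reversal_cmul: "reversal (frag_cmul c a) = frag_cmul c (reversal a)"
  by (simp add: reversal_def frag_extend_cmul)

lemma reversal_0 [simp]: "reversal 0 = 0"
  by (simp add: reversal_def)

lemma reversal_1 [simp]: "reversal 1 = 1"
  by (simp add: reversal_def one_eq_empty_word)

lemma reversal_gen [simp]: "reversal (free_gen g) = free_gen g"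
  by (simp add: reversal_def free_gen_def)

lemma reversal_sum: "reversal (\<Sum>i\<in>F. f i) = (\<Sum>i\<in>F. reversal (f i))"
  by (induction F rule: infinite_finite_induct) (auto simp: reversal_add)

lemma reversal_mult: "reversal (f * g) = reversal g * reversal f"
proof -
  have "Poly_Mapping.keys f \<subseteq> UNIV" by simp
  then show ?thesis
  proof (induction f rule: frag_induction)
    case (one u)
    have "Poly_Mapping.keys g \<subseteq> UNIV" by simp
    then show ?case
    proof (induction g rule: frag_induction)
      case (one v)
      show ?case
        using frag_of_word_mult[of "letters u" "letters v"]
          frag_of_word_mult[of "rev (letters v)" "rev (letters u)"]
        by (simp add: reversal_def)
    qed (auto simp: reversal_diff algebra_simps)
  qed (auto simp: reversal_diff algebra_simps)
qed

lemma reversal_reversal [simp]: "reversal (reversal f) = f"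
proof -
  have "f \<in> carrier (free_alg UNIV)" by simp
  then show ?thesis
    by (induction f rule: free_alg_induct) (auto simp: reversal_mult reversal_diff)
qed

lemma reversal_closed: "f \<in> carrier (free_alg G) \<Longrightarrow> reversal f \<in> carrier (free_alg G)"
  by (induction f rule: free_alg_induct) (auto simp: reversal_mult reversal_diff)

lemma reversal_x_word: "reversal (x_word js) = x_word (rev js)"
  by (induction js) (auto simp: reversal_mult)

lemma reversal_del_word: "reversal (del_word ks) = del_word (rev ks)"
  by (induction ks) (auto simp: reversal_mult)

context positive_rank
begin

lemma reversal_nh_rel:
  assumes r: "r \<in> nh_rels n"
  shows "reversal r \<in> nh.rel_ideal"
proof -
  let ?X = "{xvar i * del i + del i * xvar (i+1) - 1 | i. i \<in> {1..<n}}"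
  let ?Y = "{del i * xvar i + xvar (i+1) * del i - 1 | i. i \<in> {1..<n}}"
  have XY: "?X \<subseteq> nh_rels n" "?Y \<subseteq> nh_rels n"
    unfolding nh_rels_def by blast+
  note rev = reversal_add reversal_diff reversal_mult
  consider "r \<in> ?X" | "r \<in> ?Y" | "r \<notin> ?X" "r \<notin> ?Y" by blast
  then have "reversal r \<in> nh_rels n"
  proof cases
    case 1
    then have "reversal r \<in> ?Y" by (auto simp: rev add.commute)
    then show ?thesis using XY by blast
  next
    case 2
    then have "reversal r \<in> ?X" by (auto simp: rev add.commute)
    then show ?thesis using XY by blast
  next
    case 3
    then have "reversal r = r"
      using r unfolding nh_rels_def pol_rels_def
      by (elim UnE) (auto simp: rev mult.assoc add.commute split: if_splits)
    then show ?thesis using r by simp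
  qed
  then show ?thesis by (rule nh.rel_ideal_rel)
qed

lemma reversal_nh_ideal: "f \<in> nh.rel_ideal \<Longrightarrow> reversal f \<in> nh.rel_ideal"
proof (induction rule: nh.rel_ideal_induct)
  case (left a b)
  then show ?case using nh.rel_ideal_right reversal_closed by (auto simp: reversal_mult)
next
  case (right a b)
  then show ?case using nh.rel_ideal_left reversal_closed by (auto simp: reversal_mult)
qed (auto simp: reversal_nh_rel reversal_diff nh.rel_ideal_diff)

lemma one_notin_pol_ideal: "1 \<notin> pol.rel_ideal"
proof
  assume 1: "1 \<in> pol.rel_ideal"
  let ?z = "\<lambda>i\<in>{1..n}. 0 :: nat"
  have z: "?z \<in> exponents n" by (auto simp: exponents_def)
  have "x_monomial n ?z * 1 \<in> pol.rel_ideal"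
    by (rule pol.rel_ideal_left[OF x_monomial_closed 1])
  then have "(1 :: int) = 0"
    using x_monomials_independent[of "{?z}" "\<lambda>_. 1" ?z] z by simp
  then show False by simp
qed

text \<open>No length has to be counted: a word that is not reduced acts by zero, and this one does not.\<close>

lemma long_word_reduced: "reduced_expression n w_long long_word"
proof (rule ccontr)
  assume "\<not> ?thesis"
  then have "del_word long_word \<in> nh.rel_ideal"
    using del_word_not_reduced[OF long_word_set] by (simp add: word_prod_long_word)
  then have "act (del_word long_word) stair_product \<in> pol.rel_ideal"
    using act_nh_ideal stair_product_closed by blast
  then show False
    using act_long_word pol.sim_0 pol.sim_trans[OF pol.sim_sym] one_notin_pol_ideal by metis
qed

lemma complement:
  assumes "w \<in> W"
  shows "winv w \<circ> w_long \<in> W" "len (winv w \<circ> w_long) + len w = len w_long"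
    "w \<circ> (winv w \<circ> w_long) = w_long"
    "v \<in> W \<Longrightarrow> v \<circ> (winv w \<circ> w_long) = w_long \<Longrightarrow> v = w"
proof -
  have b: "bij w" by (rule weyl_bij[OF assms])
  show W: "winv w \<circ> w_long \<in> W"
    by (intro weyl_comp weyl_inv w_long_W assms)
  have "winv w \<circ> w_long = winv (w_long \<circ> w)"
    using inv_w_long[OF assms] by simp
  then show "len (winv w \<circ> w_long) + len w = len w_long"
    using len_inv[OF weyl_comp[OF w_long_W assms]] len_w_long[OF assms] by simp
  show "w \<circ> (winv w \<circ> w_long) = w_long"
    using b by (simp add: fun_eq_iff bij_is_surj surj_f_inv_f)
  assume "v \<in> W" "v \<circ> (winv w \<circ> w_long) = w_long"
  then have "v \<circ> (winv w \<circ> w_long) \<circ> w_long \<circ> w = w_long \<circ> w_long \<circ> w" by simp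
  moreover have "v \<circ> (winv w \<circ> w_long) \<circ> w_long \<circ> w = v \<circ> (winv w \<circ> ((w_long \<circ> w_long) \<circ> w))"
    by (simp only: comp_assoc)
  moreover have "winv w \<circ> w = id" using b by (simp add: bij_is_inj)
  ultimately show "v = w" by (simp only: w_long_w_long id_comp comp_id)
qed

text \<open>Take \<open>w\<^sub>0\<close> of minimal length among the elements with a nonzero coefficient, and its complement
  \<open>u\<close> with \<open>w\<^sub>0 u\<close> the longest element.  For any other \<open>w\<close> in the relation \<open>red w @ red u\<close> is not
  reduced: otherwise \<open>w u\<close> would be at least as long as the longest element, hence equal to it,
  and \<open>w\<close> would be \<open>w\<^sub>0\<close>.\<close>

lemma action_independent:
  assumes red: "\<And>w. w \<in> W \<Longrightarrow> reduced_expression n w (red w)"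
    and F: "finite F" "F \<subseteq> W \<times> exponents n"
    and zero: "\<And>m. m \<in> free_pol \<Longrightarrow>
      act (\<Sum>i\<in>F. frag_cmul (c i) (x_monomial n (snd i) * del_word (red (fst i)))) m \<in> pol.rel_ideal"
    and i: "i \<in> F"
  shows "c i = 0"
proof (rule ccontr)
  assume "c i \<noteq> 0"
  define S where "S = {i \<in> F. c i \<noteq> 0}"
  have "finite S" "S \<noteq> {}" using F i \<open>c i \<noteq> 0\<close> by (auto simp: S_def)
  then obtain i0 where i0: "i0 \<in> S" "\<And>i. i \<in> S \<Longrightarrow> len (fst i0) \<le> len (fst i)"
    using ex_is_arg_min_if_finite[of S "\<lambda>i. len (fst i)"] unfolding is_arg_min_linorder by blast
  define w0 where "w0 = fst i0"
  define u where "u = winv w0 \<circ> w_long"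
  have w0: "w0 \<in> W" using i0(1) F by (auto simp: S_def w0_def)
  note u = complement[OF w0, folded u_def]
  have set_red: "set (red w) \<subseteq> {1..n}" "word_prod n (red w) = w" "length (red w) = len w" if "w \<in> W" for w
    using red[OF that] by (simp_all add: reduced_iff)
  define p where "p = act (del_word (red u)) stair_product"
  have p: "p \<in> free_pol"
    unfolding p_def using set_red[OF u(1)] by (intro act_del_word_closed stair_product_closed)
  have other: "act (del_word (red w)) p \<in> pol.rel_ideal" if w: "w \<in> W" "w \<noteq> w0" "len w0 \<le> len w" for w
  proof -
    have word: "set (red w @ red u) \<subseteq> {1..n}" "word_prod n (red w @ red u) = w \<circ> u"
      using set_red[OF w(1)] set_red[OF u(1)] by (simp_all add: word_prod_append)
    have "\<not> reduced_expression n (w \<circ> u) (red w @ red u)"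
    proof
      assume "reduced_expression n (w \<circ> u) (red w @ red u)"
      then have "len (w \<circ> u) = len w + len u"
        using set_red[OF w(1)] set_red[OF u(1)] by (simp add: reduced_iff)
      moreover have "len (w \<circ> u) \<le> len w_long"
        by (rule len_le_w_long[OF weyl_comp[OF w(1) u(1)]])
      ultimately have "len (w \<circ> u) = len w_long" using u(2) w(3) by simp
      then have "w \<circ> u = w_long" by (rule len_eq_w_long[OF weyl_comp[OF w(1) u(1)]])
      then show False using u(4)[OF w(1)] w(2) by blast
    qed
    then have "del_word (red w @ red u) \<in> nh.rel_ideal"
      using del_word_not_reduced[OF word(1)] word(2) by simp
    then have "act (del_word (red w @ red u)) stair_product \<in> pol.rel_ideal"
      by (rule act_nh_ideal[OF _ stair_product_closed])
    then show ?thesis by (simp add: p_def nh_op.action_mult)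
  qed
  have "reduced_expression n w_long (red w0 @ red u)"
    using set_red[OF w0] set_red[OF u(1)] u(2,3) by (simp add: reduced_iff word_prod_append)
  then have "nh.sim (del_word (red w0 @ red u)) (del_word long_word)"
    using del_word_reduced long_word_reduced by blast
  then have "pol.sim (act (del_word (red w0 @ red u)) stair_product) (act (del_word long_word) stair_product)"
    unfolding nh.sim_def pol.sim_def
    using act_nh_ideal[OF _ stair_product_closed]
    by (auto simp flip: nh_op.action_diff nh_op.action_add)
  then have "pol.sim (act (del_word (red w0)) p) 1"
    using pol.sim_trans[OF _ act_long_word] by (simp add: p_def nh_op.action_mult)
  \<comment> \<open>The sign \<open>e\<close> depends on \<open>w0\<close> only, hence is common to all terms that survive.\<close>
  then obtain e :: int where e: "e \<noteq> 0" "act (del_word (red w0)) p - frag_cmul e 1 \<in> pol.rel_ideal"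
    unfolding pol.sim_def by (metis frag_cmul_one frag_cmul_minus_one diff_minus_eq_add neg_equal_0_iff_equal zero_neq_one)
  define H where "H = {r. (w0, r) \<in> F}"
  have H: "finite H" "H \<subseteq> exponents n"
    using F finite_subset[of "Pair w0 ` H" F] finite_imageD[of "Pair w0" H]
    by (auto simp: H_def inj_on_def)
  let ?t = "\<lambda>i. frag_cmul (c i) (x_monomial n (snd i) * act (del_word (red (fst i))) p)"
  let ?e = "\<lambda>r. frag_cmul (c (w0, r) * e) (x_monomial n r)"
  have act_t: "act (frag_cmul (c i) (x_monomial n (snd i) * del_word (red (fst i)))) p = ?t i" for i
    by (simp add: nh_op.action_cmul nh_op.action_mult act_pol)
  have "(\<Sum>i\<in>F. ?t i) \<in> pol.rel_ideal"
    using zero[OF p] by (simp add: nh_op.action_sum act_t)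
  moreover have "(\<Sum>i\<in>F - Pair w0 ` H. ?t i) \<in> pol.rel_ideal"
  proof (rule pol.rel_ideal_sum)
    fix i assume "i \<in> F - Pair w0 ` H"
    then have i: "i \<in> F" "fst i \<noteq> w0" by (cases i; auto simp: H_def)+
    show "?t i \<in> pol.rel_ideal"
    proof (cases "c i = 0")
      case False
      then have "len w0 \<le> len (fst i)" using i0(2)[of i] i by (simp add: S_def w0_def)
      then show ?thesis
        using i F(2) by (intro pol.rel_ideal_cmul pol.rel_ideal_left other) auto
    qed simp
  qed
  moreover have "(\<Sum>i\<in>F. ?t i) = (\<Sum>i\<in>F - Pair w0 ` H. ?t i) + (\<Sum>i\<in>Pair w0 ` H. ?t i)"
    using F(1) by (intro sum.subset_diff) (auto simp: H_def)
  ultimately have "(\<Sum>i\<in>Pair w0 ` H. ?t i) \<in> pol.rel_ideal"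
    using pol.rel_ideal_diff[of "\<Sum>i\<in>F. ?t i" "\<Sum>i\<in>F - Pair w0 ` H. ?t i"] by simp
  moreover have "(\<Sum>i\<in>Pair w0 ` H. ?t i) = (\<Sum>r\<in>H. ?t (w0, r))"
    by (subst sum.reindex) (auto simp: inj_on_def)
  moreover have "(\<Sum>r\<in>H. ?t (w0, r) - ?e r) \<in> pol.rel_ideal"
  proof (rule pol.rel_ideal_sum)
    fix r
    have "frag_cmul (c (w0, r)) (x_monomial n r * (act (del_word (red w0)) p - frag_cmul e 1)) \<in> pol.rel_ideal"
      using e(2) by (intro pol.rel_ideal_cmul pol.rel_ideal_left) auto
    moreover have "frag_cmul (c (w0, r)) (x_monomial n r * (act (del_word (red w0)) p - frag_cmul e 1)) =
        ?t (w0, r) - ?e r"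
      by (simp add: right_diff_distrib free_mult_cmul frag_cmul_diff_distrib2)
    ultimately show "?t (w0, r) - ?e r \<in> pol.rel_ideal" by simp
  qed
  ultimately have "(\<Sum>r\<in>H. ?e r) \<in> pol.rel_ideal"
    using pol.rel_ideal_diff[of "\<Sum>r\<in>H. ?t (w0, r)" "\<Sum>r\<in>H. ?t (w0, r) - ?e r"]
    by (simp add: sum_subtractf)
  moreover have "snd i0 \<in> H" using i0(1) by (simp add: H_def S_def w0_def)
  ultimately have "c (w0, snd i0) * e = 0"
    using x_monomials_independent[OF H, of "\<lambda>r. c (w0, r) * e"] by simp
  then show False using e(1) i0(1) by (simp add: S_def w0_def)
qed

text \<open>Write the element in the spanning family; by independence of the operators all
  coefficients vanish.\<close>

lemma nh_faithful:
  assumes red: "\<And>w. w \<in> W \<Longrightarrow> reduced_expression n w (red w)"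
    and f: "f \<in> free_nh" and zero: "\<And>m. m \<in> free_pol \<Longrightarrow> act f m \<in> pol.rel_ideal"
  shows "f \<in> nh.rel_ideal"
proof -
  let ?v = "\<lambda>i. x_monomial n (snd i) * del_word (red (fst i))"
  have v: "(\<lambda>(w, r). x_monomial n r * del_word (red w)) = ?v" by (simp add: fun_eq_iff split: prod.split)
  obtain F c where F: "finite F" "F \<subseteq> W \<times> exponents n"
    "f - (\<Sum>i\<in>F. frag_cmul (c i) (?v i)) \<in> nh.rel_ideal"
    using nh.spanned_combination[OF nh_spanned[OF red f]] unfolding v by blast
  have "act (\<Sum>i\<in>F. frag_cmul (c i) (?v i)) m \<in> pol.rel_ideal" if "m \<in> free_pol" for m
    using pol.rel_ideal_diff[OF zero[OF that] act_nh_ideal[OF F(3) that]]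
    by (simp add: nh_op.action_diff)
  then have "c i = 0" if "i \<in> F" for i
    using action_independent[OF red F(1,2) _ that] by blast
  then show ?thesis using F(3) by simp
qed

lemma x_then_del_independent:
  assumes red: "\<And>w. w \<in> W \<Longrightarrow> reduced_expression n w (red w)"
    and F: "finite F" "F \<subseteq> W \<times> exponents n" "i \<in> F"
    and "(\<Sum>i\<in>F. frag_cmul (c i) (x_monomial n (snd i) * del_word (red (fst i)))) \<in> nh.rel_ideal"
  shows "c i = 0"
  using action_independent[OF red F(1,2) act_nh_ideal[OF assms(5)] F(3)] .

text \<open>Reversing the word chosen for \<open>w\<inverse>\<close> is again an admissible choice for \<open>w\<close>.  So the results on the
  first family, for this other choice, can be transported by \<open>reversal\<close>.\<close>

lemma reversed_reduced:
  assumes red: "\<And>w. w \<in> W \<Longrightarrow> reduced_expression n w (red w)" and w: "w \<in> W"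
  shows "reduced_expression n w (rev (red (winv w)))"
proof -
  have r: "set (red (winv w)) \<subseteq> {1..n}" "word_prod n (red (winv w)) = winv w" "length (red (winv w)) = len w"
    using red[OF weyl_inv[OF w]] len_inv[OF w] by (simp_all add: reduced_iff)
  have "word_prod n (rev (red (winv w))) = winv (winv w)"
    using word_inv[OF r(1)] r(2) by simp
  also have "\<dots> = w" using weyl_bij[OF w] by (simp add: inv_inv_eq)
  finally show ?thesis using r by (simp add: reduced_iff)
qed

lemma reversal_x_monomial: "pol.sim (reversal (x_monomial n r)) (x_monomial n r)"
  unfolding x_monomial_x_word reversal_x_word by (rule x_word_mset) auto

lemma winv_winv: "w \<in> W \<Longrightarrow> winv (winv w) = w"
  by (simp add: weyl_bij inv_inv_eq)

lemma del_then_x_independent: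
  assumes red: "\<And>w. w \<in> W \<Longrightarrow> reduced_expression n w (red w)"
    and F: "finite F" "F \<subseteq> W \<times> exponents n" "i \<in> F"
    and zero: "(\<Sum>i\<in>F. frag_cmul (c i) (del_word (red (fst i)) * x_monomial n (snd i))) \<in> nh.rel_ideal"
  shows "c i = 0"
proof -
  define red' where "red' w = rev (red (winv w))" for w
  have red': "reduced_expression n w (red' w)" if "w \<in> W" for w
    unfolding red'_def by (rule reversed_reduced[OF red that])
  have "\<exists>e. (e = 1 \<or> e = - 1) \<and> reversal (x_monomial n r) - frag_cmul e (x_monomial n r) \<in> pol.rel_ideal" for r
    using reversal_x_monomial[of r] unfolding pol.sim_def
    by (elim disjE) (rule exI[of _ 1], simp, rule exI[of _ "- 1"], simp)
  then obtain e :: "(nat \<Rightarrow> nat) \<Rightarrow> int" where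
    e: "e r = 1 \<or> e r = - 1" "reversal (x_monomial n r) - frag_cmul (e r) (x_monomial n r) \<in> pol.rel_ideal" for r
    by metis
  \<comment> \<open>Modulo the relations, reversal sends the term of \<open>(w, r)\<close> to \<open>e r\<close> times that of \<open>(w\<inverse>, r)\<close> for
    \<open>red'\<close>; the sign \<open>e r\<close> comes from reordering the monomial.\<close>
  define \<sigma> :: "(int \<Rightarrow> int) \<times> (nat \<Rightarrow> nat) \<Rightarrow> _" where "\<sigma> i = (winv (fst i), snd i)" for i
  have \<sigma>: "\<sigma> (\<sigma> i) = i" "\<sigma> i \<in> W \<times> exponents n" if "i \<in> W \<times> exponents n" for i
    using that by (auto simp: \<sigma>_def winv_winv weyl_inv)
  have inj: "inj_on \<sigma> F"
    using \<sigma>(1) F(2) by (metis inj_on_inverseI subsetD)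
  let ?a = "\<lambda>i. frag_cmul (c i) (reversal (x_monomial n (snd i)) * del_word (rev (red (fst i))))"
  let ?b = "\<lambda>i. frag_cmul (c i * e (snd i)) (x_monomial n (snd i) * del_word (rev (red (fst i))))"
  let ?d = "\<lambda>i. frag_cmul (c (\<sigma> i) * e (snd i)) (x_monomial n (snd i) * del_word (red' (fst i)))"
  have "(\<Sum>i\<in>F. ?a i) \<in> nh.rel_ideal"
    using reversal_nh_ideal[OF zero]
    by (simp add: reversal_sum reversal_cmul reversal_mult reversal_del_word)
  moreover have "(\<Sum>i\<in>F. ?a i - ?b i) \<in> nh.rel_ideal"
  proof (rule nh.rel_ideal_sum)
    fix i assume "i \<in> F"
    then have "fst i \<in> W" using F(2) by (auto simp: mem_Times_iff)
    then have "set (rev (red (fst i))) \<subseteq> {1..n}"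
      using red[of "fst i"] by (simp add: reduced_iff)
    then have "frag_cmul (c i) ((reversal (x_monomial n (snd i)) - frag_cmul (e (snd i)) (x_monomial n (snd i))) *
        del_word (rev (red (fst i)))) \<in> nh.rel_ideal"
      by (intro nh.rel_ideal_cmul nh.rel_ideal_right pol_ideal_nh e del_word_closed)
    then show "?a i - ?b i \<in> nh.rel_ideal"
      by (simp add: left_diff_distrib frag_cmul_diff_distrib2 free_cmul_mult)
  qed
  ultimately have "(\<Sum>i\<in>F. ?b i) \<in> nh.rel_ideal"
    using nh.rel_ideal_diff[of "\<Sum>i\<in>F. ?a i" "\<Sum>i\<in>F. ?a i - ?b i"] by (simp add: sum_subtractf)
  also have "(\<Sum>i\<in>F. ?b i) = (\<Sum>i\<in>F. ?d (\<sigma> i))"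
  proof (rule sum.cong[OF HOL.refl])
    fix i assume "i \<in> F"
    then have "i \<in> W \<times> exponents n" using F(2) by blast
    then show "?b i = ?d (\<sigma> i)"
      using \<sigma>(1)[of i] by (auto simp: red'_def \<sigma>_def winv_winv)
  qed
  also have "\<dots> = (\<Sum>i\<in>\<sigma> ` F. ?d i)"
    by (simp only: sum.reindex[OF inj] o_def)
  finally have sum_d: "(\<Sum>i\<in>\<sigma> ` F. ?d i) \<in> nh.rel_ideal" .
  have \<sigma>F: "finite (\<sigma> ` F)" "\<sigma> ` F \<subseteq> W \<times> exponents n" "\<sigma> i \<in> \<sigma> ` F"
    using F \<sigma>(2) by blast+
  have "c (\<sigma> (\<sigma> i)) * e (snd (\<sigma> i)) = 0"
  proof -
    define d where "d i = c (\<sigma> i) * e (snd i)" for i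
    have "d (\<sigma> i) = 0"
      by (rule x_then_del_independent[where red = red' and F = "\<sigma> ` F" and c = d])
        (use red' \<sigma>F sum_d in \<open>simp_all only: d_def\<close>)
    then show ?thesis by (simp only: d_def)
  qed
  moreover have "\<sigma> (\<sigma> i) = i" using F(2,3) by (intro \<sigma>(1)) blast
  moreover have "e (snd (\<sigma> i)) \<noteq> 0" using e(1)[of "snd (\<sigma> i)"] by linarith
  ultimately show ?thesis by (metis mult_eq_0_iff)
qed

lemma nh_spanned_del_then_x:
  assumes red: "\<And>w. w \<in> W \<Longrightarrow> reduced_expression n w (red w)"
    and f: "f \<in> free_nh"
  shows "nh.spanned (\<lambda>(w, r). del_word (red w) * x_monomial n r) (W \<times> exponents n) f"
    (is "nh.spanned ?v ?I _")
proof -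
  define red' where "red' w = rev (red (winv w))" for w
  have red': "reduced_expression n w (red' w)" if "w \<in> W" for w
    unfolding red'_def by (rule reversed_reduced[OF red that])
  have "nh.spanned ?v ?I (reversal g)"
    if "nh.spanned (\<lambda>(w, r). x_monomial n r * del_word (red' w)) (W \<times> exponents n) g" for g
    using that
  proof (induction rule: nh.spanned.induct)
    case (ideal f)
    then show ?case by (intro nh.spanned.ideal reversal_nh_ideal)
  next
    case (diff f g)
    then show ?case by (simp add: reversal_diff nh.spanned.diff)
  next
    case (base i)
    then obtain w r where i: "i = (w, r)" "w \<in> W" "r \<in> exponents n" by auto
    have "set (red (winv w)) \<subseteq> {1..n}"
      using red[OF weyl_inv[OF i(2)]] by (simp add: reduced_iff)
    then have "nh.sim (del_word (red (winv w)) * reversal (x_monomial n r)) (del_word (red (winv w)) * x_monomial n r)"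
      by (intro nh.sim_left pol_sim_nh reversal_x_monomial del_word_closed)
    moreover have "nh.spanned ?v ?I (del_word (red (winv w)) * x_monomial n r)"
      using nh.spanned.base[of "(winv w, r)" ?I ?v] i weyl_inv by simp
    ultimately have "nh.spanned ?v ?I (del_word (red (winv w)) * reversal (x_monomial n r))"
      by (rule nh.spanned_sim)
    then show ?case
      by (simp add: i red'_def reversal_mult reversal_del_word)
  qed
  from this[OF nh_spanned[OF red' reversal_closed[OF f]]] show ?thesis by simp
qed

lemma End_zero_iff:
  assumes "f \<in> free_nh"
  shows "act_End f = \<zero>\<^bsub>End_ring (Pol n)\<^esub> \<longleftrightarrow> (\<forall>m\<in>free_pol. act f m \<in> pol.rel_ideal)"
proof -
  have z: "\<zero>\<^bsub>End_ring (Pol n)\<^esub> (pol.cls m) = pol.cls 0" if "m \<in> free_pol" for m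
    using that by (simp add: End_ring_def Pol_eq pol.cls_zero)
  have iff: "pol.cls (act f m) = pol.cls 0 \<longleftrightarrow> act f m \<in> pol.rel_ideal" if "m \<in> free_pol" for m
    using pol.cls_eq_iff[of "act f m" 0] act_closed[OF assms that] by simp
  show ?thesis
  proof
    assume "act_End f = \<zero>\<^bsub>End_ring (Pol n)\<^esub>"
    then show "\<forall>m\<in>free_pol. act f m \<in> pol.rel_ideal"
      using act_End(2)[OF assms] z iff by metis
  next
    assume "\<forall>m\<in>free_pol. act f m \<in> pol.rel_ideal"
    then show "act_End f = \<zero>\<^bsub>End_ring (Pol n)\<^esub>"
      using act_End(2)[OF assms] z iff
      by (intro End_eqI act_End_extensional) (auto simp: End_ring_def)
  qed
qed

lemma abelian_group_End: "abelian_group (End_ring (Pol n))"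
  using ring_End_ring[OF ring_Pol] by (rule ring.is_abelian_group)

lemma abelian_group_NH: "abelian_group nh.alg"
  using nh.ring_alg by (rule ring.is_abelian_group)

lemma act_End_add:
  assumes "f \<in> free_nh" "g \<in> free_nh"
  shows "act_End (f + g) = act_End f \<oplus>\<^bsub>End_ring (Pol n)\<^esub> act_End g"
  using assms
  by (intro End_eqI act_End_extensional)
    (simp_all add: End_ring_def act_End act_closed nh_op.action_add Pol_eq flip: pol.cls_ops)

text \<open>Faithfulness turns independence in the nilHecke algebra into independence of the operators, so for
  either family only the statements modulo the relations remain.\<close>

lemma independent_and_basis:
  fixes v :: "(int \<Rightarrow> int) \<times> (nat \<Rightarrow> nat) \<Rightarrow> generator free_elt"
  assumes red: "\<And>w. w \<in> W \<Longrightarrow> reduced_expression n w (red w)"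
    and v: "\<And>i. i \<in> I \<Longrightarrow> v i \<in> free_nh"
    and indep: "\<And>F c i. finite F \<Longrightarrow> F \<subseteq> I \<Longrightarrow> i \<in> F \<Longrightarrow>
      (\<Sum>i\<in>F. frag_cmul (c i) (v i)) \<in> nh.rel_ideal \<Longrightarrow> c i = 0"
    and span: "\<And>f. f \<in> free_nh \<Longrightarrow> nh.spanned v I f"
  shows "int_independent (End_ring (Pol n)) (\<lambda>i. nh_action n (nh_class n (v i))) I \<and>
    int_basis (NH n) (\<lambda>i. nh_class n (v i)) I"
proof
  have sum_closed: "(\<Sum>i\<in>F. frag_cmul (c i) (v i)) \<in> free_nh" if "F \<subseteq> I" for F c
    using that by (intro carrier_sum carrier_cmul v) auto
  show "int_independent (End_ring (Pol n)) (\<lambda>i. nh_action n (nh_class n (v i))) I"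
  proof (rule int_independentI[OF abelian_group_End, where G = "nh_gens n" and h = "\<lambda>f. nh_action n (nh_class n f)"])
    fix F c i
    assume F: "finite F" "F \<subseteq> I" "i \<in> F"
      and "nh_action n (nh_class n (\<Sum>i\<in>F. frag_cmul (c i) (v i))) = \<zero>\<^bsub>End_ring (Pol n)\<^esub>"
    then have "(\<Sum>i\<in>F. frag_cmul (c i) (v i)) \<in> nh.rel_ideal"
      using nh_faithful[OF red sum_closed[OF F(2)]]
      by (simp add: nh_action_class sum_closed End_zero_iff)
    then show "c i = 0" by (rule indep[OF F])
  qed (simp_all add: nh_action_class act_End act_End_add v)
  have "int_independent nh.alg (\<lambda>i. nh.cls (v i)) I"
  proof (rule int_independentI[OF abelian_group_NH, where G = "nh_gens n"])
    fix F c i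
    assume F: "finite F" "F \<subseteq> I" "i \<in> F"
      and "nh.cls (\<Sum>i\<in>F. frag_cmul (c i) (v i)) = \<zero>\<^bsub>nh.alg\<^esub>"
    then have "(\<Sum>i\<in>F. frag_cmul (c i) (v i)) \<in> nh.rel_ideal"
      using nh.cls_eq_iff[OF sum_closed[OF F(2)], of 0] by (simp add: nh.cls_zero)
    then show "c i = 0" by (rule indep[OF F])
  qed (simp_all add: nh.cls_ops v)
  moreover have "\<exists>F c. finite F \<and> F \<subseteq> I \<and> a = (\<Oplus>\<^bsub>nh.alg\<^esub>i\<in>F. add_pow nh.alg (c i :: int) (nh.cls (v i)))"
    if a: "a \<in> carrier nh.alg" for a
  proof -
    obtain f where f: "f \<in> free_nh" "a = nh.cls f" using a by (rule nh.alg_cases)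
    obtain F c where F: "finite F" "F \<subseteq> I" "f - (\<Sum>i\<in>F. frag_cmul (c i) (v i)) \<in> nh.rel_ideal"
      using nh.spanned_combination[OF span[OF f(1)]] by blast
    have "a = nh.cls (\<Sum>i\<in>F. frag_cmul (c i) (v i))"
      using f F(3) nh.cls_eq_iff[OF f(1) sum_closed[OF F(2)]] by simp
    also have "\<dots> = (\<Oplus>\<^bsub>nh.alg\<^esub>i\<in>F. add_pow nh.alg (c i) (nh.cls (v i)))"
      using F(1,2) v
      by (intro additive_combination[symmetric, OF abelian_group_NH, where G = "nh_gens n"])
        (auto simp: nh.cls_ops)
    finally show ?thesis using F(1,2) by blast
  qed
  ultimately show "int_basis (NH n) (\<lambda>i. nh_class n (v i)) I"
    unfolding int_basis_def NH_eq nh_class_eq by blast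
qed

end

theorem proposition4p4:
  fixes n :: nat and red :: "(int \<Rightarrow> int) \<Rightarrow> nat list"
  assumes "n \<ge> 1"
    and "\<And>w. w \<in> weyl_B n \<Longrightarrow> reduced_expression n w (red w)"
  shows "int_independent (End_ring (Pol n))
           (\<lambda>(w, r). nh_action n (nh_class n (x_monomial n r * del_word (red w))))
           (weyl_B n \<times> exponents n)
       \<and> int_independent (End_ring (Pol n))
           (\<lambda>(w, r). nh_action n (nh_class n (del_word (red w) * x_monomial n r)))
           (weyl_B n \<times> exponents n)
       \<and> int_basis (NH n)
           (\<lambda>(w, r). nh_class n (x_monomial n r * del_word (red w)))
           (weyl_B n \<times> exponents n)
       \<and> int_basis (NH n)
           (\<lambda>(w, r). nh_class n (del_word (red w) * x_monomial n r))
           (weyl_B n \<times> exponents n)"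
proof -
  interpret positive_rank n by standard (rule assms(1))
  let ?I = "weyl_B n \<times> exponents n"
  let ?v = "\<lambda>i. x_monomial n (snd i) * del_word (red (fst i))"
  let ?v' = "\<lambda>i. del_word (red (fst i)) * x_monomial n (snd i)"
  have closed: "?v i \<in> free_nh" "?v' i \<in> free_nh" if "i \<in> ?I" for i
  proof -
    have "fst i \<in> weyl_B n" using that by (simp add: mem_Times_iff)
    then have "del_word (red (fst i)) \<in> free_nh"
      using assms(2) by (intro del_word_closed) (simp add: reduced_iff)
    then show "?v i \<in> free_nh" "?v' i \<in> free_nh"
      using free_pol_nh[OF x_monomial_closed] by simp_all
  qed
  have span: "nh.spanned ?v ?I f" "nh.spanned ?v' ?I f" if "f \<in> free_nh" for f
    using nh_spanned[OF assms(2) that] nh_spanned_del_then_x[OF assms(2) that]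
    by (simp_all only: case_prod_unfold)
  have "int_independent (End_ring (Pol n)) (\<lambda>i. nh_action n (nh_class n (?v i))) ?I \<and>
      int_basis (NH n) (\<lambda>i. nh_class n (?v i)) ?I"
  proof (rule independent_and_basis[where red = red])
    fix F c i
    assume "finite F" "F \<subseteq> ?I" "i \<in> F" "(\<Sum>i\<in>F. frag_cmul (c i) (?v i)) \<in> nh.rel_ideal"
    then show "c i = 0"
      using x_then_del_independent[where red = red and F = F and c = c and i = i] assms(2) by blast
  qed (use assms(2) closed(1) span(1) in blast)+
  moreover have "int_independent (End_ring (Pol n)) (\<lambda>i. nh_action n (nh_class n (?v' i))) ?I \<and>
      int_basis (NH n) (\<lambda>i. nh_class n (?v' i)) ?I"
  proof (rule independent_and_basis[where red = red])
    fix F c i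
    assume "finite F" "F \<subseteq> ?I" "i \<in> F" "(\<Sum>i\<in>F. frag_cmul (c i) (?v' i)) \<in> nh.rel_ideal"
    then show "c i = 0"
      using del_then_x_independent[where red = red and F = F and c = c and i = i] assms(2) by blast
  qed (use assms(2) closed(2) span(2) in blast)+
  ultimately show ?thesis
    unfolding case_prod_unfold by blast
qed

end
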